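(* Let $B$ be a complex Banach space and $\tau\ge2$. If $\lambda\in\underline{\mathrm{DC}}_\tau$, then every monogenic function in $\mathcal M((K_j),B)$ admits a Gevrey-$\tau$ asymptotic expansion at $\lambda$: $$\mathcal M((K_j),B)\subset\mathcal G_\tau(\lambda,B).$$
   Context: **Diophantine points.** For $\gamma>0$, $\tau\ge2$, $\mathrm{DC}(\gamma,\tau)$ is the set of irrational $y\in\mathbb R$ with $|y-n/m|\ge\gamma m^{-\tau}$ for all rationals $n/m$ ($m\ge1$); $\mathrm{DC}_\tau=\bigcup_{\gamma>0}\mathrm{DC}(\gamma,\tau)$ and $\underline{\mathrm{DC}}_\tau=\{e^{2\pi iy}:y\in\mathrm{DC}_\tau\}$. **The compact sets $K_j$.** An irrational class $x\in(\mathbb R\setminus\mathbb Q)/\mathbb Z$ is represented in $]0,1[$ as $x=[0,a_1,a_2,\dots]$ with convergents $n_k(x)/m_k(x)=[0,a_1,\dots,a_k]$ in lowest terms, $k\ge0$ ($n_0/m_0=0/1$). For a decreasing function $\psi$ on $\mathbb N^*$ with $2\sum_{m\ge1}\psi(m)<1$ and $0<\psi(m)\le\frac1{2m}$ (an approximation function), set $C_\psi=\{x\in(\mathbb R\setminus\mathbb Q)/\mathbb Z:\ m_{k+1}(x)\le 1/\psi(m_k(x))\ \forall k\ge0\}$, and for $\kappa\in\,]0,1[$, $d>0$ let $C_{\psi,\kappa,d}\subset\mathbb C/\mathbb Z$ be the set of classes of those $\tilde x\in\mathbb C$ for which there is a lift $\tilde y\in\mathbb R$ of a point of $C_\psi$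 with $\kappa|\mathrm{Re}(\tilde x-\tilde y)|\le|\mathrm{Im}\,\tilde x|\le d$. Fix $\kappa\in\,]0,1[$, $d,\alpha>0$ and a decreasing sequence of positive numbers $(\gamma_j)_{j\ge0}$ tending to $0$ with $\gamma_j<\inf(\frac{\alpha e}2,\frac{e^\alpha-1}2,1)$. Then $\psi_j(m)=\gamma_je^{-\alpha m}$ is an approximation function and $K_j=\{e^{2\pi ix}:x\in C_{\psi_j,\kappa,d}\}$; $(K_j)$ is an increasing sequence of compact subsets of $\mathbb C$. **Monogenic functions.** For $K\subset\mathbb C$ compact, $\mathcal C^1_{hol}(K,B)$ is the space of continuous $f:K\to B$ for which there is a continuous $f^{(1)}:K\to B$ such that for all $z\in K$, $\varepsilon>0$ there is $\delta>0$ with $\|f(z_2)-f(z_1)-f^{(1)}(z_1)(z_2-z_1)\|\le\varepsilon|z_1-z_2|$ for all $z_1,z_2\in K$ with $|z_1-z|<\delta$, $|z_2-z|<\delta$. $\mathcal M((K_j),B)=\varprojlim\mathcal C^1_{hol}(K_j,B)$, i.e. the functions on $\bigcup_jK_j$ whose restriction to each $K_j$ is in $\mathcal C^1_{hol}(K_j,B)$. **Gevrey classes.** Let $\mathbb D=\{|q|<1\}$, $\mathbb E=\{|q|>1\}$, $\mathbb S^1=\{|q|=1\}$. For $\lambda\in\mathbb S^1$, $\mathcal G_\tau(\lambda,B)$ is the space of $B$-valued functions $f$ for which there exist open disks $\Delta^-\subset\mathbb D$ and $\Delta^+\subset\mathbb E$ tangent to $\mathbb S^1$ at $\lambda$ (contained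 in the domain of $f$) on which $f$ is holomorphic, a single formal series $\sum_{n\ge0}a_nQ^n\in B[[Q]]$ and positive numbers $c_0,c_1$ such that for all $N\ge0$ and all $q\in\Delta^-\cup\Delta^+$, $$\Big\|f(q)-\sum_{0\le n\le N-1}a_n(q-\lambda)^n\Big\|\le c_0c_1^N\,\Gamma(1+N\tau)\,|q-\lambda|^N.$$ *)

theory Defs
  imports "HOL-Analysis.Analysis"
begin

class complex_banach = banach +
  fixes scaleC :: "complex \<Rightarrow> 'a \<Rightarrow> 'a"  (infixr \<open>*\<^sub>C\<close> 75)
  assumes scaleC_add_right: "a *\<^sub>C (x + y) = a *\<^sub>C x + a *\<^sub>C y"
    and scaleC_add_left: "(a + b) *\<^sub>C x = a *\<^sub>C x + b *\<^sub>C x"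
    and scaleC_scaleC: "a *\<^sub>C (b *\<^sub>C x) = (a * b) *\<^sub>C x"
    and scaleC_of_real: "complex_of_real r *\<^sub>C x = r *\<^sub>R x"
    and norm_scaleC: "norm (a *\<^sub>C x) = cmod a * norm x"

instantiation complex :: complex_banach
begin

definition scaleC_complex :: "complex \<Rightarrow> complex \<Rightarrow> complex"
  where "scaleC_complex a x = a * x"

instance
  by standard (simp_all add: scaleC_complex_def algebra_simps norm_mult scaleR_conv_of_real)

end

definition holomorphic_banach_on :: "(complex \<Rightarrow> 'b::complex_banach) \<Rightarrow> complex set \<Rightarrow> bool"
  where "holomorphic_banach_on f S \<longleftrightarrow>
    (\<forall>z\<in>S. \<exists>D. (f has_derivative (\<lambda>h. h *\<^sub>C D)) (at z within S))"

definition DC :: "real \<Rightarrow> real \<Rightarrow> real set"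
  where "DC \<gamma> \<tau> = {y. y \<notin> \<rat> \<and>
    (\<forall>(n::int) (m::nat). 1 \<le> m \<longrightarrow> \<bar>y - of_int n / of_nat m\<bar> \<ge> \<gamma> * real m powr (- \<tau>))}"

definition DC_union :: "real \<Rightarrow> real set"
  where "DC_union \<tau> = (\<Union>\<gamma>\<in>{0<..}. DC \<gamma> \<tau>)"

definition exp_2pi_i :: "complex \<Rightarrow> complex"
  where "exp_2pi_i x = exp (2 * of_real pi * \<i> * x)"

definition DC_circle :: "real \<Rightarrow> complex set"
  where "DC_circle \<tau> = {exp_2pi_i (of_real y) | y. y \<in> DC_union \<tau>}"

text \<open>
  For irrational \<open>x\<close>, \<open>cf_rem x k\<close> is the \<open>k\<close>-th iterate of the Gauss map at the
  representative of \<open>x + \<int>\<close> in \<open>]0,1[\<close>. The index of \<open>cf_digit\<close> is shifted by one: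
  \<open>cf_digit x k\<close> is the partial quotient \<open>a\<close> with index \<open>k + 1\<close> in
  \<open>frac x = [0, a\<^sub>1, a\<^sub>2, \<dots>]\<close>.
\<close>

primrec cf_rem :: "real \<Rightarrow> nat \<Rightarrow> real" where
  "cf_rem x 0 = frac x"
| "cf_rem x (Suc k) = frac (1 / cf_rem x k)"

definition cf_digit :: "real \<Rightarrow> nat \<Rightarrow> int"
  where "cf_digit x k = \<lfloor>1 / cf_rem x k\<rfloor>"

primrec cf_eval :: "int list \<Rightarrow> rat" where
  "cf_eval [] = 0"
| "cf_eval (a # as) = 1 / (of_int a + cf_eval as)"

definition cf_convergent :: "real \<Rightarrow> nat \<Rightarrow> rat"
  where "cf_convergent x k = cf_eval (map (cf_digit x) [0..<k])"

definition cf_denom :: "real \<Rightarrow> nat \<Rightarrow> nat"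
  where "cf_denom x k = nat (snd (quotient_of (cf_convergent x k)))"

text \<open>
  Subsets of \<open>\<real>/\<int>\<close> and \<open>\<complex>/\<int>\<close> are represented by their (1-periodic) full preimages
  in \<open>\<real>\<close> and \<open>\<complex>\<close>.
\<close>

definition C_real :: "(nat \<Rightarrow> real) \<Rightarrow> real set"
  where "C_real \<psi> = {y. y \<notin> \<rat> \<and>
    (\<forall>k. real (cf_denom y (Suc k)) \<le> 1 / \<psi> (cf_denom y k))}"

definition C_complex :: "(nat \<Rightarrow> real) \<Rightarrow> real \<Rightarrow> real \<Rightarrow> complex set"
  where "C_complex \<psi> \<kappa> d = {x. \<exists>y\<in>C_real \<psi>.
    \<kappa> * \<bar>Re (x - of_real y)\<bar> \<le> \<bar>Im x\<bar> \<and> \<bar>Im x\<bar> \<le> d}"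

definition psi_exp :: "real \<Rightarrow> real \<Rightarrow> nat \<Rightarrow> real"
  where "psi_exp \<alpha> \<gamma> m = \<gamma> * exp (- \<alpha> * real m)"

definition K_seq :: "real \<Rightarrow> real \<Rightarrow> real \<Rightarrow> (nat \<Rightarrow> real) \<Rightarrow> nat \<Rightarrow> complex set"
  where "K_seq \<kappa> d \<alpha> \<gamma> j = exp_2pi_i ` C_complex (psi_exp \<alpha> (\<gamma> j)) \<kappa> d"

text \<open>
  A function on \<open>S \<subseteq> \<complex>\<close> is represented by a total function whose values outside \<open>S\<close>
  are irrelevant. None of the following notions depends on the values outside the domain, which
  is \<open>K\<close> for \<open>C1_hol\<close>, \<open>\<Union>j. K j\<close> for \<open>monogenic\<close>, and \<open>S\<close> for \<open>gevrey\<close>.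
\<close>

definition C1_hol :: "complex set \<Rightarrow> (complex \<Rightarrow> 'b::complex_banach) set"
  where "C1_hol K = {f. continuous_on K f \<and>
    (\<exists>f1. continuous_on K f1 \<and>
      (\<forall>z\<in>K. \<forall>\<epsilon>>0. \<exists>\<delta>>0. \<forall>z1\<in>K. \<forall>z2\<in>K.
        cmod (z1 - z) < \<delta> \<longrightarrow> cmod (z2 - z) < \<delta> \<longrightarrow>
        norm (f z2 - f z1 - (z2 - z1) *\<^sub>C f1 z1) \<le> \<epsilon> * cmod (z1 - z2)))}"

definition monogenic :: "(nat \<Rightarrow> complex set) \<Rightarrow> (complex \<Rightarrow> 'b::complex_banach) set"
  where "monogenic K = {f. \<forall>j. f \<in> C1_hol (K j)}"

text \<open>Two distinct circles are tangent at a point iff it is their only common point.\<close>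

definition tangent_disk :: "complex \<Rightarrow> complex set \<Rightarrow> bool"
  where "tangent_disk l \<Delta> \<longleftrightarrow>
    (\<exists>c r. r > 0 \<and> \<Delta> = ball c r \<and> sphere c r \<inter> sphere 0 1 = {l})"

definition gevrey :: "real \<Rightarrow> complex \<Rightarrow> complex set \<Rightarrow> (complex \<Rightarrow> 'b::complex_banach) set"
  where "gevrey \<tau> l S = {f. \<exists>\<Delta>m \<Delta>p.
    tangent_disk l \<Delta>m \<and> \<Delta>m \<subseteq> {q. cmod q < 1} \<and> \<Delta>m \<subseteq> S \<and>
    tangent_disk l \<Delta>p \<and> \<Delta>p \<subseteq> {q. cmod q > 1} \<and> \<Delta>p \<subseteq> S \<and>
    holomorphic_banach_on f \<Delta>m \<and> holomorphic_banach_on f \<Delta>p \<and>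
    (\<exists>(a :: nat \<Rightarrow> 'b) (c0 :: real) (c1 :: real). c0 > 0 \<and> c1 > 0 \<and>
      (\<forall>N. \<forall>q \<in> \<Delta>m \<union> \<Delta>p.
        norm (f q - (\<Sum>n<N. (q - l) ^ n *\<^sub>C a n))
          \<le> c0 * c1 ^ N * Gamma (1 + real N * \<tau>) * cmod (q - l) ^ N))}"

end

theory Submission
  imports Defs
begin

text \<open>
  Lift \<open>\<lambda>\<close> to \<open>y0\<close>. A fraction \<open>n/m\<close> within \<open>\<delta>\<close> of \<open>y0\<close> has \<open>m \<ge> const \<cdot> \<delta> powr (-1/\<tau>)\<close>,
  so an interval of length \<open>r\<close> at distance \<open>\<delta>\<close> from \<open>y0\<close> which misses the set \<open>C\<close> of \<open>\<psi>\<^sub>j\<close>, being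
  covered by the intervals of radius \<open>\<psi>\<^sub>j(m)\<close> around such fractions, satisfies
  \<open>r \<le> const \<cdot> \<gamma>\<^sub>j exp (-c \<delta> powr (-1/\<tau>))\<close>. Hence for large \<open>j\<close> the set \<open>K\<^sub>j\<close> contains both
  sides \<open>H(t) \<le> |y| \<le> \<eta>\<close> of an explicit flat gap \<open>H\<close> around the unit circle, in the coordinate
  \<open>q = \<lambda> exp (2\<pi>i(t + iy))\<close>, and \<open>H\<close> closes at \<open>\<lambda>\<close>.

  By Cauchy's formula on both sides of the gap, \<open>2\<pi>i f(q)\<close> is the sum of integrals of
  \<open>f(\<zeta>)/(\<zeta> - q)\<close> over two circles, analytic near \<open>\<lambda>\<close>, and of the difference of the integrals over
  the two boundary curves of the gap. Expand the kernel at \<open>\<lambda>\<close>. As \<open>f\<close> is \<open>C\<^sup>1\<close> in the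
  sense of Whitney, its values at opposite boundary points differ by \<open>O(H)\<close>, and
  \<open>H(t) / |t|^N\<close> is at most \<open>c0 c1^N \<Gamma>(1 + N\<tau>)\<close>.
\<close>

section \<open>Convergents of continued fractions\<close>

text \<open>The obstacle is that the gap closes at \<lambda>, exactly where the kernel is expanded:
  on either boundary curve alone the powers of 1/(\<zeta> - \<lambda>) blow up, so the two curves
  have to be paired at equal \<open>t\<close> before integrating. With w = t(1 - t), which treats
  alike the two ends of the parameter interval representing \<lambda>, tangency keeps the boundary
  points at distance at least of order w^2 from the disks. Besides w^(-N) the kernels therefore cost
  only a fixed power of w. The rate \<open>c\<close> of the flat gap is split into two halves: one
  pays for this power and for the derivative of H, the other yields \<Gamma>(1 + N \<tau>). The rate
  does not depend on \<open>j\<close>, while the factor in front of the exponential becomes as small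
  as desired for large \<open>j\<close>; this pushes the gap below the tangent disks. As f has a
  derivative only relative to a set on whose boundary the curves run, Cauchy's theorem is obtained
  from homotopies inside that set.\<close>

primrec cf_frac :: "int list \<Rightarrow> int \<times> int" where
  "cf_frac [] = (0, 1)"
| "cf_frac (a # as) = (snd (cf_frac as), a * snd (cf_frac as) + fst (cf_frac as))"

lemma cf_frac_bounds:
  assumes "\<And>a. a \<in> set as \<Longrightarrow> 1 \<le> a"
  shows "0 \<le> fst (cf_frac as) \<and> 1 \<le> snd (cf_frac as)"
  using assms
proof (induction as)
  case (Cons a as)
  then have "0 \<le> fst (cf_frac as)" "1 \<le> snd (cf_frac as)" "1 \<le> a" by auto
  moreover from this have "1 \<le> a * snd (cf_frac as)"
    by (metis mult_mono' mult_1 zero_le_one)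
  ultimately show ?case by auto
qed simp

text \<open>Each step adds a multiple of one entry to the other, which preserves the gcd; the
  recursion therefore delivers fractions already in lowest terms.\<close>

lemma coprime_cf_frac: "coprime (fst (cf_frac as)) (snd (cf_frac as))"
proof (induction as)
  case (Cons a as)
  then show ?case
    by (metis cf_frac.simps(2) coprime_commute coprime_iff_gcd_eq_1 fst_conv gcd_add_mult snd_conv)
qed simp

lemma cf_eval_eq_cf_frac:
  assumes "\<And>a. a \<in> set as \<Longrightarrow> 1 \<le> a"
  shows "cf_eval as = of_int (fst (cf_frac as)) / of_int (snd (cf_frac as))"
  using assms
proof (induction as)
  case (Cons a as)
  have "1 \<le> snd (cf_frac as)" using cf_frac_bounds[of as] Cons.prems by auto
  then have "(of_int a :: rat) + of_int (fst (cf_frac as)) / of_int (snd (cf_frac as))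
      = of_int (snd (cf_frac (a # as))) / of_int (snd (cf_frac as))"
    by (simp add: field_simps)
  with Cons show ?case by simp
qed simp

text \<open>Identifies \<open>cf_denom\<close>, defined through the normal form of a rational, with
  the second component of a recursion on which induction is possible.\<close>

lemma quotient_of_cf_eval:
  assumes "\<And>a. a \<in> set as \<Longrightarrow> 1 \<le> a"
  shows "quotient_of (cf_eval as) = cf_frac as"
proof -
  have "quotient_of (Fract (fst (cf_frac as)) (snd (cf_frac as))) = cf_frac as"
    using cf_frac_bounds[of as] assms coprime_cf_frac[of as]
    unfolding quotient_of_Fract
    by (metis less_le_trans normalize_stable prod.collapse zero_less_one)
  then show ?thesis
    by (simp add: cf_eval_eq_cf_frac[OF assms] Fract_of_int_quotient)
qed

section \<open>The Gauss map and the approximation error of convergents\<close>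

lemma cf_rem_irrational:
  assumes "y \<notin> \<rat>"
  shows "cf_rem y k \<notin> \<rat> \<and> 0 < cf_rem y k \<and> cf_rem y k < 1"
proof (induction k)
  case 0
  have "frac y \<notin> \<rat>" using assms
    by (metis Rats_add Rats_of_int frac_def diff_add_cancel)
  moreover from this have "frac y \<noteq> 0" by (metis Rats_0)
  ultimately show ?case
    using frac_ge_0[of y] frac_lt_1[of y] by simp
next
  case (Suc k)
  have "1 / cf_rem y k \<notin> \<rat>" using Suc
    by (metis Rats_divide Rats_1 div_by_1 divide_divide_eq_right mult_1)
  then have "frac (1 / cf_rem y k) \<notin> \<rat>"
    by (metis Rats_add Rats_of_int frac_def diff_add_cancel)
  moreover from this have "frac (1 / cf_rem y k) \<noteq> 0" by (metis Rats_0)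
  ultimately show ?case
    using frac_ge_0[of "1 / cf_rem y k"] frac_lt_1[of "1 / cf_rem y k"] by simp
qed

lemma cf_digit_ge_1: "y \<notin> \<rat> \<Longrightarrow> 1 \<le> cf_digit y k"
  using cf_rem_irrational[of y k] by (simp add: cf_digit_def le_floor_iff)

lemma cf_rem_shift: "cf_rem (1 / cf_rem y 0) k = cf_rem y (Suc k)"
  by (induction k) simp_all

lemma cf_digit_shift: "cf_digit (1 / cf_rem y 0) k = cf_digit y (Suc k)"
  by (simp add: cf_digit_def cf_rem_shift del: cf_rem.simps)

text \<open>The recursion of \<open>cf_frac\<close> puts a digit in front, whereas passing from
  \<open>k\<close> to \<open>Suc k\<close> appends one at the end. Replacing \<open>y\<close> by
  \<open>1 / cf_rem y 0\<close> turns appending into prepending, the form needed for induction on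
  \<open>k\<close>.\<close>

lemma cf_frac_shift:
  "cf_frac (map (cf_digit y) [0..<Suc k])
    = cf_frac (cf_digit y 0 # map (cf_digit (1 / cf_rem y 0)) [0..<k])"
proof -
  have "map (cf_digit y) [0..<Suc k] = cf_digit y 0 # map (\<lambda>i. cf_digit y (Suc i)) [0..<k]"
    by (simp add: map_Suc_upt[symmetric] upt_conv_Cons del: upt_Suc)
  also have "map (\<lambda>i. cf_digit y (Suc i)) [0..<k] = map (cf_digit (1 / cf_rem y 0)) [0..<k]"
    by (rule map_cong) (simp_all only: cf_digit_shift)
  finally show ?thesis by (rule arg_cong)
qed

lemma cf_rem_0_step:
  assumes "y \<notin> \<rat>"
  shows "cf_rem y 0 * (of_int (cf_digit y 0) + cf_rem (1 / cf_rem y 0) 0) = 1"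
    "1 / cf_rem y 0 \<notin> \<rat>"
proof -
  have *: "cf_rem y 0 \<notin> \<rat>" "0 < cf_rem y 0" using cf_rem_irrational[OF assms, of 0] by auto
  then show "cf_rem y 0 * (of_int (cf_digit y 0) + cf_rem (1 / cf_rem y 0) 0) = 1"
    by (simp add: cf_digit_def frac_def)
  show "1 / cf_rem y 0 \<notin> \<rat>" using *
    by (metis Rats_divide Rats_1 div_by_1 divide_divide_eq_right mult_1)
qed

text \<open>The classical first bound is not inductive by itself: a Gauss step replaces a
  denominator Q by a Q + P, so the numerators have to be controlled along with it. This is the role
  of the second conjunct.\<close>

lemma cf_frac_error:
  assumes "y \<notin> \<rat>"
  defines "p \<equiv> \<lambda>k. of_int (fst (cf_frac (map (cf_digit y) [0..<k]))) :: real"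
    and "q \<equiv> \<lambda>k. of_int (snd (cf_frac (map (cf_digit y) [0..<k]))) :: real"
  shows "\<bar>q k * cf_rem y 0 - p k\<bar> * q (Suc k) \<le> 1 \<and>
    \<bar>q k * cf_rem y 0 - p k\<bar> * p (Suc k) \<le> cf_rem y 0"
  using assms(1) unfolding p_def q_def
proof (induction k arbitrary: y)
  case 0
  have pos: "0 < cf_rem y 0" using cf_rem_irrational[OF 0, of 0] by simp
  have "of_int (cf_digit y 0) \<le> 1 / cf_rem y 0"
    unfolding cf_digit_def by (rule of_int_floor_le)
  then have "cf_rem y 0 * of_int (cf_digit y 0) \<le> 1"
    using pos by (simp add: pos_le_divide_eq mult.commute)
  then show ?case using pos by simp
next
  case (Suc k)
  define x where "x = cf_rem y 0"
  define y' where "y' = 1 / cf_rem y 0"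
  define x' where "x' = cf_rem y' 0"
  define a where "a = (of_int (cf_digit y 0) :: real)"
  define P where "P = (\<lambda>k. of_int (fst (cf_frac (map (cf_digit y') [0..<k]))) :: real)"
  define Q where "Q = (\<lambda>k. of_int (snd (cf_frac (map (cf_digit y') [0..<k]))) :: real)"
  have st: "x * (a + x') = 1" "y' \<notin> \<rat>"
    using cf_rem_0_step[OF Suc.prems] by (simp_all add: x_def y'_def x'_def a_def)
  have pos: "0 < x" using cf_rem_irrational[OF Suc.prems, of 0] by (simp add: x_def)
  have a: "0 \<le> a" using cf_digit_ge_1[OF Suc.prems, of 0] by (simp add: a_def)
  have IH: "\<bar>Q k * x' - P k\<bar> * Q (Suc k) \<le> 1" "\<bar>Q k * x' - P k\<bar> * P (Suc k) \<le> x'"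
    using Suc.IH[OF st(2)] by (simp_all add: P_def Q_def x'_def)
  have eq: "of_int (fst (cf_frac (map (cf_digit y) [0..<Suc k]))) = Q k"
       "of_int (snd (cf_frac (map (cf_digit y) [0..<Suc k]))) = a * Q k + P k" for k
    unfolding cf_frac_shift by (simp_all add: P_def Q_def y'_def a_def)
  \<comment> \<open>By x (a + x') = 1, prepending a digit multiplies the error by - x.\<close>
  have err: "(a * Q k + P k) * x - Q k = - x * (Q k * x' - P k)"
  proof -
    have "Q k = Q k * (x * (a + x'))" by (simp add: st(1))
    then show ?thesis by (simp add: algebra_simps)
  qed
  have abs: "\<bar>(a * Q k + P k) * x - Q k\<bar> = x * \<bar>Q k * x' - P k\<bar>"
    unfolding err using pos by (simp add: abs_mult)
  have "x * \<bar>Q k * x' - P k\<bar> * (a * Q (Suc k) + P (Suc k))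
      = x * (a * (\<bar>Q k * x' - P k\<bar> * Q (Suc k)) + \<bar>Q k * x' - P k\<bar> * P (Suc k))"
    by (simp add: algebra_simps)
  also have "\<dots> \<le> x * (a * 1 + x')"
    using pos a IH by (intro mult_left_mono add_mono) auto
  finally have 1: "x * \<bar>Q k * x' - P k\<bar> * (a * Q (Suc k) + P (Suc k)) \<le> 1"
    using st(1) by simp
  have 2: "x * \<bar>Q k * x' - P k\<bar> * Q (Suc k) \<le> x"
    using mult_left_mono[OF IH(1), of x] pos by (simp add: mult.assoc)
  show ?case
    unfolding eq abs x_def[symmetric] using 1 2 by blast
qed

text \<open>At a convergent p/q of x = \<open>frac y\<close>, \<open>far\<close> makes \<psi>(q) at
  most |x - p/q|, hence at most |q x - p|, and \<open>cf_frac_error\<close> bounds this by the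
  inverse of the next denominator. The complement of the Cantor set is thereby covered by intervals
  around fractions, whose lengths can be summed.\<close>

lemma C_realI:
  assumes far: "\<And>(n::int) (m::nat). 1 \<le> m \<Longrightarrow> \<psi> m \<le> \<bar>y - of_int n / of_nat m\<bar>"
    and pos: "\<And>m. 0 < \<psi> m"
  shows "y \<in> C_real \<psi>"
proof -
  have irr: "y \<notin> \<rat>"
  proof
    assume "y \<in> \<rat>"
    then obtain n m where "m > 0" "y = of_int n / of_nat m"
      by (metis Rats_cases' of_int_of_nat_eq of_nat_0_less_iff zero_less_imp_eq_int)
    then show False using far[of m n] pos[of m] by auto
  qed
  have "real (cf_denom y (Suc k)) \<le> 1 / \<psi> (cf_denom y k)" for k
  proof -
    let ?f = "\<lambda>k. cf_frac (map (cf_digit y) [0..<k])"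
    have dig: "\<And>k a. a \<in> set (map (cf_digit y) [0..<k]) \<Longrightarrow> 1 \<le> a"
      using cf_digit_ge_1[OF irr] by auto
    have den: "1 \<le> snd (?f k)" "cf_denom y k = nat (snd (?f k))" for k
      using cf_frac_bounds[of "map (cf_digit y) [0..<k]", OF dig]
        quotient_of_cf_eval[of "map (cf_digit y) [0..<k]", OF dig]
      by (simp_all add: cf_denom_def cf_convergent_def)
    define q p q' where "q = real (cf_denom y k)" and "p = real_of_int (fst (?f k))"
      and "q' = real (cf_denom y (Suc k))"
    have q: "q = of_int (snd (?f k))" "1 \<le> q" "q' = of_int (snd (?f (Suc k)))" "1 \<le> q'"
      using den[of k] den[of "Suc k"] by (simp_all add: q_def q'_def del: upt_Suc)
    have 1: "\<bar>q * frac y - p\<bar> * q' \<le> 1"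
      using cf_frac_error[OF irr, of k] unfolding q(1,3) p_def by simp
    \<comment> \<open>The convergents belong to \<open>frac y\<close>, so the numerator is shifted
      by the integer part times the denominator.\<close>
    have "\<psi> (cf_denom y k) \<le> \<bar>y - of_int (\<lfloor>y\<rfloor> * int (cf_denom y k) + fst (?f k)) / q\<bar>"
      using far[of "cf_denom y k" "\<lfloor>y\<rfloor> * int (cf_denom y k) + fst (?f k)"] q(2)
      by (simp add: q_def)
    also have "\<dots> = \<bar>frac y - p / q\<bar>"
      using q(2) by (simp add: add_divide_distrib frac_def p_def q_def algebra_simps)
    also have "\<dots> = \<bar>q * frac y - p\<bar> / q"
    proof -
      have "frac y - p / q = (q * frac y - p) / q"
        using q(2) by (simp add: field_simps)
      then show ?thesis using q(2) by (simp only: abs_divide)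
    qed
    also have "\<dots> \<le> \<bar>q * frac y - p\<bar>"
      using q(2) by (simp add: divide_le_eq mult_left_le_one_le mult_le_cancel_left1)
    also have "\<dots> \<le> 1 / q'"
      using 1 q(4) by (simp add: pos_le_divide_eq)
    finally have "\<psi> (cf_denom y k) \<le> 1 / q'" .
    then show ?thesis
      using pos[of "cf_denom y k"] q(4) by (simp add: q'_def field_simps)
  qed
  then show ?thesis using irr by (simp add: C_real_def)
qed

section \<open>Approximation by the Cantor sets near a Diophantine point\<close>

text \<open>Euler's integral for \<Gamma>(p + 1) is cut down to [v, v + 1], where t^p \<ge> v^p and
  exp(-t) \<ge> exp(-v - 1); the constant \<open>exp 1\<close> is the price of the shift by 1. The
  Gamma factors of the final bound originate here.\<close>

lemma powr_exp_le_Gamma: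
  fixes p v :: real
  assumes "0 \<le> p" "0 < v"
  shows "v powr p * exp (- v) \<le> exp 1 * Gamma (p + 1)"
proof -
  define f where "f = (\<lambda>t. t powr (p + 1 - 1) / exp t :: real)"
  have G: "(f has_integral Gamma (p + 1)) {0..}"
    unfolding f_def using Gamma_integral_real[of "p + 1"] assms by simp
  have int: "f integrable_on {v..v+1}"
    unfolding f_def using assms(2)
    by (intro integrable_continuous_real continuous_intros) auto
  have "v powr p * exp (- v - 1) = integral {v..v+1} (\<lambda>t. v powr p * exp (- v - 1))"
    by simp
  also have "\<dots> \<le> integral {v..v+1} f"
  proof (rule integral_le[OF _ int])
    show "v powr p * exp (- v - 1) \<le> f t" if "t \<in> {v..v+1}" for t
    proof -
      have "v powr p * exp (- v - 1) \<le> t powr p * exp (- t)"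
        using that assms by (intro mult_mono powr_mono2) auto
      then show ?thesis by (simp add: f_def exp_minus divide_inverse)
    qed
  qed (rule integrable_const_ivl)
  also have "\<dots> \<le> integral {0..} f"
    using G int assms(2)
    by (intro integral_subset_le) (auto simp: f_def integrable_on_def)
  also have "\<dots> = Gamma (p + 1)"
    using G by (rule integral_unique)
  finally show ?thesis
    by (simp add: exp_diff field_simps)
qed

lemma powr_exp_bounded:
  fixes a p :: real
  assumes "0 < a" "0 \<le> p"
  obtains K where "0 < K" "\<And>v. 0 < v \<Longrightarrow> v powr p * exp (- a * v) \<le> K"
proof
  show "0 < exp 1 * Gamma (p + 1) * a powr (- p)"
    using assms by (simp add: Gamma_real_pos)
  show "v powr p * exp (- a * v) \<le> exp 1 * Gamma (p + 1) * a powr (- p)" if "0 < v" for v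
    using powr_exp_le_Gamma[of p "a * v"] assms that
    by (simp add: powr_mult powr_minus field_simps)
qed

text \<open>The substitution v = \<open>w powr (- 1 / \<tau>)\<close> turns powers of 1/w into
  powers of v, which the exponential dominates.\<close>

lemma flat_le_powr:
  fixes c \<tau> p :: real
  assumes "0 < c" "0 < \<tau>" "0 \<le> p"
  obtains K where "0 < K" "\<And>w. 0 < w \<Longrightarrow> exp (- c * w powr (- 1 / \<tau>)) \<le> K * w powr p"
proof -
  obtain K where K: "0 < K" "\<And>v. 0 < v \<Longrightarrow> v powr (\<tau> * p) * exp (- c * v) \<le> K"
    using powr_exp_bounded[of c "\<tau> * p"] assms by auto
  have "exp (- c * w powr (- 1 / \<tau>)) \<le> K * w powr p" if "0 < w" for w
  proof -
    have "(w powr (- 1 / \<tau>)) powr (\<tau> * p) = w powr (- p)"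
      using assms by (simp add: powr_powr)
    then have "w powr (- p) * exp (- c * w powr (- 1 / \<tau>)) \<le> K"
      using K(2)[of "w powr (- 1 / \<tau>)"] that by simp
    then show ?thesis using that by (simp add: powr_minus field_simps)
  qed
  with K(1) show ?thesis using that by blast
qed

text \<open>At most \<open>5 m\<close> fractions with denominator \<open>m\<close> lie within distance \<open>2\<close> of a point.\<close>

lemma covered_interval_length_le:
  fixes x r :: real and \<psi> :: "nat \<Rightarrow> real"
  assumes r: "0 \<le> r" "r \<le> 1"
    and psi: "\<And>m. 0 \<le> \<psi> m" "\<And>m. \<psi> m \<le> 1"
    and sum: "summable (\<lambda>m. real m * \<psi> m)"
    and cover: "\<And>z. z \<in> {x..x+r} \<Longrightarrow>
      \<exists>m\<in>M. 1 \<le> m \<and> (\<exists>n::int. \<bar>z - of_int n / of_nat m\<bar> < \<psi> m)"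
  shows "r \<le> (\<Sum>m. if m \<in> M then 10 * real m * \<psi> m else 0)"
proof -
  \<comment> \<open>The distance 2 is \<open>r \<le> 1\<close> plus \<open>\<psi> m \<le> 1\<close>.
    Rounding leaves at most 4m + 1 \<le> 5m numerators, and each interval has length 2 \<psi>(m),
    whence the constant 10.\<close>
  define N where "N m = {\<lceil>real m * x - 2 * real m\<rceil>..\<lfloor>real m * x + 2 * real m\<rfloor>}" for m
  define U where "U m = (if m \<in> M \<and> 1 \<le> m
     then (\<Union>n\<in>N m. {of_int n / of_nat m - \<psi> m..of_int n / of_nat m + \<psi> m}) else {})"
    for m :: nat
  define b where "b m = (if m \<in> M then 10 * real m * \<psi> m else 0)" for m
  have b: "0 \<le> b m" for m using psi(1) by (simp add: b_def)
  have sb: "summable b"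
  proof (rule summable_comparison_test[OF _ summable_mult[OF sum, of 10]])
    show "\<exists>N. \<forall>n\<ge>N. norm (b n) \<le> 10 * (real n * \<psi> n)"
      using psi(1) by (auto simp: b_def)
  qed
  have "{x..x+r} \<subseteq> (\<Union>m. U m)"
  proof
    fix z assume z: "z \<in> {x..x+r}"
    then obtain m n where mn: "m \<in> M" "1 \<le> m" "\<bar>z - of_int n / of_nat m\<bar> < \<psi> m"
      using cover by blast
    have "\<bar>of_int n / of_nat m - x\<bar> \<le> 2"
      using mn(3) z r psi(2)[of m] unfolding atLeastAtMost_iff by linarith
    then have "\<bar>(of_int n / of_nat m - x) * real m\<bar> \<le> 2 * real m"
      unfolding abs_mult by (simp add: mult_right_mono)
    also have "(of_int n / of_nat m - x) * real m = of_int n - real m * x"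
      using mn(2) by (simp add: field_simps)
    finally have "n \<in> N m"
      unfolding N_def atLeastAtMost_iff ceiling_le_iff le_floor_iff by linarith
    moreover have "z \<in> {of_int n / of_nat m - \<psi> m..of_int n / of_nat m + \<psi> m}"
      using mn(3) by auto
    ultimately have "z \<in> U m"
      using mn(1,2) by (auto simp: U_def)
    then show "z \<in> (\<Union>m. U m)" by blast
  qed
  moreover have meas: "U m \<in> sets lborel" for m
    unfolding U_def N_def by auto
  ultimately have "emeasure lborel {x..x+r} \<le> emeasure lborel (\<Union>m. U m)"
    by (intro emeasure_mono) auto
  also have "\<dots> \<le> (\<Sum>m. emeasure lborel (U m))"
    using meas by (intro emeasure_subadditive_countably) auto
  also have "\<dots> \<le> (\<Sum>m. ennreal (b m))"
  proof (rule suminf_le)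
    fix m
    show "emeasure lborel (U m) \<le> ennreal (b m)"
    proof (cases "m \<in> M \<and> 1 \<le> m")
      case True
      have fin: "finite (N m)" by (simp add: N_def)
      have "\<lfloor>real m * x + 2 * real m\<rfloor> - \<lceil>real m * x - 2 * real m\<rceil> + 1 \<le> 4 * int m + 1"
        by linarith
      then have "card (N m) \<le> 4 * m + 1"
        unfolding N_def card_atLeastAtMost_int by linarith
      then have card: "real (card (N m)) \<le> 5 * real m" using True by linarith
      have "emeasure lborel (U m)
          \<le> (\<Sum>n\<in>N m. emeasure lborel {of_int n / of_nat m - \<psi> m..of_int n / of_nat m + \<psi> m})"
        using True fin unfolding U_def by (simp del: emeasure_lborel_Icc emeasure_lborel_Icc_eq)
          (intro emeasure_subadditive_finite, auto)
      also have "\<dots> = ennreal (real (card (N m)) * (2 * \<psi> m))"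
        using psi(1)[of m] by (simp add: ennreal_mult ennreal_of_nat_eq_real_of_nat)
      also have "\<dots> \<le> ennreal (b m)"
      proof (rule ennreal_leI)
        have "real (card (N m)) * (2 * \<psi> m) \<le> (5 * real m) * (2 * \<psi> m)"
          using card psi(1)[of m] by (intro mult_right_mono) auto
        then show "real (card (N m)) * (2 * \<psi> m) \<le> b m"
          using True by (simp add: b_def)
      qed
      finally show ?thesis .
    qed (auto simp: U_def)
  qed auto
  also have "\<dots> = ennreal (\<Sum>m. b m)"
    using b sb by (intro suminf_ennreal2) auto
  finally show ?thesis
    using r suminf_nonneg[OF sb b] by (simp add: b_def)
qed

section \<open>Gaps of the Cantor sets near a Diophantine point\<close>

lemma DC_add_1: "y \<in> DC g \<tau> \<Longrightarrow> y + 1 \<in> DC g \<tau>"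
proof -
  assume y: "y \<in> DC g \<tau>"
  have "y + 1 \<notin> \<rat>" using y Rats_diff[of "y + 1" 1] by (auto simp: DC_def)
  moreover have "g * real m powr (- \<tau>) \<le> \<bar>y + 1 - of_int n / of_nat m\<bar>"
    if "1 \<le> m" for n m
  proof -
    have "y + 1 - of_int n / of_nat m = y - of_int (n - int m) / of_nat m"
      using that by (simp add: field_simps)
    moreover have "g * real m powr (- \<tau>) \<le> \<bar>y - of_int (n - int m) / of_nat m\<bar>"
      using y that unfolding DC_def by blast
    ultimately show ?thesis by simp
  qed
  ultimately show ?thesis by (auto simp: DC_def)
qed

text \<open>The order of the quantifiers matters: \<open>c\<close> is fixed before \<theta>, and
  only the threshold for \<gamma> depends on \<theta>, so the gap can be scaled down without
  spoiling its rate. The two ends must belong to the set exactly, because the gap closes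
  there.\<close>

lemma C_real_dense_near_DC:
  fixes g \<tau> \<alpha> y0 :: real
  assumes y0: "y0 \<in> DC g \<tau>" and "0 < g" "0 < \<tau>" "0 < \<alpha>"
  obtains c where "0 < c"
    and "\<And>\<theta>. 0 < \<theta> \<Longrightarrow> \<exists>\<epsilon>>0. \<forall>\<gamma>. 0 < \<gamma> \<and> \<gamma> < \<epsilon> \<longrightarrow>
      y0 \<in> C_real (psi_exp \<alpha> \<gamma>) \<and> y0 + 1 \<in> C_real (psi_exp \<alpha> \<gamma>) \<and>
      (\<forall>t\<in>{0<..<1}. \<exists>a\<in>C_real (psi_exp \<alpha> \<gamma>).
         \<bar>y0 + t - a\<bar> \<le> \<theta> * exp (- c * (t * (1 - t)) powr (- 1 / \<tau>)))"
proof
  \<comment> \<open>Half of the decay rate \<alpha> produces the flat factor; the other half keeps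
    the series \<open>s\<close> below convergent. The 6 arises from comparing a distance
    \<open>3 * w\<close> with \<open>g / 2\<close>.\<close>
  define c where "c = \<alpha> / 2 * (g / 6) powr (1 / \<tau>)"
  define E where "E w = exp (- c * w powr (- 1 / \<tau>))" for w
  show c: "0 < c" using assms by (simp add: c_def)
  obtain B where B: "0 < B" "\<And>v. 0 < v \<Longrightarrow> v powr \<tau> * exp (- \<alpha> * v) \<le> B"
    using powr_exp_bounded[of \<alpha> \<tau>] assms by auto
  obtain K where K: "0 < K" "\<And>w. 0 < w \<Longrightarrow> E w \<le> K * w powr 1"
    using flat_le_powr[of c \<tau> 1] c assms unfolding E_def by auto
  define s where "s m = 10 * real m * exp (- \<alpha> / 2) ^ m" for m :: nat
  have "summable (\<lambda>m. real (Suc m) * exp (- \<alpha> / 2) ^ m)"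
    using geometric_deriv_sums[of "exp (- \<alpha> / 2)"] assms by (auto simp: sums_iff)
  then have "summable (\<lambda>m. real m * exp (- \<alpha> / 2) ^ m)"
    by (rule summable_comparison_test[rotated]) (auto intro!: exI[of _ 0])
  then have sums: "summable s"
    unfolding s_def using summable_mult[of "\<lambda>m. real m * exp (- \<alpha> / 2) ^ m" 10]
    by (simp add: mult.assoc)
  fix \<theta> :: real assume "0 < \<theta>"
  \<comment> \<open>The cap 1/K forces \<open>r \<le> w\<close> below, so that the interval of
    length \<open>r\<close> stays within \<open>3 * w\<close> of the Diophantine point.\<close>
  define \<theta>' where "\<theta>' = min \<theta> (1 / K)"
  have \<theta>': "0 < \<theta>'" "\<theta>' \<le> \<theta>" "\<theta>' * K \<le> 1"
    using \<open>0 < \<theta>\<close> K(1) by (auto simp: \<theta>'_def min_def field_simps)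
  have "0 \<le> suminf s" using sums by (intro suminf_nonneg) (auto simp: s_def)
  \<comment> \<open>The three caps give in turn \<psi> \<le> 1, \<psi> at most half of the
    Diophantine bound, and a total covering length strictly below \<open>r\<close>; the last, strict
    inequality is why 1 is added to the sum.\<close>
  define \<epsilon> where "\<epsilon> = min (min 1 (g / (2 * B))) (\<theta>' / (suminf s + 1))"
  have \<epsilon>: "0 < \<epsilon>" "\<epsilon> \<le> 1" "\<epsilon> * B \<le> g / 2" "\<epsilon> * suminf s < \<theta>'"
  proof -
    show "0 < \<epsilon>" "\<epsilon> \<le> 1" using \<theta>'(1) \<open>0 \<le> suminf s\<close> assms B(1) by (auto simp: \<epsilon>_def)
    have "\<epsilon> \<le> g / (2 * B)" by (simp add: \<epsilon>_def)
    then show "\<epsilon> * B \<le> g / 2" using B(1) by (simp add: field_simps)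
    have "\<epsilon> \<le> \<theta>' / (suminf s + 1)" by (simp add: \<epsilon>_def)
    then have "\<epsilon> * (suminf s + 1) \<le> \<theta>'" using \<open>0 \<le> suminf s\<close> by (simp add: pos_le_divide_eq)
    then show "\<epsilon> * suminf s < \<theta>'" using \<open>0 < \<epsilon>\<close> by (simp add: algebra_simps)
  qed
  show "\<exists>\<epsilon>>0. \<forall>\<gamma>. 0 < \<gamma> \<and> \<gamma> < \<epsilon> \<longrightarrow>
      y0 \<in> C_real (psi_exp \<alpha> \<gamma>) \<and> y0 + 1 \<in> C_real (psi_exp \<alpha> \<gamma>) \<and>
      (\<forall>t\<in>{0<..<1}. \<exists>a\<in>C_real (psi_exp \<alpha> \<gamma>).
         \<bar>y0 + t - a\<bar> \<le> \<theta> * exp (- c * (t * (1 - t)) powr (- 1 / \<tau>)))"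
  proof (intro exI[of _ \<epsilon>] conjI allI impI ballI; (elim conjE)?)
    show "0 < \<epsilon>" by fact
  next
    fix \<gamma> :: real assume \<gamma>: "0 < \<gamma>" "\<gamma> < \<epsilon>"
    let ?\<psi> = "psi_exp \<alpha> \<gamma>"
    have psi: "0 < ?\<psi> m" "?\<psi> m \<le> 1" for m
      using \<gamma> \<epsilon>(2) assms mult_mono[of \<gamma> 1 "exp (- \<alpha> * real m)" 1] by (auto simp: psi_exp_def)
    have psi_le: "?\<psi> m \<le> g / 2 * real m powr (- \<tau>)" if "1 \<le> m" for m
    proof -
      have "?\<psi> m \<le> \<epsilon> * (B * real m powr (- \<tau>))"
        using B(2)[of "real m"] that \<gamma> unfolding psi_exp_def
        by (intro mult_mono) (auto simp: powr_minus field_simps)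
      also have "\<dots> \<le> g / 2 * real m powr (- \<tau>)"
        using mult_right_mono[OF \<epsilon>(3), of "real m powr (- \<tau>)"] by (simp add: mult.assoc)
      finally show ?thesis .
    qed
    have far_DC: "?\<psi> m \<le> \<bar>y - of_int n / of_nat m\<bar>"
      if "y \<in> DC g \<tau>" "1 \<le> m" for y n m
    proof -
      have "?\<psi> m \<le> g * real m powr (- \<tau>)"
        using psi_le[OF that(2)] \<open>0 < g\<close> by (smt (verit) field_sum_of_halves mult_nonneg_nonneg powr_ge_zero ring_class.ring_distribs(2))
      also have "\<dots> \<le> \<bar>y - of_int n / of_nat m\<bar>"
        using that unfolding DC_def by blast
      finally show ?thesis .
    qed
    have in_C: "y \<in> C_real ?\<psi>" if "\<And>n m. 1 \<le> m \<Longrightarrow> ?\<psi> m \<le> \<bar>y - of_int n / of_nat m\<bar>" for y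
      by (rule C_realI[OF that psi(1)])
    show "y0 \<in> C_real ?\<psi>" "y0 + 1 \<in> C_real ?\<psi>"
      using far_DC DC_add_1 y0 by (blast intro: in_C)+
    fix t :: real assume t: "t \<in> {0<..<1}"
    \<comment> \<open>The distance from \<open>t\<close> to the nearer end is at most
      \<open>2 * w\<close>; that end decides whether \<open>y0\<close> or \<open>y0 + 1\<close>
      serves as Diophantine point.\<close>
    define w where "w = t * (1 - t)"
    have w: "0 < w" "w \<le> 1" "min t (1 - t) \<le> 2 * w"
    proof -
      show "0 < w" using t by (simp add: w_def)
      show "w \<le> 1" using t mult_mono[of t 1 "1 - t" 1] by (auto simp: w_def)
      have "t \<le> 2 * w" if "t \<le> 1/2"
        using mult_left_mono[of "1/2" "1 - t" t] that t by (simp add: w_def)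
      moreover have "1 - t \<le> 2 * w" if "1/2 \<le> t"
        using mult_right_mono[of "1/2" "t" "1 - t"] that t by (simp add: w_def)
      ultimately show "min t (1 - t) \<le> 2 * w" by linarith
    qed
    obtain y where y: "y \<in> DC g \<tau>" "\<bar>y0 + t - y\<bar> \<le> 2 * w"
    proof (cases "t \<le> 1/2")
      case True
      then show ?thesis using that[of y0] y0 t w by auto
    next
      case False
      then show ?thesis using that[of "y0 + 1"] DC_add_1[OF y0] t w by auto
    qed
    define r where "r = \<theta>' * E w"
    have r: "0 < r" "r \<le> w"
    proof -
      show "0 < r" using \<theta>'(1) by (simp add: r_def E_def)
      have "r \<le> \<theta>' * (K * w)"
        unfolding r_def using K(2)[OF w(1)] \<theta>'(1) w(1) by (intro mult_left_mono) auto
      also have "\<dots> \<le> 1 * w"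
        using mult_right_mono[OF \<theta>'(3), of w] w(1) by (simp add: mult.assoc)
      finally show "r \<le> w" by simp
    qed
    have "\<exists>a\<in>C_real ?\<psi>. a \<in> {y0 + t..y0 + t + r}"
    proof (rule ccontr)
      assume none: "\<not> (\<exists>a\<in>C_real ?\<psi>. a \<in> {y0 + t..y0 + t + r})"
      \<comment> \<open>The denominators which the Diophantine condition does not exclude; the
        cutoff is (6w/g)^(-1/\<tau>).\<close>
      define M where "M = {m. w powr (- 1 / \<tau>) * (g / 6) powr (1 / \<tau>) \<le> real m}"
      have "r \<le> (\<Sum>m. if m \<in> M then 10 * real m * ?\<psi> m else 0)"
      proof (rule covered_interval_length_le[where x = "y0 + t"])
        show "summable (\<lambda>m. real m * ?\<psi> m)"
        proof (rule summable_comparison_test[OF _ sums], intro exI allI impI)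
          fix m
          have "?\<psi> m \<le> exp (- \<alpha> * real m)"
            using \<gamma> \<epsilon> by (simp add: psi_exp_def)
          also have "\<dots> \<le> exp (- \<alpha> / 2 * real m)"
            using assms by (simp add: mult_right_mono)
          also have "\<dots> \<le> 10 * exp (- \<alpha> / 2) ^ m"
            by (simp add: exp_of_nat_mult[symmetric] mult.commute)
          finally have "real m * ?\<psi> m \<le> real m * (10 * exp (- \<alpha> / 2) ^ m)"
            by (rule mult_left_mono) simp
          then show "norm (real m * ?\<psi> m) \<le> s m"
            using psi(1)[of m] by (simp add: s_def)
        qed
        fix z assume z: "z \<in> {y0 + t..y0 + t + r}"
        then have "z \<notin> C_real ?\<psi>" using none by blast
        then obtain n m where nm: "1 \<le> m" "\<bar>z - of_int n / of_nat m\<bar> < ?\<psi> m"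
          using in_C[of z] by (meson not_le)
        have "g * real m powr (- \<tau>) \<le> \<bar>y - of_int n / of_nat m\<bar>"
          using y(1) nm(1) unfolding DC_def by blast
        \<comment> \<open>Here |y - z| \<le> 2w + r \<le> 3w; the term with g/2 is absorbed on the
          left afterwards.\<close>
        also have "\<dots> \<le> 3 * w + g / 2 * real m powr (- \<tau>)"
          using nm(2) psi_le[OF nm(1)] y(2) z r(2) unfolding atLeastAtMost_iff by linarith
        finally have "real m powr (- \<tau>) \<le> 6 * w / g"
          using \<open>0 < g\<close> by (simp add: field_simps)
        then have "(6 * w / g) powr (- 1 / \<tau>) \<le> (real m powr (- \<tau>)) powr (- 1 / \<tau>)"
          using nm(1) \<open>0 < \<tau>\<close> by (intro powr_mono2') auto
        also have "\<dots> = real m"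
          using nm(1) \<open>0 < \<tau>\<close> by (simp add: powr_powr)
        also have "(6 * w / g) powr (- 1 / \<tau>) = w powr (- 1 / \<tau>) * (g / 6) powr (1 / \<tau>)"
          using w(1) \<open>0 < g\<close> by (simp add: powr_mult powr_divide powr_minus field_simps)
        finally have "m \<in> M" by (simp add: M_def)
        then show "\<exists>m\<in>M. 1 \<le> m \<and> (\<exists>n::int. \<bar>z - of_int n / of_nat m\<bar> < ?\<psi> m)"
          using nm by blast
      qed (use r w psi less_imp_le in auto)
      also have "\<dots> \<le> (\<Sum>m. \<gamma> * E w * s m)"
      proof (rule suminf_le)
        show le: "(if m \<in> M then 10 * real m * ?\<psi> m else 0) \<le> \<gamma> * E w * s m" for m
        proof (cases "m \<in> M")
          case True
          \<comment> \<open>Membership in \<open>M\<close> trades half of the exponent for the flat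
            factor \<open>E w\<close>.\<close>
          have "\<alpha> / 2 * (w powr (- 1 / \<tau>) * (g / 6) powr (1 / \<tau>)) \<le> \<alpha> / 2 * real m"
            using True assms by (intro mult_left_mono) (auto simp: M_def)
          then have "- \<alpha> * real m \<le> - c * w powr (- 1 / \<tau>) + real m * (- \<alpha> / 2)"
            by (simp add: c_def algebra_simps)
          then have "exp (- \<alpha> * real m) \<le> E w * exp (- \<alpha> / 2) ^ m"
            unfolding E_def by (simp only: exp_of_nat_mult[symmetric] exp_add[symmetric] exp_le_cancel_iff)
          then have "10 * real m * \<gamma> * exp (- \<alpha> * real m) \<le> 10 * real m * \<gamma> * (E w * exp (- \<alpha> / 2) ^ m)"
            using \<gamma> by (intro mult_left_mono) auto
          then show ?thesis using True by (simp add: psi_exp_def s_def algebra_simps)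
        next
          case False
          then show ?thesis using \<gamma> by (simp add: s_def E_def)
        qed
        show sum': "summable (\<lambda>m. \<gamma> * E w * s m)" using sums by (rule summable_mult)
        show "summable (\<lambda>m. if m \<in> M then 10 * real m * ?\<psi> m else 0)"
        proof (rule summable_comparison_test[OF _ sum'], intro exI allI impI)
          show "norm (if m \<in> M then 10 * real m * ?\<psi> m else 0) \<le> \<gamma> * E w * s m" for m
            using le[of m] psi(1)[of m] by (auto split: if_splits)
        qed
      qed
      also have "\<dots> = E w * (\<gamma> * suminf s)"
        using sums by (simp add: suminf_mult algebra_simps)
      finally have "\<theta>' \<le> \<gamma> * suminf s"
        unfolding r_def by (simp add: E_def mult.commute)
      also have "\<dots> \<le> \<epsilon> * suminf s"
        using \<gamma> \<open>0 \<le> suminf s\<close> by (intro mult_right_mono) auto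
      finally show False using \<epsilon>(4) by simp
    qed
    then obtain a where a: "a \<in> C_real ?\<psi>" "a \<in> {y0 + t..y0 + t + r}" by blast
    have "\<bar>y0 + t - a\<bar> \<le> r" using a(2) by auto
    also have "r \<le> \<theta> * E w"
      unfolding r_def using \<theta>'(2) by (intro mult_right_mono) (auto simp: E_def)
    finally show "\<exists>a\<in>C_real ?\<psi>. \<bar>y0 + t - a\<bar> \<le> \<theta> * exp (- c * (t * (1 - t)) powr (- 1 / \<tau>))"
      using a(1) by (auto simp: E_def w_def)
  qed
qed

section \<open>The flat gap function\<close>

text \<open>The ends are set to 0 separately, since \<open>0 powr a = 0\<close> would make the
  exponential equal to 1 there. The product t(1 - t) is a smooth substitute for the distance to the
  nearer end.\<close>

definition flat :: "real \<Rightarrow> real \<Rightarrow> real \<Rightarrow> real"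
  where "flat c \<tau> t = (if t \<in> {0<..<1} then exp (- c * (t * (1 - t)) powr (- 1 / \<tau>)) else 0)"

definition flat_deriv :: "real \<Rightarrow> real \<Rightarrow> real \<Rightarrow> real"
  where "flat_deriv c \<tau> t = c / \<tau> * (1 - 2 * t) * (t * (1 - t)) powr (- 1 / \<tau> - 1) * flat c \<tau> t"

lemma flat_nonneg: "0 \<le> flat c \<tau> t"
  by (simp add: flat_def)

lemma flat_pos: "t \<in> {0<..<1} \<Longrightarrow> 0 < flat c \<tau> t"
  by (simp add: flat_def)

lemma flat_ends [simp]: "flat c \<tau> 0 = 0" "flat c \<tau> 1 = 0"
  "flat_deriv c \<tau> 0 = 0" "flat_deriv c \<tau> 1 = 0"
  by (simp_all add: flat_def flat_deriv_def)

lemma flat_half: "flat c \<tau> t = flat (c / 2) \<tau> t * flat (c / 2) \<tau> t"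
  by (simp add: flat_def mult_exp_exp)

text \<open>\<open>powr_exp_le_Gamma\<close> is used with p = N \<tau> and v = c w^(-1/\<tau>),
  where w = t(1 - t): then v^p = (c^\<tau>)^N w^(-N). The order \<tau> of the Gevrey class enters
  through this exponent.\<close>

lemma flat_le_power_Gamma:
  assumes "0 < c" "0 < \<tau>" "t \<in> {0..1}"
  shows "flat c \<tau> t \<le> exp 1 * (c powr (- \<tau>)) ^ N * Gamma (1 + real N * \<tau>) * (t * (1 - t)) ^ N"
proof (cases "t \<in> {0<..<1}")
  case True
  define w where "w = t * (1 - t)"
  define v where "v = c * w powr (- 1 / \<tau>)"
  have w: "0 < w" and v: "0 < v" using True assms by (simp_all add: w_def v_def)
  have "v powr (real N * \<tau>) = (c powr \<tau>) ^ N * w powr (- real N)"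
    using assms w by (simp add: v_def powr_mult powr_powr powr_realpow[symmetric] mult.commute)
  also have "\<dots> = inverse ((c powr (- \<tau>)) ^ N * w ^ N)"
    using w assms by (simp add: powr_minus powr_realpow power_inverse)
  finally have vN: "v powr (real N * \<tau>) * ((c powr (- \<tau>)) ^ N * w ^ N) = 1"
    using w assms by (simp add: field_simps)
  have "exp (- v) = v powr (real N * \<tau>) * exp (- v) * ((c powr (- \<tau>)) ^ N * w ^ N)"
    using vN by (metis mult.assoc mult.commute mult_1)
  also have "\<dots> \<le> exp 1 * Gamma (real N * \<tau> + 1) * ((c powr (- \<tau>)) ^ N * w ^ N)"
    using powr_exp_le_Gamma[of "real N * \<tau>" v] v assms w
    by (intro mult_right_mono) auto
  finally have "exp (- v) \<le> exp 1 * Gamma (real N * \<tau> + 1) * ((c powr (- \<tau>)) ^ N * w ^ N)" .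
  then show ?thesis using True by (simp add: flat_def v_def w_def algebra_simps)
next
  case False
  have "0 < Gamma (1 + real N * \<tau>)"
    using assms by (intro Gamma_real_pos) (simp add: add_pos_nonneg)
  then show ?thesis using False assms by (auto simp: flat_def)
qed

text \<open>Only half of the exponential is spent on the power; the factor
  \<open>flat (c / 2) \<tau> t\<close> stays available for the Gamma bound. The derivative is
  included because the tangent vectors of the two boundary curves of the gap differ by it.\<close>

lemma flat_bound:
  assumes "0 < c" "0 < \<tau>"
  obtains K where "0 < K"
    "\<And>t. t \<in> {0..1} \<Longrightarrow> flat c \<tau> t + \<bar>flat_deriv c \<tau> t\<bar> \<le> K * (t * (1 - t)) ^ p * flat (c / 2) \<tau> t"
proof -
  obtain K1 where K1: "0 < K1"
    "\<And>w. 0 < w \<Longrightarrow> exp (- (c / 2) * w powr (- 1 / \<tau>)) \<le> K1 * w powr (real p)"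
    using flat_le_powr[of "c / 2" \<tau> "real p"] assms by auto
  \<comment> \<open>The extra exponent 1/\<tau> + 1 cancels the negative power in
    \<open>flat_deriv\<close>.\<close>
  obtain K2 where K2: "0 < K2"
    "\<And>w. 0 < w \<Longrightarrow> exp (- (c / 2) * w powr (- 1 / \<tau>)) \<le> K2 * w powr (real p + (1 / \<tau> + 1))"
    using flat_le_powr[of "c / 2" \<tau> "real p + (1 / \<tau> + 1)"] assms by auto
  show ?thesis
  proof
    show "0 < K1 + c / \<tau> * K2" using K1(1) K2(1) assms by (simp add: add_pos_pos)
    fix t :: real assume t: "t \<in> {0..1}"
    show "flat c \<tau> t + \<bar>flat_deriv c \<tau> t\<bar> \<le> (K1 + c / \<tau> * K2) * (t * (1 - t)) ^ p * flat (c / 2) \<tau> t"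
    proof (cases "t \<in> {0<..<1}")
      case True
      define w where "w = t * (1 - t)"
      define e where "e = flat (c / 2) \<tau> t"
      have w: "0 < w" using True by (simp add: w_def)
      have e: "0 < e" "e = exp (- (c / 2) * w powr (- 1 / \<tau>))"
        using True by (simp_all add: e_def flat_def w_def)
      have ee: "flat c \<tau> t = e * e" unfolding e_def by (rule flat_half)
      have "e \<le> K1 * w ^ p" using K1(2)[OF w] e(2) w by (simp add: powr_realpow)
      then have 1: "flat c \<tau> t \<le> K1 * w ^ p * e"
        using e(1) ee by simp
      have "w powr (- 1 / \<tau> - 1) * e \<le> w powr (- 1 / \<tau> - 1) * (K2 * w powr (real p + (1 / \<tau> + 1)))"
        using K2(2)[OF w] e(2) by (intro mult_left_mono) auto
      also have "\<dots> = K2 * (w powr ((- 1 / \<tau> - 1) + (real p + (1 / \<tau> + 1))))"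
        by (simp only: powr_add) simp
      also have "(- 1 / \<tau> - 1) + (real p + (1 / \<tau> + 1)) = real p" by simp
      finally have 2: "w powr (- 1 / \<tau> - 1) * e \<le> K2 * w ^ p"
        using w by (simp add: powr_realpow)
      have "\<bar>flat_deriv c \<tau> t\<bar> = c / \<tau> * \<bar>1 - 2 * t\<bar> * (w powr (- 1 / \<tau> - 1) * e * e)"
        unfolding flat_deriv_def ee w_def[symmetric] using assms e(1) by (simp add: abs_mult)
      also have "\<dots> \<le> c / \<tau> * 1 * (K2 * w ^ p * e)"
      proof (rule mult_mono)
        show "c / \<tau> * \<bar>1 - 2 * t\<bar> \<le> c / \<tau> * 1"
          using assms True by (intro mult_left_mono) auto
        show "w powr (- 1 / \<tau> - 1) * e * e \<le> K2 * w ^ p * e"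
          using 2 e(1) by (intro mult_right_mono) auto
      qed (use e(1) assms in auto)
      finally show ?thesis
        using 1 unfolding w_def[symmetric] e_def[symmetric] by (simp add: algebra_simps)
    qed (use t in \<open>auto simp: flat_def flat_deriv_def\<close>)
  qed
qed

lemma has_vector_derivative_0_quadratic:
  fixes f :: "real \<Rightarrow> real"
  assumes "f a = 0" "\<And>x. x \<in> S \<Longrightarrow> \<bar>f x\<bar> \<le> K * (x - a)\<^sup>2"
  shows "(f has_vector_derivative 0) (at a within S)"
  unfolding has_vector_derivative_def
proof (rule has_derivativeI_sandwich[of 1 _ _ _ _ "\<lambda>x. K * \<bar>x - a\<bar>"])
  show "((\<lambda>x. K * \<bar>x - a\<bar>) \<longlongrightarrow> 0) (at a within S)"
    by (auto intro!: tendsto_eq_intros)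
  fix y assume y: "y \<in> S" "y \<noteq> a"
  have "\<bar>f y\<bar> \<le> (K * \<bar>y - a\<bar>) * \<bar>y - a\<bar>"
    using assms(2)[OF y(1)] by (simp add: power2_eq_square mult.assoc)
  then show "norm (f y - f a - (y - a) *\<^sub>R 0) / norm (y - a) \<le> K * \<bar>y - a\<bar>"
    using y(2) assms(1) by (simp add: pos_divide_le_eq)
qed auto

text \<open>At the two ends the derivative is one-sided, and the formula cannot be differentiated;
  there it is 0 because \<open>flat_bound\<close> with exponent 2 makes the function quadratically
  small.\<close>

lemma has_vector_derivative_flat:
  assumes "0 < c" "0 < \<tau>" "t \<in> {0..1}"
  shows "(flat c \<tau> has_vector_derivative flat_deriv c \<tau> t) (at t within {0..1})"
proof (cases "t \<in> {0<..<1}")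
  case True
  have "((\<lambda>t. exp (- c * (t * (1 - t)) powr (- 1 / \<tau>))) has_real_derivative
      exp (- c * (t * (1 - t)) powr (- 1 / \<tau>)) * (- c * (- 1 / \<tau> * (t * (1 - t)) powr (- 1 / \<tau> - 1) * (1 - 2 * t)))) (at t)"
    using True
    by (intro DERIV_fun_exp DERIV_cmult DERIV_fun_powr) (auto intro!: derivative_eq_intros)
  also have "exp (- c * (t * (1 - t)) powr (- 1 / \<tau>)) * (- c * (- 1 / \<tau> * (t * (1 - t)) powr (- 1 / \<tau> - 1) * (1 - 2 * t)))
      = flat_deriv c \<tau> t"
    using True by (simp add: flat_deriv_def flat_def)
  finally have "(flat c \<tau> has_real_derivative flat_deriv c \<tau> t) (at t)"
    by (rule has_field_derivative_transform_within_open[OF _ open_greaterThanLessThan True])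
      (auto simp: flat_def)
  then show ?thesis
    using has_field_derivative_at_within has_real_derivative_iff_has_vector_derivative by blast
next
  case False
  obtain K where K: "0 < K" "\<And>t. t \<in> {0..1} \<Longrightarrow>
      flat c \<tau> t + \<bar>flat_deriv c \<tau> t\<bar> \<le> K * (t * (1 - t)) ^ 2 * flat (c / 2) \<tau> t"
    using flat_bound[OF assms(1,2), of 2] by metis
  have flat1: "flat (c / 2) \<tau> x \<le> 1" for x
    using assms by (simp add: flat_def)
  have le: "\<bar>flat c \<tau> x\<bar> \<le> K * (x * (1 - x))\<^sup>2" if "x \<in> {0..1}" for x
  proof -
    have "\<bar>flat c \<tau> x\<bar> \<le> K * (x * (1 - x))\<^sup>2 * flat (c / 2) \<tau> x"
      using K(2)[OF that] flat_nonneg[of c \<tau> x] by linarith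
    also have "\<dots> \<le> K * (x * (1 - x))\<^sup>2 * 1"
      using flat1 K(1) by (intro mult_left_mono) auto
    finally show ?thesis by simp
  qed
  have t: "t = 0 \<or> t = 1" using False assms(3) by auto
  have "(flat c \<tau> has_vector_derivative 0) (at t within {0..1})"
  proof (rule has_vector_derivative_0_quadratic)
    show "flat c \<tau> t = 0" using t by auto
    fix x :: real assume x: "x \<in> {0..1}"
    have "(x * (1 - x))\<^sup>2 \<le> (x - t)\<^sup>2"
    proof (rule abs_le_square_iff[THEN iffD1])
      have "x * (1 - x) \<le> x" "x * (1 - x) \<le> 1 - x" "0 \<le> x * (1 - x)"
        using x mult_left_mono[of "1 - x" 1 x] mult_right_mono[of x 1 "1 - x"] by auto
      then show "\<bar>x * (1 - x)\<bar> \<le> \<bar>x - t\<bar>" using t x by auto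
    qed
    then show "\<bar>flat c \<tau> x\<bar> \<le> K * (x - t)\<^sup>2"
      using le[OF x] K(1) by (meson mult_left_mono less_imp_le order_trans)
  qed
  then show ?thesis using t by auto
qed

text \<open>Serves for formulas that are singular at t = 0 and t = 1 but small nearby: the bound
  squeezes the function to its value 0.\<close>

lemma continuous_on_unit_intervalI:
  fixes f :: "real \<Rightarrow> 'a::real_normed_vector"
  assumes "continuous_on {0<..<1} f" "f 0 = 0" "f 1 = 0"
    and "\<And>t. t \<in> {0<..<1} \<Longrightarrow> norm (f t) \<le> C * (t * (1 - t))"
  shows "continuous_on {0..1} f"
  unfolding continuous_on_eq_continuous_within
proof
  fix t :: real assume t: "t \<in> {0..1}"
  show "continuous (at t within {0..1}) f"
  proof (cases "t \<in> {0<..<1}")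
    case True
    then have "isCont f t" using assms(1) continuous_on_eq_continuous_at open_greaterThanLessThan by blast
    then show ?thesis by (rule continuous_at_imp_continuous_at_within)
  next
    case False
    then have t: "t = 0 \<or> t = 1" using t by auto
    have le: "norm (f s) \<le> C * (s * (1 - s))" if "s \<in> {0..1}" for s
      using assms(2-4) that by (cases "s \<in> {0<..<1}") force+
    have "((\<lambda>s. C * (s * (1 - s))) \<longlongrightarrow> C * (t * (1 - t))) (at t within {0..1})"
      by (intro tendsto_intros)
    then have "((\<lambda>s. C * (s * (1 - s))) \<longlongrightarrow> 0) (at t within {0..1})"
      using t by auto
    then have "(f \<longlongrightarrow> 0) (at t within {0..1})"
      by (rule Lim_null_comparison[rotated]) (use le in \<open>auto simp: eventually_at_filter\<close>)
    then show ?thesis using t assms(2,3) by (auto simp: continuous_within)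
  qed
qed

lemma continuous_on_flat_deriv:
  assumes "0 < c" "0 < \<tau>"
  shows "continuous_on {0..1} (flat_deriv c \<tau>)"
proof -
  obtain K where K: "0 < K" "\<And>t. t \<in> {0..1} \<Longrightarrow>
      flat c \<tau> t + \<bar>flat_deriv c \<tau> t\<bar> \<le> K * (t * (1 - t)) ^ 1 * flat (c / 2) \<tau> t"
    using flat_bound[OF assms, of 1] by metis
  show ?thesis
  proof (rule continuous_on_unit_intervalI[where C = K])
    have "continuous_on {0<..<1} (\<lambda>t. c / \<tau> * (1 - 2 * t) * (t * (1 - t)) powr (- 1 / \<tau> - 1) *
        exp (- c * (t * (1 - t)) powr (- 1 / \<tau>)))"
      by (intro continuous_intros) auto
    then show "continuous_on {0<..<1} (flat_deriv c \<tau>)"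
      by (rule continuous_on_eq) (auto simp: flat_deriv_def flat_def)
    fix t :: real assume t: "t \<in> {0<..<1}"
    have "flat (c / 2) \<tau> t \<le> 1" using assms by (simp add: flat_def)
    have "\<bar>flat_deriv c \<tau> t\<bar> \<le> K * (t * (1 - t)) * flat (c / 2) \<tau> t"
      using K(2)[of t] t flat_nonneg[of c \<tau> t] by simp
    also have "\<dots> \<le> K * (t * (1 - t)) * 1"
      using \<open>flat (c / 2) \<tau> t \<le> 1\<close> K(1) t by (intro mult_left_mono) auto
    finally show "norm (flat_deriv c \<tau> t) \<le> K * (t * (1 - t))" by simp
  qed simp_all
qed

section \<open>Cauchy's formula between graphs over the circle\<close>

lemma bounded_bilinear_scaleC:
  "bounded_bilinear (scaleC :: complex \<Rightarrow> 'b::complex_banach \<Rightarrow> 'b)"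
proof
  fix a a' :: complex and r :: real and x y :: 'b
  show "(a + a') *\<^sub>C x = a *\<^sub>C x + a' *\<^sub>C x" by (rule scaleC_add_left)
  show "a *\<^sub>C (x + y) = a *\<^sub>C x + a *\<^sub>C y" by (rule scaleC_add_right)
  show "(r *\<^sub>R a) *\<^sub>C x = r *\<^sub>R (a *\<^sub>C x)"
    by (metis scaleC_of_real scaleC_scaleC scaleR_conv_of_real)
  show "a *\<^sub>C (r *\<^sub>R x) = r *\<^sub>R (a *\<^sub>C x)"
    by (simp add: scaleC_of_real[symmetric] scaleC_scaleC mult.commute)
  show "\<exists>K. \<forall>a (x::'b). norm (a *\<^sub>C x) \<le> norm a * norm x * K"
    by (rule exI[of _ 1]) (simp add: norm_scaleC)
qed

interpretation scaleC: bounded_bilinear "scaleC :: complex \<Rightarrow> 'b::complex_banach \<Rightarrow> 'b"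
  by (rule bounded_bilinear_scaleC)

lemma scaleC_one [simp]: "1 *\<^sub>C x = x"
  using scaleC_of_real[of 1 x] by simp

lemmas continuous_on_scaleC [continuous_intros] = scaleC.continuous_on

lemma has_vector_derivative_complex_chain:
  fixes z :: "real \<Rightarrow> complex" and g :: "complex \<Rightarrow> 'b::complex_banach"
  assumes "(z has_vector_derivative z') (at s within U)" and "z ` U \<subseteq> D"
    and "(g has_derivative (\<lambda>h. h *\<^sub>C D1)) (at (z s) within D)"
  shows "((\<lambda>s. g (z s)) has_vector_derivative z' *\<^sub>C D1) (at s within U)"
proof -
  have "((\<lambda>s. g (z s)) has_derivative (\<lambda>h. (h *\<^sub>R z') *\<^sub>C D1)) (at s within U)"
    using assms(1) has_derivative_subset[OF assms(3,2)]
    unfolding has_vector_derivative_def by (rule has_derivative_in_compose)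
  then show ?thesis by (simp add: has_vector_derivative_def scaleC.scaleR_left)
qed

text \<open>
  Differentiating under the integral sign, the \<open>s\<close>-derivative of the integrand \<open>zt * g z\<close> is the
  \<open>t\<close>-derivative of \<open>zs * g z\<close>. Only derivatives of \<open>g\<close> relative to \<open>D\<close> enter, so \<open>D\<close>
  need not be open, and finitely many parameters \<open>s\<close>, at which the curve meets the exceptional
  set \<open>P\<close>, are harmless.
\<close>

lemma homotopy_integral_eq:
  fixes z zs zt zst :: "real \<Rightarrow> real \<Rightarrow> complex" and g g1 :: "complex \<Rightarrow> 'b::complex_banach"
  assumes fin: "finite S"
    and zD: "\<And>s t. s \<in> {0..1} \<Longrightarrow> t \<in> {0..1} \<Longrightarrow> z s t \<in> D"
    and zP: "\<And>s t. s \<in> {0..1} - S \<Longrightarrow> t \<in> {0..1} \<Longrightarrow> z s t \<notin> P"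
    and cg: "continuous_on D g" and cg1: "continuous_on (D - P) g1"
    and deriv: "\<And>w. w \<in> D - P \<Longrightarrow> (g has_derivative (\<lambda>h. h *\<^sub>C g1 w)) (at w within D)"
    and zs: "\<And>s t. s \<in> {0..1} \<Longrightarrow> t \<in> {0..1} \<Longrightarrow>
      ((\<lambda>s. z s t) has_vector_derivative zs s t) (at s within {0..1})"
    and zt: "\<And>s t. s \<in> {0..1} \<Longrightarrow> t \<in> {0..1} \<Longrightarrow>
      ((\<lambda>t. z s t) has_vector_derivative zt s t) (at t within {0..1})"
    and zts: "\<And>s t. s \<in> {0..1} \<Longrightarrow> t \<in> {0..1} \<Longrightarrow>
      ((\<lambda>s. zt s t) has_vector_derivative zst s t) (at s within {0..1})"
    and zst: "\<And>s t. s \<in> {0..1} \<Longrightarrow> t \<in> {0..1} \<Longrightarrow>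
      ((\<lambda>t. zs s t) has_vector_derivative zst s t) (at t within {0..1})"
    and cz: "continuous_on ({0..1} \<times> {0..1}) (\<lambda>(s, t). z s t)"
      "continuous_on ({0..1} \<times> {0..1}) (\<lambda>(s, t). zs s t)"
      "continuous_on ({0..1} \<times> {0..1}) (\<lambda>(s, t). zt s t)"
      "continuous_on ({0..1} \<times> {0..1}) (\<lambda>(s, t). zst s t)"
    and closed: "\<And>s. s \<in> {0..1} \<Longrightarrow> z s 0 = z s 1" "\<And>s. s \<in> {0..1} \<Longrightarrow> zs s 0 = zs s 1"
  shows "integral {0..1} (\<lambda>t. zt 0 t *\<^sub>C g (z 0 t)) = integral {0..1} (\<lambda>t. zt 1 t *\<^sub>C g (z 1 t))"
proof -
  define J where "J s = integral {0..1} (\<lambda>t. zt s t *\<^sub>C g (z s t))" for s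

  have cgz: "continuous_on ({0..1} \<times> {0..1}) (\<lambda>(s, t). g (z s t))"
    unfolding case_prod_beta'
    by (rule continuous_on_compose2[OF cg cz(1)[unfolded case_prod_beta']]) (auto intro: zD)
  have cint: "continuous_on ({0..1} \<times> {0..1}) (\<lambda>(s, t). zt s t *\<^sub>C g (z s t))"
    using scaleC.continuous_on[OF cz(3) cgz] by (simp add: case_prod_beta')
  have contJ: "continuous_on {0..1} J"
    unfolding J_def
    using integral_continuous_on_param[of "{0..1}" "0 :: real" "1 :: real", unfolded cbox_interval, OF cint]
    by simp
  have slice: "continuous_on {0..1} (\<lambda>t. zt s t *\<^sub>C g (z s t))" if "s \<in> {0..1}" for s
  proof -
    have "continuous_on {0..1} (Pair s)" "Pair s ` {0..1} \<subseteq> {0..1} \<times> {0..1}"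
      using that by (auto intro!: continuous_intros)
    from continuous_on_compose2[OF cint this] show ?thesis by simp
  qed
  have derJ: "(J has_derivative (\<lambda>h. 0)) (at s within {0..1})" if s: "s \<in> {0..1} - S" for s
  proof -
    have "open (- S)" using fin by (simp add: finite_imp_closed open_Compl)
    then obtain e where e: "0 < e" "ball s e \<subseteq> - S"
      using s open_contains_ball by blast
    \<comment> \<open>The Leibniz rule asks for a convex parameter set on which the derivative is
      continuous, hence for a neighbourhood of \<open>s\<close> that avoids
      \<open>S\<close>.\<close>
    define U where "U = {0..1} \<inter> ball s e"
    have U: "s \<in> U" "convex U" "U \<subseteq> {0..1}" "U \<subseteq> {0..1} - S"
      using s e by (auto simp: U_def intro!: convex_Int)
    let ?d = "\<lambda>s t. zt s t *\<^sub>C (zs s t *\<^sub>C g1 (z s t)) + zst s t *\<^sub>C g (z s t)"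
    have "(J has_vector_derivative integral (cbox 0 1) (?d s)) (at s within U)"
      unfolding J_def cbox_interval[symmetric]
    proof (rule leibniz_rule_vector_derivative[OF _ _ _ U(1,2)])
      fix u t :: real assume u: "u \<in> U" and t: "t \<in> cbox 0 1"
      have u': "u \<in> {0..1}" "z u t \<in> D - P" using u t U zD zP by (auto simp: cbox_interval)
      have *: "((\<lambda>s. g (z s t)) has_vector_derivative zs u t *\<^sub>C g1 (z u t)) (at u within U)"
        using has_vector_derivative_within_subset[OF zs U(3)] u' t U(3) zD deriv
        by (intro has_vector_derivative_complex_chain[where D = D]) (auto simp: cbox_interval)
      show "((\<lambda>s. zt s t *\<^sub>C g (z s t)) has_vector_derivative ?d u t) (at u within U)"
        using has_vector_derivative_within_subset[OF zts U(3)] u' t *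
        by (intro scaleC.has_vector_derivative) (auto simp: cbox_interval)
    next
      show "(\<lambda>t. zt u t *\<^sub>C g (z u t)) integrable_on cbox 0 1" if "u \<in> U" for u
        using slice[of u] that U(3) by (auto simp: cbox_interval intro!: integrable_continuous_real)
      have sub: "U \<times> {0..1} \<subseteq> {0..1} \<times> {0..1}" using U(3) by auto
      note c = cz[THEN continuous_on_subset, OF sub] cgz[THEN continuous_on_subset, OF sub]
      have "continuous_on (U \<times> {0..1}) (\<lambda>(s, t). g1 (z s t))"
        unfolding case_prod_beta'
      proof (rule continuous_on_compose2[OF cg1 c(1)[unfolded case_prod_beta']])
        show "(\<lambda>p. z (fst p) (snd p)) ` (U \<times> {0..1}) \<subseteq> D - P"
          using zD zP U(3,4) by (auto simp: subset_eq)
      qed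
      then show "continuous_on (U \<times> cbox 0 1) (\<lambda>(s, t). ?d s t)"
        using c unfolding cbox_interval case_prod_beta' by (intro continuous_intros)
    qed
    also have "integral (cbox 0 1) (?d s) = zs s 1 *\<^sub>C g (z s 1) - zs s 0 *\<^sub>C g (z s 0)"
      unfolding cbox_interval
    proof (rule integral_unique, rule fundamental_theorem_of_calculus)
      fix t :: real assume t: "t \<in> {0..1}"
      have "((\<lambda>t. g (z s t)) has_vector_derivative zt s t *\<^sub>C g1 (z s t)) (at t within {0..1})"
        using s t zD zP zt deriv
        by (intro has_vector_derivative_complex_chain[where D = D]) auto
      then have "((\<lambda>t. zs s t *\<^sub>C g (z s t)) has_vector_derivative
          (zs s t *\<^sub>C (zt s t *\<^sub>C g1 (z s t)) + zst s t *\<^sub>C g (z s t))) (at t within {0..1})"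
        using s t zst by (intro scaleC.has_vector_derivative) auto
      then show "((\<lambda>t. zs s t *\<^sub>C g (z s t)) has_vector_derivative ?d s t) (at t within {0..1})"
        by (simp add: scaleC_scaleC mult.commute)
    qed simp
    also have "\<dots> = 0" using closed s by simp
    finally have "(J has_derivative (\<lambda>h. 0)) (at s within U)"
      by (simp add: has_vector_derivative_def)
    moreover have "at s within U = at s within {0..1}"
      unfolding U_def using e by (intro at_within_nhd[of _ "ball s e"]) auto
    ultimately show ?thesis by simp
  qed
  \<comment> \<open>Continuity of \<open>J\<close> bridges the finitely many parameters in
    \<open>S\<close>.\<close>
  have "J 1 = J 0"
    by (rule has_derivative_zero_unique_strong_interval[OF fin contJ refl derJ]) auto
  then show ?thesis by (simp add: J_def)
qed

text \<open>This is exp(2 \<pi> i (t + i y)), of modulus exp(-2 \<pi> y): positive heights lie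
  inside the unit disk, negative ones outside.\<close>

definition annulus_point :: "real \<Rightarrow> real \<Rightarrow> complex"
  where "annulus_point t y = exp (of_real (- 2 * pi * y) + \<i> * of_real (2 * pi * t))"

text \<open>The contour integral of \<open>g\<close>, counterclockwise along the closed curve at
  height \<open>h\<close>. The derivative \<open>h'\<close> is passed separately, as it is meant
  relative to the parameter interval and is one-sided at its ends.\<close>

definition graph_integral :: "(real \<Rightarrow> real) \<Rightarrow> (real \<Rightarrow> real) \<Rightarrow> (complex \<Rightarrow> 'b::complex_banach) \<Rightarrow> 'b"
  where "graph_integral h h' g = integral {0..1}
    (\<lambda>t. ((of_real (- 2 * pi * h' t) + \<i> * of_real (2 * pi)) * annulus_point t (h t)) *\<^sub>C
      g (annulus_point t (h t)))"

lemma norm_annulus_point [simp]: "norm (annulus_point t y) = exp (- 2 * pi * y)"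
  by (simp add: annulus_point_def norm_exp_eq_Re)

lemma annulus_point_eqD:
  assumes "annulus_point t y = annulus_point t' y'"
  shows "y = y'" "\<exists>n::int. t = t' + of_int n"
proof -
  show "y = y'" using arg_cong[OF assms, of norm] by simp
  obtain n :: int where n: "of_real (- 2 * pi * y) + \<i> * of_real (2 * pi * t)
      = of_real (- 2 * pi * y') + \<i> * of_real (2 * pi * t') + (of_int (2 * n) * pi) * \<i>"
    using assms unfolding annulus_point_def exp_eq by auto
  from arg_cong[OF n, of Im] have "2 * pi * t = 2 * pi * (t' + of_int n)"
    by (simp add: algebra_simps)
  then show "\<exists>n::int. t = t' + of_int n" by auto
qed

lemma annulus_point_eq_unit:
  assumes "annulus_point t y = annulus_point t' y'" "t \<in> {0..1}" "t' \<in> {0..1}"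
  shows "t = t' \<or> t = 0 \<and> t' = 1 \<or> t = 1 \<and> t' = 0"
proof -
  obtain n :: int where n: "t = t' + of_int n" using annulus_point_eqD(2)[OF assms(1)] by blast
  then have "\<bar>real_of_int n\<bar> \<le> 1" using assms(2,3) by auto
  then have "n = 0 \<or> n = 1 \<or> n = -1" by linarith
  then show ?thesis using n assms(2,3) by auto
qed

lemma annulus_point_nonzero [simp]: "annulus_point t y \<noteq> 0"
  by (simp add: annulus_point_def)

lemma annulus_point_0_1: "annulus_point 0 y = annulus_point 1 y"
  by (auto simp: annulus_point_def exp_eq intro!: exI[of _ "-1"])

lemma has_vector_derivative_annulus_point:
  assumes "(x has_vector_derivative x') (at s within U)" "(y has_vector_derivative y') (at s within U)"
  shows "((\<lambda>s. annulus_point (x s) (y s)) has_vector_derivative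
    (of_real (- 2 * pi * y') + \<i> * of_real (2 * pi * x')) * annulus_point (x s) (y s)) (at s within U)"
proof -
  have "((\<lambda>s. of_real (- 2 * pi * y s) + \<i> * of_real (2 * pi * x s)) has_vector_derivative
      (of_real (- 2 * pi * y') + \<i> * of_real (2 * pi * x'))) (at s within U)"
    using assms unfolding has_real_derivative_iff_has_vector_derivative[symmetric]
    by (intro has_vector_derivative_add has_vector_derivative_of_real
        has_vector_derivative_mult_right) (auto intro!: derivative_eq_intros)
  from field_vector_diff_chain_within[OF this has_field_derivative_at_within[OF DERIV_exp]]
  show ?thesis unfolding annulus_point_def o_def .
qed

lemma continuous_on_annulus_point [continuous_intros]:
  "continuous_on S x \<Longrightarrow> continuous_on S y \<Longrightarrow> continuous_on S (\<lambda>s. annulus_point (x s) (y s))"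
  unfolding annulus_point_def by (intro continuous_intros)

text \<open>The height moves along the segment from \<open>h t\<close> to \<open>b\<close>. Since
  these differ, the moving curve meets \<open>p\<close> for at most one value of the homotopy
  parameter; this is why continuity of \<open>g\<close> is enough at \<open>p\<close>.\<close>

lemma graph_integral_deform:
  fixes h h' :: "real \<Rightarrow> real" and g g1 :: "complex \<Rightarrow> 'b::complex_banach"
  assumes h: "\<And>t. t \<in> {0..1} \<Longrightarrow> (h has_vector_derivative h' t) (at t within {0..1})"
    and ch': "continuous_on {0..1} h'" and h01: "h 0 = h 1"
    and hb: "\<And>t. t \<in> {0..1} \<Longrightarrow> h t \<noteq> b"
    and D: "\<And>t y. t \<in> {0..1} \<Longrightarrow> y \<in> closed_segment (h t) b \<Longrightarrow> annulus_point t y \<in> D"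
    and cg: "continuous_on D g" and cg1: "continuous_on (D - {p}) g1"
    and deriv: "\<And>w. w \<in> D - {p} \<Longrightarrow> (g has_derivative (\<lambda>h. h *\<^sub>C g1 w)) (at w within D)"
  shows "graph_integral h h' g = graph_integral (\<lambda>_. b) (\<lambda>_. 0) g"
proof -
  define y where "y s t = (1 - s) * h t + s * b" for s t
  define z where "z s t = annulus_point t (y s t)" for s t
  define zs where "zs s t = of_real (- 2 * pi * (b - h t)) * z s t" for s t
  define zt where "zt s t = (of_real (- 2 * pi * ((1 - s) * h' t)) + \<i> * of_real (2 * pi)) * z s t" for s t
  define zst where "zst s t = of_real (2 * pi * h' t) * z s t + of_real (- 2 * pi * (b - h t)) * zt s t" for s t
  define S where "S = {s \<in> {0..1}. \<exists>t\<in>{0..1}. z s t = p}"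
  \<comment> \<open>Equal points have equal heights, and equal \<open>t\<close> up to the identified
    ends, where \<open>h 0 = h 1\<close>. So \<open>h\<close> agrees, and the moving height
    determines \<open>s\<close>.\<close>
  have uniq: "s = s'" if s: "s \<in> S" "s' \<in> S" for s s'
  proof -
    obtain t where "t \<in> {0..1}" "annulus_point t (y s t) = p"
      using s(1) unfolding S_def z_def by blast
    moreover obtain t' where "t' \<in> {0..1}" "annulus_point t' (y s' t') = p"
      using s(2) unfolding S_def z_def by blast
    ultimately have t: "t \<in> {0..1}" "t' \<in> {0..1}" "annulus_point t (y s t) = annulus_point t' (y s' t')"
      by simp_all
    have "h t = h t'" using annulus_point_eq_unit[OF t(3,1,2)] h01 by auto
    then have "(s - s') * (b - h t) = 0"
      using annulus_point_eqD(1)[OF t(3)] by (simp add: y_def algebra_simps)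
    then show "s = s'" using hb[OF t(1)] by simp
  qed
  have fin: "finite S"
  proof (cases "S = {}")
    case False
    then obtain s where "s \<in> S" by blast
    then have "S \<subseteq> {s}" using uniq by blast
    then show ?thesis by (rule finite_subset) simp
  qed simp
  have ch: "continuous_on {0..1} h"
    using has_vector_derivative_continuous[OF h] by (simp add: continuous_on_eq_continuous_within)
  have chs: "continuous_on ({0..1} \<times> {0..1}) (\<lambda>p. h (snd p))"
      "continuous_on ({0..1} \<times> {0..1}) (\<lambda>p. h' (snd p))"
    by (rule continuous_on_compose2[OF ch] continuous_on_compose2[OF ch'], auto intro!: continuous_intros)+
  have cy: "continuous_on ({0..1} \<times> {0..1}) (\<lambda>p. y (fst p) (snd p))"
    unfolding y_def by (intro continuous_intros chs)
  have cz: "continuous_on ({0..1} \<times> {0..1}) (\<lambda>p. z (fst p) (snd p))"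
    unfolding z_def by (intro continuous_intros cy)
  have czt: "continuous_on ({0..1} \<times> {0..1}) (\<lambda>p. zt (fst p) (snd p))"
    unfolding zt_def by (intro continuous_intros cz chs)
  have ys: "((\<lambda>s. y s t) has_vector_derivative b - h t) (at s within {0..1})" for s t
    unfolding y_def by (auto intro!: derivative_eq_intros simp: has_real_derivative_iff_has_vector_derivative[symmetric])
  have yt: "((\<lambda>t. y s t) has_vector_derivative (1 - s) * h' t) (at t within {0..1})"
    if "t \<in> {0..1}" for s t
    using h[OF that] unfolding y_def has_real_derivative_iff_has_vector_derivative[symmetric]
    by (auto intro!: derivative_eq_intros)
  have dzs: "((\<lambda>s. z s t) has_vector_derivative zs s t) (at s within {0..1})" for s t
    using has_vector_derivative_annulus_point[OF has_vector_derivative_const ys]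
    unfolding z_def zs_def by simp
  have dzt: "((\<lambda>t. z s t) has_vector_derivative zt s t) (at t within {0..1})" if "t \<in> {0..1}" for s t
    using has_vector_derivative_annulus_point[OF has_vector_derivative_id yt[OF that]]
    unfolding z_def zt_def by simp
  have "integral {0..1} (\<lambda>t. zt 0 t *\<^sub>C g (z 0 t)) = integral {0..1} (\<lambda>t. zt 1 t *\<^sub>C g (z 1 t))"
  proof (rule homotopy_integral_eq[OF fin _ _ cg cg1 deriv])
    fix s t :: real assume st: "s \<in> {0..1}" "t \<in> {0..1}"
    have "y s t \<in> closed_segment (h t) b"
      using st by (auto simp: y_def closed_segment_def)
    then show "z s t \<in> D" unfolding z_def using D st by blast
    show "((\<lambda>s. z s t) has_vector_derivative zs s t) (at s within {0..1})" by (rule dzs)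
    show "((\<lambda>t. z s t) has_vector_derivative zt s t) (at t within {0..1})" using dzt st by blast
    have "((\<lambda>s. of_real (- 2 * pi * ((1 - s) * h' t)) + \<i> * of_real (2 * pi) :: complex)
        has_vector_derivative of_real (2 * pi * h' t)) (at s within {0..1})"
      unfolding has_vector_derivative_def
      by (auto intro!: derivative_eq_intros simp: scaleR_conv_of_real algebra_simps)
    from has_vector_derivative_mult[OF this dzs[of t]]
    show "((\<lambda>s. zt s t) has_vector_derivative zst s t) (at s within {0..1})"
      unfolding zt_def zst_def zs_def by (simp add: algebra_simps)
    have "((\<lambda>t. of_real (- 2 * pi * (b - h t)) :: complex) has_vector_derivative of_real (2 * pi * h' t))
        (at t within {0..1})"
      using h[OF st(2)] unfolding has_real_derivative_iff_has_vector_derivative[symmetric]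
      by (intro has_vector_derivative_of_real) 
        (auto intro!: derivative_eq_intros simp: has_real_derivative_iff_has_vector_derivative[symmetric])
    from has_vector_derivative_mult[OF this dzt[OF st(2), of s]]
    show "((\<lambda>t. zs s t) has_vector_derivative zst s t) (at t within {0..1})"
      unfolding zst_def zs_def by (simp add: algebra_simps)
  next
    show "continuous_on ({0..1} \<times> {0..1}) (\<lambda>(s, t). zs s t)"
      "continuous_on ({0..1} \<times> {0..1}) (\<lambda>(s, t). zst s t)"
      unfolding case_prod_beta' zs_def zst_def by (intro continuous_intros cz czt chs)+
    show "z s 0 = z s 1" "zs s 0 = zs s 1" for s
      using annulus_point_0_1 by (simp_all add: z_def y_def zs_def h01)
  qed (use cz czt in \<open>auto simp: S_def case_prod_beta'\<close>)
  then show ?thesis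
    by (simp add: graph_integral_def zt_def z_def y_def)
qed

section \<open>Winding numbers and the Cauchy kernel\<close>

lemma has_derivative_inverse_diff:
  "w \<noteq> q \<Longrightarrow> ((\<lambda>\<zeta>. inverse (\<zeta> - q)) has_derivative (\<lambda>h. h *\<^sub>C (- (inverse (w - q))\<^sup>2))) (at w within D)"
  for q w :: complex
  by (auto intro!: derivative_eq_intros simp: scaleC_complex_def power2_eq_square)

text \<open>The circle is translated by \<open>s * q\<close> until it is centred at
  \<open>q\<close>, where the integrand is the constant 2 \<pi> i. It never meets \<open>q\<close>,
  because |q| is less than the radius.\<close>

lemma graph_integral_circle_inside:
  assumes "norm q < exp (- 2 * pi * b)"
  shows "graph_integral (\<lambda>_. b) (\<lambda>_. 0) (\<lambda>\<zeta>. inverse (\<zeta> - q)) = 2 * pi * \<i>"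
proof -
  define z where "z s t = annulus_point t b + of_real s * q" for s t
  define zt where "zt s t = \<i> * of_real (2 * pi) * annulus_point t b" for s t :: real
  have ne: "z s t \<noteq> q" if "s \<in> {0..1}" for s t
  proof
    assume "z s t = q"
    then have "annulus_point t b = of_real (1 - s) * q" by (simp add: z_def algebra_simps)
    from arg_cong[OF this, of norm] have "exp (- 2 * pi * b) = (1 - s) * norm q"
      using that by (simp add: norm_mult del: of_real_diff)
    also have "\<dots> \<le> norm q" using that by (simp add: mult_left_le_one_le)
    finally show False using assms by simp
  qed
  have "integral {0..1} (\<lambda>t. zt 0 t *\<^sub>C inverse (z 0 t - q)) = integral {0..1} (\<lambda>t. zt 1 t *\<^sub>C inverse (z 1 t - q))"
  proof (rule homotopy_integral_eq[where S = "{}" and D = "- {q}" and P = "{}"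
        and zs = "\<lambda>s t. q" and zst = "\<lambda>s t. 0" and ?g1.0 = "\<lambda>w. - (inverse (w - q))\<^sup>2" and z = z])
    fix s t :: real assume "s \<in> {0..1}" "t \<in> {0..1}"
    show "((\<lambda>s. z s t) has_vector_derivative q) (at s within {0..1})"
      unfolding z_def by (auto intro!: derivative_eq_intros simp: has_vector_derivative_def scaleR_conv_of_real)
    have "((\<lambda>t. annulus_point t b) has_vector_derivative zt s t) (at t within {0..1})"
      using has_vector_derivative_annulus_point[OF has_vector_derivative_id has_vector_derivative_const]
      by (simp add: zt_def)
    from has_vector_derivative_add[OF this has_vector_derivative_const]
    show "((\<lambda>t. z s t) has_vector_derivative zt s t) (at t within {0..1})"
      unfolding z_def by simp
  qed (use ne in \<open>auto simp: zt_def case_prod_beta' z_def annulus_point_0_1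
      intro!: continuous_intros has_derivative_inverse_diff\<close>)
  also have "(\<lambda>t. zt 1 t *\<^sub>C inverse (z 1 t - q)) = (\<lambda>t::real. \<i> * of_real (2 * pi))"
    by (simp add: fun_eq_iff zt_def z_def scaleC_complex_def)
  also have "integral {0..1} (\<lambda>t::real. \<i> * of_real (2 * pi)) = 2 * of_real pi * \<i>"
    by (subst integral_const_real) simp
  finally show ?thesis
    by (simp add: graph_integral_def zt_def z_def scaleC_complex_def)
qed

text \<open>The circle shrinks radially to the origin without meeting \<open>q\<close>, and a
  constant curve has integral 0.\<close>

lemma graph_integral_circle_outside:
  assumes "exp (- 2 * pi * b) < norm q"
  shows "graph_integral (\<lambda>_. b) (\<lambda>_. 0) (\<lambda>\<zeta>. inverse (\<zeta> - q)) = 0"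
proof -
  define z where "z s t = of_real (1 - s) * annulus_point t b" for s t
  define zt where "zt s t = of_real (1 - s) * (\<i> * of_real (2 * pi) * annulus_point t b)" for s t :: real
  have ne: "z s t \<noteq> q" if "s \<in> {0..1}" for s t
  proof
    assume "z s t = q"
    from arg_cong[OF this, of norm] have "norm q = (1 - s) * exp (- 2 * pi * b)"
      using that by (simp add: z_def norm_mult del: of_real_diff)
    also have "\<dots> \<le> exp (- 2 * pi * b)" using that by (simp add: mult_left_le_one_le)
    finally show False using assms by simp
  qed
  have dt: "((\<lambda>t. annulus_point t b) has_vector_derivative \<i> * of_real (2 * pi) * annulus_point t b) (at t within {0..1})" for t
    using has_vector_derivative_annulus_point[OF has_vector_derivative_id has_vector_derivative_const]
    by simp
  have "integral {0..1} (\<lambda>t. zt 0 t *\<^sub>C inverse (z 0 t - q)) = integral {0..1} (\<lambda>t. zt 1 t *\<^sub>C inverse (z 1 t - q))"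
  proof (rule homotopy_integral_eq[where S = "{}" and D = "- {q}" and P = "{}"
        and zs = "\<lambda>s t. - annulus_point t b" and zst = "\<lambda>s t. - (\<i> * of_real (2 * pi) * annulus_point t b)"
        and ?g1.0 = "\<lambda>w. - (inverse (w - q))\<^sup>2" and z = z])
    fix s t :: real assume "s \<in> {0..1}" "t \<in> {0..1}"
    show "((\<lambda>s. z s t) has_vector_derivative - annulus_point t b) (at s within {0..1})"
      "((\<lambda>s. zt s t) has_vector_derivative - (\<i> * of_real (2 * pi) * annulus_point t b)) (at s within {0..1})"
      unfolding z_def zt_def
      by (auto intro!: derivative_eq_intros simp: has_vector_derivative_def scaleR_conv_of_real)
    show "((\<lambda>t. z s t) has_vector_derivative zt s t) (at t within {0..1})"
      unfolding z_def zt_def using has_vector_derivative_mult_right[OF dt] by blast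
    show "((\<lambda>t. - annulus_point t b) has_vector_derivative - (\<i> * of_real (2 * pi) * annulus_point t b)) (at t within {0..1})"
      using has_vector_derivative_minus[OF dt] by simp
  qed (use ne in \<open>auto simp: zt_def case_prod_beta' z_def annulus_point_0_1
      intro!: continuous_intros has_derivative_inverse_diff\<close>)
  then show ?thesis
    by (simp add: graph_integral_def zt_def z_def scaleC_complex_def)
qed

lemma continuous_on_graph_integrand:
  fixes g :: "complex \<Rightarrow> 'b::complex_banach"
  assumes "continuous_on {0..1} h" "continuous_on {0..1} h'"
    and "continuous_on D g" "\<And>t. t \<in> {0..1} \<Longrightarrow> annulus_point t (h t) \<in> D"
  shows "continuous_on {0..1} (\<lambda>t. ((of_real (- 2 * pi * h' t) + \<i> * of_real (2 * pi)) *
      annulus_point t (h t)) *\<^sub>C g (annulus_point t (h t)))"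
proof -
  have "continuous_on {0..1} (\<lambda>t. annulus_point t (h t))"
    by (intro continuous_intros assms)
  then have "continuous_on {0..1} (\<lambda>t. g (annulus_point t (h t)))"
    by (rule continuous_on_compose2[OF assms(3)]) (use assms(4) in auto)
  then show ?thesis by (intro continuous_intros assms)
qed

lemma graph_integral_scaleC_right:
  fixes v :: "'b::complex_banach"
  assumes "continuous_on {0..1} h" "continuous_on {0..1} h'"
    and "continuous_on D k" "\<And>t. t \<in> {0..1} \<Longrightarrow> annulus_point t (h t) \<in> D"
  shows "graph_integral h h' (\<lambda>\<zeta>. k \<zeta> *\<^sub>C v) = graph_integral h h' k *\<^sub>C v"
proof -
  have "(\<lambda>t. ((of_real (- 2 * pi * h' t) + \<i> * of_real (2 * pi)) * annulus_point t (h t)) *\<^sub>C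
      k (annulus_point t (h t))) integrable_on {0..1}" (is "?f integrable_on _")
    by (rule integrable_continuous_real, rule continuous_on_graph_integrand) (use assms in auto)
  from integral_linear[OF this scaleC.bounded_linear_left[of v]]
  show ?thesis
    by (simp add: graph_integral_def o_def scaleC_complex_def scaleC_scaleC)
qed

lemma graph_integral_diff:
  fixes g1 g2 :: "complex \<Rightarrow> 'b::complex_banach"
  assumes "continuous_on {0..1} h" "continuous_on {0..1} h'"
    and "continuous_on D g1" "continuous_on D g2" "\<And>t. t \<in> {0..1} \<Longrightarrow> annulus_point t (h t) \<in> D"
  shows "graph_integral h h' (\<lambda>\<zeta>. g1 \<zeta> - g2 \<zeta>) = graph_integral h h' g1 - graph_integral h h' g2"
  unfolding graph_integral_def scaleC.diff_right
  by (intro integral_diff integrable_continuous_real)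
    (use continuous_on_graph_integrand[OF assms(1,2)] assms(3-5) in blast)+

lemma graph_integral_cong:
  "(\<And>t. t \<in> {0..1} \<Longrightarrow> g1 (annulus_point t (h t)) = g2 (annulus_point t (h t))) \<Longrightarrow>
    graph_integral h h' g1 = graph_integral h h' g2"
  unfolding graph_integral_def by (rule integral_cong) simp

lemma has_derivative_Cauchy_kernel:
  fixes f :: "complex \<Rightarrow> 'b::complex_banach"
  assumes "w \<noteq> q" "(f has_derivative (\<lambda>h. h *\<^sub>C D1)) (at w within D)"
  shows "((\<lambda>\<zeta>. inverse (\<zeta> - q) *\<^sub>C f \<zeta>) has_derivative
    (\<lambda>h. h *\<^sub>C (inverse (w - q) *\<^sub>C D1 - (inverse (w - q))\<^sup>2 *\<^sub>C f w))) (at w within D)"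
proof -
  have "((\<lambda>\<zeta>. inverse (\<zeta> - q) *\<^sub>C f \<zeta>) has_derivative
    (\<lambda>h. inverse (w - q) *\<^sub>C (h *\<^sub>C D1) + (h *\<^sub>C (- (inverse (w - q))\<^sup>2)) *\<^sub>C f w)) (at w within D)"
    by (rule scaleC.FDERIV[OF has_derivative_inverse_diff[OF assms(1)] assms(2)])
  also have "(\<lambda>h. inverse (w - q) *\<^sub>C (h *\<^sub>C D1) + (h *\<^sub>C (- (inverse (w - q))\<^sup>2)) *\<^sub>C f w)
      = (\<lambda>h. h *\<^sub>C (inverse (w - q) *\<^sub>C D1 - (inverse (w - q))\<^sup>2 *\<^sub>C f w))"
    by (simp add: fun_eq_iff scaleC.diff_right scaleC_scaleC scaleC_complex_def mult.commute scaleC.minus_left)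
  finally show ?thesis .
qed

text \<open>Replaces the removable singularity theorem: a derivative relative to \<open>D\<close> is
  enough to extend the difference quotient continuously over \<open>q\<close>, even when
  \<open>D\<close> is not a neighbourhood of \<open>q\<close>.\<close>

lemma isCont_difference_quotient:
  fixes f :: "complex \<Rightarrow> 'b::complex_banach"
  assumes "(f has_derivative (\<lambda>h. h *\<^sub>C D1)) (at q within D)"
  shows "continuous (at q within D)
    (\<lambda>\<zeta>. if \<zeta> = q then D1 else inverse (\<zeta> - q) *\<^sub>C (f \<zeta> - f q))"
proof -
  have "((\<lambda>\<zeta>. norm (inverse (\<zeta> - q) *\<^sub>C (f \<zeta> - f q) - D1)) \<longlongrightarrow> 0) (at q within D)"
  proof (rule Lim_transform_eventually)
    show "((\<lambda>y. norm ((f y - f q) - (y - q) *\<^sub>C D1) / norm (y - q)) \<longlongrightarrow> 0) (at q within D)"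
      using assms unfolding has_derivative_iff_norm by blast
    show "\<forall>\<^sub>F y in at q within D. norm ((f y - f q) - (y - q) *\<^sub>C D1) / norm (y - q)
        = norm (inverse (y - q) *\<^sub>C (f y - f q) - D1)"
      unfolding eventually_at_filter
    proof (intro always_eventually allI impI)
      fix y assume "y \<noteq> q"
      then have "inverse (y - q) *\<^sub>C (f y - f q) - D1
          = inverse (y - q) *\<^sub>C ((f y - f q) - (y - q) *\<^sub>C D1)"
        by (simp add: scaleC.diff_right scaleC_scaleC)
      then show "norm ((f y - f q) - (y - q) *\<^sub>C D1) / norm (y - q)
          = norm (inverse (y - q) *\<^sub>C (f y - f q) - D1)"
        by (simp add: norm_scaleC norm_inverse divide_inverse mult.commute)
    qed
  qed
  then have "((\<lambda>\<zeta>. inverse (\<zeta> - q) *\<^sub>C (f \<zeta> - f q)) \<longlongrightarrow> D1) (at q within D)"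
    by (simp add: tendsto_norm_zero_iff LIM_zero_iff)
  then have "((\<lambda>\<zeta>. if \<zeta> = q then D1 else inverse (\<zeta> - q) *\<^sub>C (f \<zeta> - f q)) \<longlongrightarrow> D1) (at q within D)"
    by (rule Lim_transform_eventually) (simp add: eventually_at_filter)
  then show ?thesis
    unfolding continuous_within by simp
qed

text \<open>For \<open>q \<notin> D\<close> the kernel is regular on \<open>D\<close>. For
  \<open>q \<in> D\<close>, subtracting f(q) from f leaves a difference quotient that is continuous
  at \<open>q\<close> and differentiable elsewhere, so \<open>q\<close> can be the exceptional
  point; what remains is the difference of two winding integrals times f(q).\<close>

lemma graph_integral_Cauchy_kernel_deform:
  fixes h h' :: "real \<Rightarrow> real" and f f1 :: "complex \<Rightarrow> 'b::complex_banach"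
  assumes h: "\<And>t. t \<in> {0..1} \<Longrightarrow> (h has_vector_derivative h' t) (at t within {0..1})"
    and ch': "continuous_on {0..1} h'" and h01: "h 0 = h 1"
    and hb: "\<And>t. t \<in> {0..1} \<Longrightarrow> h t \<noteq> b"
    and D: "\<And>t y. t \<in> {0..1} \<Longrightarrow> y \<in> closed_segment (h t) b \<Longrightarrow> annulus_point t y \<in> D"
    and cf1: "continuous_on D f1"
    and deriv: "\<And>w. w \<in> D \<Longrightarrow> (f has_derivative (\<lambda>h. h *\<^sub>C f1 w)) (at w within D)"
  shows graph_integral_deform_outside: "q \<notin> D \<Longrightarrow>
      graph_integral h h' (\<lambda>\<zeta>. inverse (\<zeta> - q) *\<^sub>C f \<zeta>) =
      graph_integral (\<lambda>_. b) (\<lambda>_. 0) (\<lambda>\<zeta>. inverse (\<zeta> - q) *\<^sub>C f \<zeta>)"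
    and graph_integral_deform_inside: "q \<in> D \<Longrightarrow>
      (\<And>t. t \<in> {0..1} \<Longrightarrow> annulus_point t (h t) \<noteq> q) \<Longrightarrow>
      (\<And>t. t \<in> {0..1} \<Longrightarrow> annulus_point t b \<noteq> q) \<Longrightarrow>
      graph_integral h h' (\<lambda>\<zeta>. inverse (\<zeta> - q) *\<^sub>C f \<zeta>) -
      graph_integral (\<lambda>_. b) (\<lambda>_. 0) (\<lambda>\<zeta>. inverse (\<zeta> - q) *\<^sub>C f \<zeta>) =
      (graph_integral h h' (\<lambda>\<zeta>. inverse (\<zeta> - q)) -
      graph_integral (\<lambda>_. b) (\<lambda>_. 0) (\<lambda>\<zeta>. inverse (\<zeta> - q))) *\<^sub>C f q"
proof -
  have cf: "continuous_on D f"
    using has_derivative_continuous[OF deriv] by (auto simp: continuous_on_eq_continuous_within)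
  have ch: "continuous_on {0..1} h"
    using has_vector_derivative_continuous[OF h] by (simp add: continuous_on_eq_continuous_within)
  show "graph_integral h h' (\<lambda>\<zeta>. inverse (\<zeta> - q) *\<^sub>C f \<zeta>) =
      graph_integral (\<lambda>_. b) (\<lambda>_. 0) (\<lambda>\<zeta>. inverse (\<zeta> - q) *\<^sub>C f \<zeta>)" if q: "q \<notin> D"
  proof (rule graph_integral_deform[where D = D and p = q
        and ?g1.0 = "\<lambda>w. inverse (w - q) *\<^sub>C f1 w - (inverse (w - q))\<^sup>2 *\<^sub>C f w", OF h ch' h01 hb D])
    show "continuous_on D (\<lambda>\<zeta>. inverse (\<zeta> - q) *\<^sub>C f \<zeta>)"
      using q by (intro continuous_intros cf) auto
    show "continuous_on (D - {q}) (\<lambda>w. inverse (w - q) *\<^sub>C f1 w - (inverse (w - q))\<^sup>2 *\<^sub>C f w)"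
      using q by (intro continuous_intros continuous_on_subset[OF cf] continuous_on_subset[OF cf1]) auto
  qed (use deriv in \<open>auto intro!: has_derivative_Cauchy_kernel\<close>)
  assume q: "q \<in> D" and qh: "\<And>t. t \<in> {0..1} \<Longrightarrow> annulus_point t (h t) \<noteq> q"
    and qb: "\<And>t. t \<in> {0..1} \<Longrightarrow> annulus_point t b \<noteq> q"
  define G where "G \<zeta> = (if \<zeta> = q then f1 q else inverse (\<zeta> - q) *\<^sub>C (f \<zeta> - f q))" for \<zeta>
  have dG: "(G has_derivative (\<lambda>h. h *\<^sub>C (inverse (w - q) *\<^sub>C f1 w - (inverse (w - q))\<^sup>2 *\<^sub>C (f w - f q)))) (at w within D)"
    if w: "w \<in> D - {q}" for w
  proof (rule has_derivative_transform_within[where d = "dist w q"])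
    have "((\<lambda>\<zeta>. f \<zeta> - f q) has_derivative (\<lambda>h. h *\<^sub>C f1 w)) (at w within D)"
      using has_derivative_diff[OF deriv[of w] has_derivative_const] w by simp
    then show "((\<lambda>\<zeta>. inverse (\<zeta> - q) *\<^sub>C (f \<zeta> - f q)) has_derivative
      (\<lambda>h. h *\<^sub>C (inverse (w - q) *\<^sub>C f1 w - (inverse (w - q))\<^sup>2 *\<^sub>C (f w - f q)))) (at w within D)"
      using w by (intro has_derivative_Cauchy_kernel) auto
  qed (use w in \<open>auto simp: G_def dist_commute\<close>)
  have cG: "continuous_on D G"
    unfolding continuous_on_eq_continuous_within
  proof
    fix w assume w: "w \<in> D"
    show "continuous (at w within D) G"
    proof (cases "w = q")
      case True
      then show ?thesis
        using isCont_difference_quotient[OF deriv[OF q]] unfolding G_def by simp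
    next
      case False
      then show ?thesis using w has_derivative_continuous[OF dG[of w]] by blast
    qed
  qed
  have G: "graph_integral h h' G = graph_integral (\<lambda>_. b) (\<lambda>_. 0) G"
  proof (rule graph_integral_deform[where D = D and p = q, OF h ch' h01 hb D cG _ dG])
    show "continuous_on (D - {q}) (\<lambda>w. inverse (w - q) *\<^sub>C f1 w - (inverse (w - q))\<^sup>2 *\<^sub>C (f w - f q))"
      by (intro continuous_intros continuous_on_subset[OF cf] continuous_on_subset[OF cf1]) auto
  qed
  have split: "graph_integral k k' G = graph_integral k k' (\<lambda>\<zeta>. inverse (\<zeta> - q) *\<^sub>C f \<zeta>)
      - graph_integral k k' (\<lambda>\<zeta>. inverse (\<zeta> - q)) *\<^sub>C f q"
    if ck: "continuous_on {0..1} k" "continuous_on {0..1} k'"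
      and k: "\<And>t. t \<in> {0..1} \<Longrightarrow> annulus_point t (k t) \<in> D - {q}" for k k'
  proof -
    have ci: "continuous_on (D - {q}) (\<lambda>\<zeta>. inverse (\<zeta> - q))"
      by (intro continuous_intros) auto
    have "graph_integral k k' G
        = graph_integral k k' (\<lambda>\<zeta>. inverse (\<zeta> - q) *\<^sub>C f \<zeta> - inverse (\<zeta> - q) *\<^sub>C f q)"
      using k by (intro graph_integral_cong) (auto simp: G_def scaleC.diff_right)
    also have "\<dots> = graph_integral k k' (\<lambda>\<zeta>. inverse (\<zeta> - q) *\<^sub>C f \<zeta>)
        - graph_integral k k' (\<lambda>\<zeta>. inverse (\<zeta> - q) *\<^sub>C f q)"
      by (rule graph_integral_diff[OF ck _ _ k])
        (intro continuous_intros ci continuous_on_subset[OF cf]; auto)+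
    also have "graph_integral k k' (\<lambda>\<zeta>. inverse (\<zeta> - q) *\<^sub>C f q)
        = graph_integral k k' (\<lambda>\<zeta>. inverse (\<zeta> - q)) *\<^sub>C f q"
      by (rule graph_integral_scaleC_right[OF ck ci k])
    finally show ?thesis .
  qed
  have "annulus_point t (h t) \<in> D - {q}" "annulus_point t b \<in> D - {q}" if "t \<in> {0..1}" for t
    using D[OF that] qh[OF that] qb[OF that] by auto
  from split[OF ch ch' this(1)] split[of "\<lambda>_. b" "\<lambda>_. 0", OF _ _ this(2)] G
  have "graph_integral h h' (\<lambda>\<zeta>. inverse (\<zeta> - q) *\<^sub>C f \<zeta>) -
      graph_integral h h' (\<lambda>\<zeta>. inverse (\<zeta> - q)) *\<^sub>C f q =
      graph_integral (\<lambda>_. b) (\<lambda>_. 0) (\<lambda>\<zeta>. inverse (\<zeta> - q) *\<^sub>C f \<zeta>) -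
      graph_integral (\<lambda>_. b) (\<lambda>_. 0) (\<lambda>\<zeta>. inverse (\<zeta> - q)) *\<^sub>C f q"
    by simp
  then show "graph_integral h h' (\<lambda>\<zeta>. inverse (\<zeta> - q) *\<^sub>C f \<zeta>) -
      graph_integral (\<lambda>_. b) (\<lambda>_. 0) (\<lambda>\<zeta>. inverse (\<zeta> - q) *\<^sub>C f \<zeta>) =
      (graph_integral h h' (\<lambda>\<zeta>. inverse (\<zeta> - q)) -
      graph_integral (\<lambda>_. b) (\<lambda>_. 0) (\<lambda>\<zeta>. inverse (\<zeta> - q))) *\<^sub>C f q"
    by (simp add: scaleC.diff_left algebra_simps)
qed

section \<open>Geometry of the tangent disks\<close>

text \<open>From sin x \<ge> x - x^3/6 \<ge> x/2 on [0, 8/5], which contains [0, \<pi>/2], and from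
  \<pi> \<ge> 2; the reflection of t to 1 - t covers the other half.\<close>

lemma sin_pi_ge:
  fixes t :: real
  assumes "t \<in> {0..1}"
  shows "t * (1 - t) \<le> sin (pi * t)"
proof -
  have half: "s \<le> sin (pi * s)" if s: "0 \<le> s" "s \<le> 1/2" for s :: real
  proof -
    define x where "x = pi * s"
    have x: "0 \<le> x" "x \<le> 8/5"
      using s pi_less_4 pi_approx(2) mult_mono[of pi "16/5" s "1/2"] by (auto simp: x_def)
    have "\<bar>sin x - (\<Sum>m<3. sin_coeff m * x ^ m)\<bar> \<le> inverse (fact 3) * \<bar>x\<bar> ^ 3"
      by (rule Maclaurin_sin_bound)
    moreover have "(\<Sum>m<3. sin_coeff m * x ^ m) = x"
      by (simp add: sin_coeff_def eval_nat_numeral)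
    ultimately have "\<bar>sin x - x\<bar> \<le> x ^ 3 / 6"
      using x by (simp add: fact_numeral)
    then have "x - x ^ 3 / 6 \<le> sin x" by linarith
    moreover have "x ^ 3 / 6 \<le> x / 2"
    proof -
      have "x * x \<le> 8/5 * (8/5)" using x by (intro mult_mono) auto
      then have "x * x \<le> 3" by simp
      then show ?thesis using mult_left_mono[of "x * x" 3 x] x by (simp add: eval_nat_numeral)
    qed
    ultimately have "x / 2 \<le> sin x" by simp
    moreover have "s \<le> x / 2"
      using s pi_ge_two mult_right_mono[of 2 pi s] by (simp add: x_def)
    ultimately show ?thesis by (simp add: x_def)
  qed
  have "min t (1 - t) \<le> sin (pi * t)"
  proof (cases "t \<le> 1/2")
    case True
    then show ?thesis using half[of t] assms by auto
  next
    case False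
    have "sin (pi * (1 - t)) = sin (pi * t)"
      using sin_pi_minus[of "pi * t"] by (simp add: algebra_simps)
    then show ?thesis using half[of "1 - t"] False assms by auto
  qed
  moreover have "t * (1 - t) \<le> t" "t * (1 - t) \<le> 1 - t"
    using assms mult_left_mono[of "1 - t" 1 t] mult_right_mono[of t 1 "1 - t"] by auto
  ultimately show ?thesis by linarith
qed

lemma norm_annulus_point_minus_1:
  "(cmod (annulus_point t y - 1))\<^sup>2 = (exp (- 2 * pi * y) - 1)\<^sup>2 + 4 * exp (- 2 * pi * y) * (sin (pi * t))\<^sup>2"
proof -
  define \<rho> where "\<rho> = exp (- 2 * pi * y)"
  define \<phi> where "\<phi> = 2 * (pi * t)"
  have R: "Re (annulus_point t y) = \<rho> * cos \<phi>" "Im (annulus_point t y) = \<rho> * sin \<phi>"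
    by (simp_all add: annulus_point_def \<rho>_def \<phi>_def Re_exp Im_exp mult.assoc)
  have "(cmod (annulus_point t y - 1))\<^sup>2 = (\<rho> * cos \<phi> - 1)\<^sup>2 + (\<rho> * sin \<phi>)\<^sup>2"
    unfolding cmod_power2 minus_complex.simps R by simp
  also have "\<dots> = \<rho>\<^sup>2 * ((sin \<phi>)\<^sup>2 + (cos \<phi>)\<^sup>2) - 2 * \<rho> * cos \<phi> + 1"
    by algebra
  also have "\<dots> = (\<rho> - 1)\<^sup>2 + 4 * \<rho> * (sin (pi * t))\<^sup>2"
    unfolding sin_cos_squared_add unfolding \<phi>_def cos_double_sin by (simp add: power2_eq_square algebra_simps)
  finally show ?thesis by (simp add: \<rho>_def)
qed

text \<open>The height bound keeps the factor 4 exp(-2 \<pi> y) of the preceding formula at least 1,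
  so the chord is no shorter than sin(\<pi> t).\<close>

lemma annulus_point_dist_1:
  assumes "t \<in> {0..1}" "\<bar>y\<bar> \<le> 1/10"
  shows "t * (1 - t) \<le> cmod (annulus_point t y - 1)"
proof (rule power2_le_imp_le)
  have "2 * pi * y \<le> 2 * (16/5) * (1/10)"
    using assms(2) pi_approx(2) pi_ge_two
    by (intro order_trans[OF mult_left_mono[of y "1/10"] mult_right_mono]) auto
  then have "1/4 \<le> exp (- 2 * pi * y)"
    using exp_ge_add_one_self[of "- 2 * pi * y"] by linarith
  moreover have "(t * (1 - t))\<^sup>2 \<le> (sin (pi * t))\<^sup>2"
    using sin_pi_ge[OF assms(1)] assms(1) by (intro power_mono) auto
  ultimately have "4 * (1/4) * (t * (1 - t))\<^sup>2 \<le> 4 * exp (- 2 * pi * y) * (sin (pi * t))\<^sup>2"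
    by (intro mult_mono) auto
  then show "(t * (1 - t))\<^sup>2 \<le> (cmod (annulus_point t y - 1))\<^sup>2"
    unfolding norm_annulus_point_minus_1 by (simp add: add_increasing)
qed simp

text \<open>The sign \<sigma> treats both disks at once: the centre is 1 - r for \<sigma> = 1 and 1
  + r for \<sigma> = -1. The right-hand side expresses membership through |z - 1|^2 and the signed
  deviation |z|^2 - 1 from the unit circle.\<close>

lemma tangent_disk_norm_eq:
  fixes z :: complex
  assumes "\<bar>\<sigma>\<bar> = 1"
  shows "(cmod (z - of_real (1 - \<sigma> * r)))\<^sup>2 =
    (1 - \<sigma> * r) * (cmod (z - 1))\<^sup>2 + \<sigma> * r * ((cmod z)\<^sup>2 - 1) + r\<^sup>2"
proof -
  have "\<sigma> * \<sigma> = 1" using assms by (auto simp: abs_if split: if_splits)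
  then have "\<sigma> * (\<sigma> * x) = x" for x by (simp add: mult.assoc[symmetric])
  then show ?thesis
    unfolding cmod_power2 by (simp add: power2_eq_square algebra_simps)
qed

text \<open>The quadratic separation matches the order of contact of tangent circles. As
  \<open>Z\<close> is close to the unit circle, its squared distance S^2 from the centre exceeds r^2
  by at least |Z - 1|^2 / 4; dividing by S + r \<le> 4 bounds S - r, and \<open>Q\<close> is within
  r of the centre.\<close>

lemma tangent_disk_dist:
  fixes Z Q :: complex
  assumes "\<bar>\<sigma>\<bar> = 1" "0 < r" "r \<le> 1/2" "cmod (Q - of_real (1 - \<sigma> * r)) < r"
    and "\<bar>(cmod Z)\<^sup>2 - 1\<bar> \<le> (cmod (Z - 1))\<^sup>2 / 4" "cmod Z \<le> 2"
  shows "(cmod (Z - 1))\<^sup>2 / 16 \<le> cmod (Z - Q)"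
proof -
  define a where "a = cmod (Z - 1)"
  define S where "S = cmod (Z - of_real (1 - \<sigma> * r))"
  have sr: "\<bar>\<sigma> * r\<bar> = r" using assms(1,2) by (simp add: abs_mult)
  have "\<bar>\<sigma> * r * ((cmod Z)\<^sup>2 - 1)\<bar> \<le> r * (a\<^sup>2 / 4)"
    unfolding abs_mult[of "\<sigma> * r"] sr using assms by (intro mult_left_mono) (auto simp: a_def)
  also have "\<dots> \<le> 1/2 * (a\<^sup>2 / 4)" using assms by (intro mult_right_mono) auto
  finally have 1: "- (a\<^sup>2 / 8) \<le> \<sigma> * r * ((cmod Z)\<^sup>2 - 1)" by linarith
  have "1/2 * a\<^sup>2 \<le> (1 - \<sigma> * r) * a\<^sup>2"
    using sr assms(3) by (intro mult_right_mono) auto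
  then have S2: "r\<^sup>2 + a\<^sup>2 / 4 \<le> S\<^sup>2"
    using tangent_disk_norm_eq[OF assms(1), of Z r] 1 zero_le_power2[of a]
    unfolding S_def a_def[symmetric] by linarith
  have a3: "a \<le> 3" using norm_triangle_ineq4[of Z 1] assms(6) by (simp add: a_def)
  have "S \<le> a + r"
  proof -
    have "S = cmod ((Z - 1) + of_real (\<sigma> * r))" by (simp add: S_def algebra_simps)
    also have "\<dots> \<le> a + cmod (of_real (\<sigma> * r))" unfolding a_def by (rule norm_triangle_ineq)
    finally show ?thesis using sr by (simp only: norm_of_real)
  qed
  then have Sr: "0 < S + r" "S + r \<le> 4" using a3 assms(2,3) by (auto simp: S_def add_nonneg_pos)
  have "a\<^sup>2 / 4 \<le> (S - r) * (S + r)"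
    using S2 by (simp add: power2_eq_square algebra_simps)
  moreover have "0 \<le> S - r"
  proof -
    have "r\<^sup>2 \<le> S\<^sup>2" using S2 zero_le_power2[of a] by linarith
    then show ?thesis using assms(2) power2_le_imp_le[of r S] by (simp add: S_def)
  qed
  ultimately have "a\<^sup>2 / 4 \<le> (S - r) * 4"
    using mult_left_mono[OF Sr(2), of "S - r"] by linarith
  moreover have "S \<le> cmod (Z - Q) + cmod (Q - of_real (1 - \<sigma> * r))"
  proof -
    have "Z - of_real (1 - \<sigma> * r) = (Z - Q) + (Q - of_real (1 - \<sigma> * r))" by simp
    then show ?thesis unfolding S_def by (metis norm_triangle_ineq)
  qed
  ultimately have "a\<^sup>2 / 16 \<le> cmod (Z - Q)"
    using assms(4) by (simp add: field_simps)
  then show ?thesis unfolding a_def .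
qed

lemma tangent_disk_norm_bounds:
  fixes Q :: complex
  assumes "\<bar>\<sigma>\<bar> = 1" "0 < r" "cmod (Q - of_real (1 - \<sigma> * r)) < r"
  shows "1 - 2 * r < cmod Q" "cmod Q < 1 + 2 * r"
proof -
  have c: "cmod (of_real (1 - \<sigma> * r)) = \<bar>1 - \<sigma> * r\<bar>" by (simp only: norm_of_real)
  have sr: "\<bar>\<sigma> * r\<bar> = r" using assms(1,2) by (simp add: abs_mult)
  show "1 - 2 * r < cmod Q"
    using norm_triangle_ineq2[of "of_real (1 - \<sigma> * r)" Q]
      norm_minus_commute[of "of_real (1 - \<sigma> * r)" Q] assms(3) c sr by linarith
  show "cmod Q < 1 + 2 * r"
    using norm_triangle_ineq2[of Q "of_real (1 - \<sigma> * r)"] assms(3) c sr by linarith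
qed

lemma exp_minus_le_half: "0 \<le> x \<Longrightarrow> x \<le> 1 \<Longrightarrow> exp (- x) \<le> 1 - x / 2" for x :: real
proof -
  assume x: "0 \<le> x" "x \<le> 1"
  have "exp (- x) \<le> 1 / (1 + x)"
    using exp_ge_add_one_self[of x] x by (simp add: exp_minus divide_inverse le_imp_inverse_le)
  also have "\<dots> \<le> 1 - x / 2"
  proof -
    have "x * x \<le> x" using mult_left_mono[of x 1 x] x by simp
    then have "1 \<le> (1 - x / 2) * (1 + x)" by (simp add: algebra_simps)
    then show ?thesis using x by (simp add: pos_divide_le_eq)
  qed
  finally show ?thesis .
qed

text \<open>The constants 3 and 6 leave room: tangent disks of radius r lie between the moduli 1 -
  2r and 1 + 2r, hence at distance at least r from the circles at heights r and -r.\<close>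

lemma exp_annulus_bounds:
  assumes "0 \<le> r" "r \<le> 1/30"
  shows "exp (- 2 * pi * r) \<le> 1 - 3 * r" "1 + 6 * r \<le> exp (2 * pi * r)"
proof -
  have "3 * r \<le> pi * r" using pi_gt3 assms by (intro mult_right_mono) auto
  moreover have "2 * pi * r \<le> 1" using pi_less_4 assms mult_mono[of pi 4 r "1/30"] by simp
  moreover have "0 \<le> pi * r" using assms by simp
  moreover have "1 + 2 * (pi * r) \<le> exp (2 * pi * r)"
    using exp_ge_add_one_self[of "2 * pi * r"] by (simp only: mult.assoc)
  ultimately show "exp (- 2 * pi * r) \<le> 1 - 3 * r" "1 + 6 * r \<le> exp (2 * pi * r)"
    using exp_minus_le_half[of "2 * pi * r"] by auto
qed

text \<open>Membership in a tangent disk becomes a lower bound for the height: with w = t(1 - t),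
  w^2 \<le> |Q - 1|^2 \<le> \<sigma>(1 - |Q|^2) \<le> 32 v. A gap of height at most w^2/200
  therefore stays below \<open>Q\<close>.\<close>

lemma tangent_disk_annulus_point:
  assumes \<sigma>: "\<bar>\<sigma>\<bar> = 1" and r: "0 < r" "r \<le> 1/30" and Q: "cmod (Q - of_real (1 - \<sigma> * r)) < r"
  obtains t v where "t \<in> {0..<1}" "0 < v" "v < r" "Q = annulus_point t (\<sigma> * v)"
    "(t * (1 - t))\<^sup>2 \<le> 32 * v"
proof -
  have nb: "1 - 2 * r < cmod Q" "cmod Q < 1 + 2 * r"
    using tangent_disk_norm_bounds[OF \<sigma> r(1) Q] by auto
  then have Q0: "0 < cmod Q" using r by linarith
  have ss: "\<sigma> = 1 \<or> \<sigma> = -1" using \<sigma> by (auto simp: abs_if split: if_splits)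
  define v where "v = - \<sigma> * ln (cmod Q) / (2 * pi)"
  have e: "exp (- 2 * pi * (\<sigma> * v)) = cmod Q"
    using Q0 ss by (auto simp: v_def)
  define t where "t = frac (Arg Q / (2 * pi))"
  have t: "t \<in> {0..<1}" by (simp add: t_def frac_lt_1)
  have "Q = annulus_point t (\<sigma> * v)"
  proof -
    have "2 * pi * t = Arg Q - 2 * pi * of_int \<lfloor>Arg Q / (2 * pi)\<rfloor>"
      by (simp add: t_def frac_def field_simps)
    then have "annulus_point t (\<sigma> * v) = exp (of_real (- 2 * pi * (\<sigma> * v))) * cis (Arg Q - 2 * pi * of_int \<lfloor>Arg Q / (2 * pi)\<rfloor>)"
      by (simp only: annulus_point_def exp_add cis_conv_exp)
    also have "exp (of_real (- 2 * pi * (\<sigma> * v))) = of_real (cmod Q)"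
      using e by (metis exp_of_real)
    also have "cis (Arg Q - 2 * pi * of_int \<lfloor>Arg Q / (2 * pi)\<rfloor>) = cis (Arg Q)"
      by (simp add: cis_divide[symmetric])
    finally show ?thesis using rcis_cmod_Arg[of Q] by (simp add: rcis_def)
  qed
  \<comment> \<open>As r is small, 1 - \<sigma> r is at least r, and r cancels from the
    identity.\<close>
  have key: "(cmod (Q - 1))\<^sup>2 \<le> \<sigma> * (1 - (cmod Q)\<^sup>2)"
  proof -
    have "(cmod (Q - of_real (1 - \<sigma> * r)))\<^sup>2 \<le> r\<^sup>2"
      using Q by (intro power_mono) auto
    then have 1: "(1 - \<sigma> * r) * (cmod (Q - 1))\<^sup>2 \<le> r * (\<sigma> * (1 - (cmod Q)\<^sup>2))"
      unfolding tangent_disk_norm_eq[OF \<sigma>] by (simp add: algebra_simps)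
    have "r * (cmod (Q - 1))\<^sup>2 \<le> (1 - \<sigma> * r) * (cmod (Q - 1))\<^sup>2"
      using ss r by (intro mult_right_mono) auto
    with 1 have "r * (cmod (Q - 1))\<^sup>2 \<le> r * (\<sigma> * (1 - (cmod Q)\<^sup>2))" by linarith
    then show ?thesis using r(1) by simp
  qed
  have "v \<noteq> 0 \<and> 0 \<le> v"
  proof -
    have "\<sigma> * (1 - (cmod Q)\<^sup>2) \<noteq> 0 \<and> 0 \<le> \<sigma> * (1 - (cmod Q)\<^sup>2)"
    proof -
      have "Q \<noteq> 1"
      proof
        assume "Q = 1"
        then have "cmod (of_real (\<sigma> * r)) < r" using Q by simp
        then show False using \<sigma> r by (simp add: abs_mult norm_mult)
      qed
      then have "0 < (cmod (Q - 1))\<^sup>2" by simp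
      then show ?thesis using key by linarith
    qed
    then have "\<sigma> = 1 \<and> (cmod Q)\<^sup>2 < 1 \<or> \<sigma> = -1 \<and> 1 < (cmod Q)\<^sup>2"
      using ss by auto
    then have "\<sigma> = 1 \<and> cmod Q < 1 \<or> \<sigma> = -1 \<and> 1 < cmod Q"
      by (metis norm_ge_zero one_le_power not_le power_le_one)
    then show ?thesis using Q0 by (auto simp: v_def divide_le_0_iff)
  qed
  then have v: "0 < v" by simp
  have vr: "v < r"
  proof (rule ccontr)
    assume "\<not> v < r"
    then have "2 * pi * r \<le> 2 * pi * v" by simp
    then have le: "exp (- 2 * pi * v) \<le> exp (- 2 * pi * r)" "exp (2 * pi * r) \<le> exp (2 * pi * v)" by auto
    have b: "exp (- 2 * pi * r) \<le> 1 - 3 * r" "1 + 6 * r \<le> exp (2 * pi * r)"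
      using exp_annulus_bounds[of r] r by auto
    from ss show False
    proof
      assume "\<sigma> = 1"
      then have "exp (- 2 * pi * v) = cmod Q" using e by simp
      then show False using le(1) b(1) nb(1) r(1) by linarith
    next
      assume "\<sigma> = -1"
      then have "exp (2 * pi * v) = cmod Q" using e by simp
      then show False using le(2) b(2) nb(2) r(1) by linarith
    qed
  qed
  have "\<sigma> * (1 - (cmod Q)\<^sup>2) \<le> 32 * v"
  proof -
    have q2: "(cmod Q)\<^sup>2 = exp (- 4 * pi * (\<sigma> * v))"
      unfolding e[symmetric] by (simp add: power2_eq_square mult_exp_exp)
    have pv: "4 * pi * v \<le> 16 * v" "4 * pi * v \<le> 1/2"
      using pi_less_4 v vr r pi_approx(2) mult_mono[of pi "16/5" v "1/30"] by auto
    show ?thesis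
      using ss
    proof
      assume "\<sigma> = 1"
      then have "(cmod Q)\<^sup>2 = exp (- (4 * pi * v))" using q2 by simp
      moreover have "1 - 4 * pi * v \<le> exp (- (4 * pi * v))"
        using exp_ge_add_one_self[of "- (4 * pi * v)"] by linarith
      ultimately have "1 - (cmod Q)\<^sup>2 \<le> 32 * v" using pv(1) v by linarith
      then show ?thesis using \<open>\<sigma> = 1\<close> by simp
    next
      assume "\<sigma> = -1"
      then have "(cmod Q)\<^sup>2 = exp (4 * pi * v)" using q2 by simp
      moreover have "exp (4 * pi * v) \<le> 1 + 2 * (4 * pi * v)"
        using real_exp_bound_lemma[of "4 * pi * v"] pv(2) v by simp
      ultimately have "(cmod Q)\<^sup>2 - 1 \<le> 32 * v" using pv(1) by linarith
      then show ?thesis using \<open>\<sigma> = -1\<close> by simp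
    qed
  qed
  moreover have "(t * (1 - t))\<^sup>2 \<le> (cmod (Q - 1))\<^sup>2"
  proof (rule power_mono)
    show "t * (1 - t) \<le> cmod (Q - 1)"
      using annulus_point_dist_1[of t "\<sigma> * v"] t v vr r \<sigma> \<open>Q = _\<close> by (auto simp: abs_mult)
  qed (use t in auto)
  ultimately have "(t * (1 - t))\<^sup>2 \<le> 32 * v" using key by linarith
  then show ?thesis using that t v vr \<open>Q = _\<close> by blast
qed

text \<open>The constant 200 makes the deviation of |Z|^2 from 1, of size about 4 \<pi> |h|, smaller
  than a quarter of |Z - 1|^2. This is the closeness hypothesis of
  \<open>tangent_disk_dist\<close>.\<close>

lemma gap_curve_estimates:
  assumes t: "t \<in> {0..1}" and h: "\<bar>h\<bar> \<le> (t * (1 - t))\<^sup>2 / 200"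
  shows "\<bar>(cmod (annulus_point t h))\<^sup>2 - 1\<bar> \<le> (cmod (annulus_point t h - 1))\<^sup>2 / 4"
    and "cmod (annulus_point t h) \<le> 2"
    and "t * (1 - t) \<le> cmod (annulus_point t h - 1)"
    and "cmod (annulus_point t h - annulus_point t (- h)) \<le> 20 * \<bar>h\<bar>"
proof -
  define w where "w = t * (1 - t)"
  have w: "0 \<le> w" "w \<le> 1"
    using t mult_mono[of t 1 "1 - t" 1] by (auto simp: w_def)
  have "w\<^sup>2 \<le> 1" using w by (simp add: power_le_one)
  then have h1: "\<bar>h\<bar> \<le> 1/200" using h by (simp add: w_def)
  have p: "pi * \<bar>h\<bar> \<le> 16/5 * \<bar>h\<bar>" using pi_approx(2) by (intro mult_right_mono) auto
  have pos: "0 \<le> pi * \<bar>h\<bar>" by simp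
  have b: "exp (4 * pi * \<bar>h\<bar>) - 1 \<le> 8 * (16/5) * \<bar>h\<bar>" "1 - exp (- 4 * pi * \<bar>h\<bar>) \<le> 8 * (16/5) * \<bar>h\<bar>"
    "exp (2 * pi * \<bar>h\<bar>) - 1 \<le> 4 * (16/5) * \<bar>h\<bar>" "1 - exp (- 2 * pi * \<bar>h\<bar>) \<le> 2 * (16/5) * \<bar>h\<bar>"
    using real_exp_bound_lemma[of "4 * pi * \<bar>h\<bar>"] real_exp_bound_lemma[of "2 * pi * \<bar>h\<bar>"]
      exp_ge_add_one_self[of "- 4 * pi * \<bar>h\<bar>"] exp_ge_add_one_self[of "- 2 * pi * \<bar>h\<bar>"] p pos h1
    by linarith+
  have mono: "1 \<le> exp (4 * pi * \<bar>h\<bar>)" "exp (- 4 * pi * \<bar>h\<bar>) \<le> 1"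
     "1 \<le> exp (2 * pi * \<bar>h\<bar>)" "exp (- 2 * pi * \<bar>h\<bar>) \<le> 1"
    using pos by (auto simp: mult.assoc)
  have sq: "(cmod (annulus_point t h))\<^sup>2 = exp (- 4 * pi * h)"
    by (simp add: power2_eq_square mult_exp_exp)
  have d1: "w \<le> cmod (annulus_point t h - 1)"
    using annulus_point_dist_1[OF t, of h] h1 by (simp add: w_def)
  then show "t * (1 - t) \<le> cmod (annulus_point t h - 1)" by (simp add: w_def)
  have "\<bar>exp (- 4 * pi * h) - 1\<bar> \<le> 8 * (16/5) * \<bar>h\<bar>"
    using b mono by (cases "0 \<le> h") auto
  also have "\<dots> \<le> w\<^sup>2 / 4" using h by (simp add: w_def)
  also have "\<dots> \<le> (cmod (annulus_point t h - 1))\<^sup>2 / 4"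
    using d1 w by (simp add: power_mono)
  finally show "\<bar>(cmod (annulus_point t h))\<^sup>2 - 1\<bar> \<le> (cmod (annulus_point t h - 1))\<^sup>2 / 4"
    unfolding sq .
  have "- 2 * pi * h \<le> 2 * pi * \<bar>h\<bar>"
    using mult_left_mono[of "- h" "\<bar>h\<bar>" "2 * pi"] by simp
  then have "exp (- 2 * pi * h) \<le> exp (2 * pi * \<bar>h\<bar>)" by (simp only: exp_le_cancel_iff)
  then show "cmod (annulus_point t h) \<le> 2"
    unfolding norm_annulus_point using b(3) h1 by linarith
  have "annulus_point t h - annulus_point t (- h)
      = of_real (exp (- 2 * pi * h) - exp (2 * pi * h)) * exp (\<i> * of_real (2 * pi * t))"
    by (simp add: annulus_point_def exp_add exp_of_real[symmetric] algebra_simps exp_diff exp_minus field_simps)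
  then have "cmod (annulus_point t h - annulus_point t (- h)) = \<bar>exp (- 2 * pi * h) - exp (2 * pi * h)\<bar>"
    by (simp only: norm_mult norm_of_real norm_exp_eq_Re) simp
  also have "\<dots> \<le> 20 * \<bar>h\<bar>"
    using b mono by (cases "0 \<le> h") auto
  finally show "cmod (annulus_point t h - annulus_point t (- h)) \<le> 20 * \<bar>h\<bar>" .
qed

section \<open>Differences of kernel products at two nearby points\<close>

lemma norm_inverse_diff_le:
  fixes x y :: complex
  assumes "0 < s" "s \<le> cmod x" "s \<le> cmod y"
  shows "cmod (inverse x - inverse y) \<le> (1 / s)\<^sup>2 * cmod (x - y)"
proof -
  have ne: "x \<noteq> 0" "y \<noteq> 0" using assms by auto
  have le: "cmod (inverse x) \<le> 1 / s" "cmod (inverse y) \<le> 1 / s"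
    using assms by (auto simp: norm_inverse inverse_eq_divide[symmetric] intro: le_imp_inverse_le)
  have "inverse x - inverse y = - (inverse x * inverse y * (x - y))"
    using ne by (simp add: field_simps)
  then have "cmod (inverse x - inverse y) = cmod (inverse x) * cmod (inverse y) * cmod (x - y)"
    by (simp only: norm_minus_cancel norm_mult)
  also have "\<dots> \<le> (1 / s) * (1 / s) * cmod (x - y)"
    using assms by (intro mult_right_mono mult_mono le) auto
  finally show ?thesis by (simp add: power2_eq_square)
qed

text \<open>Division by \<open>U\<close> reduces to the unit ball; the factor \<open>U\<close> on
  the left avoids the exponent N - 1.\<close>

lemma norm_power_diff_scaled:
  fixes u u' :: complex
  assumes "0 < U" "cmod u \<le> U" "cmod u' \<le> U"
  shows "cmod (u ^ N - u' ^ N) * U \<le> real N * U ^ N * cmod (u - u')"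
proof -
  have "cmod ((u / of_real U) ^ N - (u' / of_real U) ^ N) \<le> N * cmod (u / of_real U - u' / of_real U)"
    using assms by (intro norm_power_diff) (auto simp: norm_divide)
  then show ?thesis
    using assms(1) by (simp add: power_divide diff_divide_distrib[symmetric] norm_divide norm_power field_simps)
qed

text \<open>The factors are changed one at a time. Each change contributes \<delta>, once for
  \<open>a\<close>, \<open>v\<close> and \<open>x\<close> and N times for the power, whence N + 3;
  \<open>1 \<le> U\<close> and \<open>1 \<le> V\<close> give all terms the common exponents N + 1
  and 2.\<close>

lemma kernel_difference_bound:
  fixes a a' u u' v v' :: complex and x x' :: "'b::complex_banach"
  assumes a: "cmod a \<le> P" "cmod a' \<le> P" "cmod (a - a') \<le> P * \<delta>"
    and u: "cmod u \<le> U" "cmod u' \<le> U" "cmod (u - u') \<le> U\<^sup>2 * \<delta>"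
    and v: "cmod v \<le> V" "cmod v' \<le> V" "cmod (v - v') \<le> V\<^sup>2 * \<delta>"
    and x: "norm x \<le> M" "norm x' \<le> M" "norm (x - x') \<le> M * \<delta>"
    and pos: "1 \<le> U" "1 \<le> V" "0 \<le> \<delta>"
  shows "norm ((a * u ^ N * v) *\<^sub>C x - (a' * u' ^ N * v') *\<^sub>C x')
    \<le> P * M * \<delta> * real (N + 3) * U ^ (N + 1) * V\<^sup>2"
proof -
  have nn: "0 \<le> P" "0 \<le> M" "0 < U" "0 < V" using a x pos order_trans[OF norm_ge_zero] by (blast, blast, auto)
  have uN: "cmod (u ^ N) \<le> U ^ N" "cmod (u' ^ N) \<le> U ^ N"
    using u by (auto simp: norm_power intro!: power_mono)
  have "cmod (u ^ N - u' ^ N) * U \<le> real N * U ^ N * (U\<^sup>2 * \<delta>)"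
    using norm_power_diff_scaled[OF nn(3) u(1,2), of N] u(3) nn
    by (meson mult_left_mono order_trans of_nat_0_le_iff zero_le_power less_imp_le mult_nonneg_nonneg)
  then have du: "cmod (u ^ N - u' ^ N) \<le> real N * U ^ (N + 1) * \<delta>"
    using nn(3) by (simp add: power2_eq_square mult.assoc mult.left_commute)
  have UU: "U ^ N \<le> U ^ (N + 1)" "V \<le> V\<^sup>2"
    using pos mult_left_mono[of 1 V V] by (auto simp: power2_eq_square intro: power_increasing)
  let ?B = "P * M * \<delta> * U ^ (N + 1) * V\<^sup>2"
  have eq: "(a * u ^ N * v) *\<^sub>C x - (a' * u' ^ N * v') *\<^sub>C x' =
      ((a - a') * u ^ N * v) *\<^sub>C x + (a' * (u ^ N - u' ^ N) * v) *\<^sub>C x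
      + (a' * u' ^ N * (v - v')) *\<^sub>C x + (a' * u' ^ N * v') *\<^sub>C (x - x')"
    by (simp add: scaleC.diff_right scaleC.diff_left algebra_simps)
  have 1: "norm (((a - a') * u ^ N * v) *\<^sub>C x) \<le> ?B"
  proof -
    have "norm (((a - a') * u ^ N * v) *\<^sub>C x) \<le> (P * \<delta>) * U ^ (N + 1) * V\<^sup>2 * M"
      unfolding norm_scaleC norm_mult using a u v x uN UU nn pos
      by (intro mult_mono mult_nonneg_nonneg) (auto intro: order_trans)
    then show ?thesis by (simp add: ac_simps)
  qed
  have 2: "norm ((a' * (u ^ N - u' ^ N) * v) *\<^sub>C x) \<le> real N * ?B"
  proof -
    have "norm ((a' * (u ^ N - u' ^ N) * v) *\<^sub>C x) \<le> P * (real N * U ^ (N + 1) * \<delta>) * V\<^sup>2 * M"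
      unfolding norm_scaleC norm_mult using a du v x UU nn pos
      by (intro mult_mono mult_nonneg_nonneg) (auto intro: order_trans)
    then show ?thesis by (simp add: ac_simps)
  qed
  have 3: "norm ((a' * u' ^ N * (v - v')) *\<^sub>C x) \<le> ?B"
  proof -
    have "norm ((a' * u' ^ N * (v - v')) *\<^sub>C x) \<le> P * U ^ (N + 1) * (V\<^sup>2 * \<delta>) * M"
      unfolding norm_scaleC norm_mult using a v x uN UU nn pos
      by (intro mult_mono mult_nonneg_nonneg) (auto intro: order_trans)
    then show ?thesis by (simp add: ac_simps)
  qed
  have 4: "norm ((a' * u' ^ N * v') *\<^sub>C (x - x')) \<le> ?B"
  proof -
    have "norm ((a' * u' ^ N * v') *\<^sub>C (x - x')) \<le> P * U ^ (N + 1) * V\<^sup>2 * (M * \<delta>)"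
      unfolding norm_scaleC norm_mult using a v x uN UU nn pos
      by (intro mult_mono mult_nonneg_nonneg) (auto intro: order_trans)
    then show ?thesis by (simp add: ac_simps)
  qed
  have "norm ((a * u ^ N * v) *\<^sub>C x - (a' * u' ^ N * v') *\<^sub>C x') \<le> ?B + real N * ?B + ?B + ?B"
    unfolding eq by (intro norm_triangle_mono 1 2 3 4)
  also have "\<dots> = P * M * \<delta> * real (N + 3) * U ^ (N + 1) * V\<^sup>2"
    by (simp add: algebra_simps)
  finally show ?thesis .
qed

section \<open>The asymptotic expansion at 1\<close>

text \<open>A finite geometric series with exact remainder, obtained by iterating the resolvent
  identity X = Y + (q - l) Y X.\<close>

lemma inverse_diff_expansion:
  fixes \<zeta> q l :: complex
  assumes "\<zeta> \<noteq> l" "\<zeta> \<noteq> q"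
  shows "inverse (\<zeta> - q) = (\<Sum>n<N. (q - l) ^ n * inverse (\<zeta> - l) ^ (n + 1))
    + (q - l) ^ N * (inverse (\<zeta> - l) ^ N * inverse (\<zeta> - q))"
proof (induction N)
  case (Suc N)
  define X Y where "X = inverse (\<zeta> - q)" and "Y = inverse (\<zeta> - l)"
  have "X = Y + (q - l) * (Y * X)"
    using division_ring_inverse_diff[of "\<zeta> - q" "\<zeta> - l"] assms
    by (simp add: X_def Y_def algebra_simps)
  then have "Y ^ N * X = Y ^ N * (Y + (q - l) * (Y * X))" by (rule arg_cong)
  then have "(q - l) ^ N * (Y ^ N * X) = (q - l) ^ N * Y ^ Suc N + (q - l) ^ Suc N * (Y ^ Suc N * X)"
    by (simp only: distrib_left power_Suc ac_simps)
  with Suc show ?case unfolding X_def[symmetric] Y_def[symmetric] by (simp add: add.assoc)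
qed simp

text \<open>The kernels cost m + 5 powers of w. The seventh power kept in the gap bound leaves w^2,
  which makes the paired gap terms vanish at both ends.\<close>

lemma weight_quotient:
  fixes w :: real
  assumes "0 < w"
  shows "w ^ 7 * w ^ m / w ^ (m + 5) = w\<^sup>2"
proof -
  have "w ^ 7 * w ^ m = w ^ (7 + m)" by (simp only: power_add)
  also have "7 + m = 2 + (m + 5)" by simp
  also have "w ^ (2 + (m + 5)) = w\<^sup>2 * w ^ (m + 5)" by (simp only: power_add)
  finally show ?thesis using assms by simp
qed

text \<open>The setting after a rotation that moves \<lambda> to 1. The number \<eta> is both the
  height of the two circles and the radius of the tangent disks. The exponent 7 is 5 for the kernels
  plus 2 to spare, the denominator 200 is that of \<open>gap_curve_estimates\<close>, and
  \<open>flat (c / 2)\<close> is reserved for the Gamma factors. \<open>M\<close> bounds both F and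
  its jump across the gap relative to H.\<close>

locale flat_gap =
  fixes c \<tau> \<theta> \<eta> M :: real and D :: "complex set" and F F1 :: "complex \<Rightarrow> 'b::complex_banach"
  fixes H H'
  defines "H \<equiv> \<lambda>t. \<theta> * flat c \<tau> t" and "H' \<equiv> \<lambda>t. \<theta> * flat_deriv c \<tau> t"
  assumes c: "0 < c" and \<tau>: "0 < \<tau>" and \<theta>: "0 < \<theta>" "\<theta> < \<eta>" and \<eta>: "\<eta> \<le> 1/30"
    and H_le: "\<And>t. t \<in> {0..1} \<Longrightarrow> H t + \<bar>H' t\<bar> \<le> (t * (1 - t)) ^ 7 * flat (c / 2) \<tau> t / 200"
    and D: "\<And>t y. t \<in> {0..1} \<Longrightarrow> H t \<le> \<bar>y\<bar> \<Longrightarrow> \<bar>y\<bar> \<le> \<eta> \<Longrightarrow> annulus_point t y \<in> D"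
    and F1: "continuous_on D F1"
    and F: "\<And>w. w \<in> D \<Longrightarrow> (F has_derivative (\<lambda>h. h *\<^sub>C F1 w)) (at w within D)"
    and F_gap: "\<And>t. t \<in> {0..1} \<Longrightarrow>
      norm (F (annulus_point t (H t)) - F (annulus_point t (- H t))) \<le> M * H t"
    and F_bd: "\<And>w. w \<in> D \<Longrightarrow> cmod w \<le> 2 \<Longrightarrow> norm (F w) \<le> M"
begin

lemma F_continuous: "continuous_on D F"
  using has_derivative_continuous[OF F] by (simp add: continuous_on_eq_continuous_within)

lemma H_ends [simp]: "H 0 = 0" "H 1 = 0" "H' 0 = 0" "H' 1 = 0"
  by (simp_all add: H_def H'_def)

lemma H_nonneg: "0 \<le> H t"
  using \<theta> by (simp add: H_def flat_nonneg)

lemma H_less: "H t < \<eta>"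
proof -
  have "flat c \<tau> t \<le> 1" using c by (simp add: flat_def)
  then have "H t \<le> \<theta> * 1" unfolding H_def using \<theta> by (intro mult_left_mono) auto
  then show ?thesis using \<theta> by simp
qed

lemma has_vector_derivative_H:
  "t \<in> {0..1} \<Longrightarrow> (H has_vector_derivative H' t) (at t within {0..1})"
  unfolding H_def H'_def using has_vector_derivative_flat[OF c \<tau>]
  by (intro has_vector_derivative_mult_right) auto

lemma has_vector_derivative_minus_H:
  "t \<in> {0..1} \<Longrightarrow> ((\<lambda>t. - H t) has_vector_derivative - H' t) (at t within {0..1})"
  by (rule has_vector_derivative_minus[OF has_vector_derivative_H])

lemma H_continuous: "continuous_on {0..1} H"
  using has_vector_derivative_continuous[OF has_vector_derivative_H]
  by (simp add: continuous_on_eq_continuous_within)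

lemma H'_continuous: "continuous_on {0..1} H'"
  unfolding H'_def by (intro continuous_intros continuous_on_flat_deriv c \<tau>)

lemma H_le_square:
  assumes "t \<in> {0..1}"
  shows "H t + \<bar>H' t\<bar> \<le> (t * (1 - t))\<^sup>2 / 200"
proof -
  have w: "0 \<le> t * (1 - t)" "t * (1 - t) \<le> 1"
    using assms mult_mono[of t 1 "1 - t" 1] by auto
  have "flat (c / 2) \<tau> t \<le> 1" using c by (simp add: flat_def)
  then have "(t * (1 - t)) ^ 7 * flat (c / 2) \<tau> t \<le> (t * (1 - t)) ^ 2 * 1"
    using w flat_nonneg by (intro mult_mono power_decreasing) auto
  then show ?thesis using H_le[OF assms] by simp
qed

text \<open>\<open>upper\<close> and \<open>lower\<close> refer to the sign of the height, so that
  \<open>upper\<close> runs on the side of the unit disk; \<open>inner\<close> and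
  \<open>outer\<close> refer to the modulus. \<open>upper\<close> and \<open>lower\<close> meet at
  1.\<close>

definition upper :: "real \<Rightarrow> complex" where "upper t = annulus_point t (H t)"
definition lower :: "real \<Rightarrow> complex" where "lower t = annulus_point t (- H t)"
definition inner :: "real \<Rightarrow> complex" where "inner t = annulus_point t \<eta>"
definition outer :: "real \<Rightarrow> complex" where "outer t = annulus_point t (- \<eta>)"

definition upper' :: "real \<Rightarrow> complex"
  where "upper' t = (of_real (- 2 * pi * H' t) + \<i> * of_real (2 * pi)) * upper t"
definition lower' :: "real \<Rightarrow> complex"
  where "lower' t = (of_real (2 * pi * H' t) + \<i> * of_real (2 * pi)) * lower t"
definition inner' :: "real \<Rightarrow> complex" where "inner' t = \<i> * of_real (2 * pi) * inner t"
definition outer' :: "real \<Rightarrow> complex" where "outer' t = \<i> * of_real (2 * pi) * outer t"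

text \<open>The signs are those of the oriented boundary of the two regions between the circles and
  the gap. All four curves share one integrand so that the gap terms, each possibly singular at the
  ends, are subtracted before integrating.\<close>

definition integrand :: "(complex \<Rightarrow> complex) \<Rightarrow> real \<Rightarrow> 'b"
  where "integrand k t =
    (outer' t * k (outer t)) *\<^sub>C F (outer t) - (inner' t * k (inner t)) *\<^sub>C F (inner t) +
    ((upper' t * k (upper t)) *\<^sub>C F (upper t) - (lower' t * k (lower t)) *\<^sub>C F (lower t))"

definition tangent :: "complex \<Rightarrow> bool"
  where "tangent Q \<longleftrightarrow> (\<exists>\<sigma>. \<bar>\<sigma>\<bar> = 1 \<and> cmod (Q - of_real (1 - \<sigma> * \<eta>)) < \<eta>)"

section \<open>Bounds on the curves and on the kernels\<close>

lemma \<eta>_pos: "0 < \<eta>" using \<theta> by simp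

lemma curves_in_D:
  assumes "t \<in> {0..1}"
  shows "upper t \<in> D" "lower t \<in> D" "inner t \<in> D" "outer t \<in> D"
  using D[OF assms] H_nonneg[of t] H_less[of t] \<eta>_pos
  by (simp_all add: upper_def lower_def inner_def outer_def)

lemma curves_continuous:
  "continuous_on {0..1} upper" "continuous_on {0..1} lower"
  "continuous_on {0..1} inner" "continuous_on {0..1} outer"
  "continuous_on {0..1} upper'" "continuous_on {0..1} lower'"
  "continuous_on {0..1} inner'" "continuous_on {0..1} outer'"
  unfolding upper_def lower_def inner_def outer_def upper'_def lower'_def inner'_def outer'_def
  by (intro continuous_intros H_continuous H'_continuous)+

lemma F_curves_continuous:
  "continuous_on {0..1} (\<lambda>t. F (upper t))" "continuous_on {0..1} (\<lambda>t. F (lower t))"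
  "continuous_on {0..1} (\<lambda>t. F (inner t))" "continuous_on {0..1} (\<lambda>t. F (outer t))"
  by (rule continuous_on_compose2[OF F_continuous]; use curves_continuous curves_in_D in blast)+

lemma circle_norms:
  "cmod (inner t) \<le> 1 - 3 * \<eta>" "1 + 6 * \<eta> \<le> cmod (outer t)" "cmod (outer t) \<le> 2" "cmod (inner t) \<le> 2"
proof -
  show "cmod (inner t) \<le> 1 - 3 * \<eta>" "1 + 6 * \<eta> \<le> cmod (outer t)"
    using exp_annulus_bounds[of \<eta>] \<eta>_pos \<eta> by (simp_all add: inner_def outer_def)
  then show "cmod (inner t) \<le> 2" using \<eta>_pos by linarith
  have "2 * (pi * \<eta>) \<le> 1/2"
    using pi_less_4 pi_approx(2) \<eta> \<eta>_pos mult_mono[of pi "16/5" \<eta> "1/30"] by simp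
  then show "cmod (outer t) \<le> 2"
    using real_exp_bound_lemma[of "2 * (pi * \<eta>)"] \<eta>_pos by (simp add: outer_def mult.assoc)
qed

lemma tangent_norms:
  assumes "tangent Q"
  shows "1 - 2 * \<eta> < cmod Q" "cmod Q < 1 + 2 * \<eta>"
  using assms tangent_disk_norm_bounds \<eta>_pos unfolding tangent_def by blast+

lemma gap_curves:
  assumes "t \<in> {0..1}"
  shows "t * (1 - t) \<le> cmod (upper t - 1)" "t * (1 - t) \<le> cmod (lower t - 1)"
    "cmod (upper t) \<le> 2" "cmod (lower t) \<le> 2" "cmod (upper t - lower t) \<le> 20 * H t"
    and "tangent Q \<Longrightarrow> (t * (1 - t))\<^sup>2 / 16 \<le> cmod (upper t - Q)"
    and "tangent Q \<Longrightarrow> (t * (1 - t))\<^sup>2 / 16 \<le> cmod (lower t - Q)"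
proof -
  have h: "\<bar>H t\<bar> \<le> (t * (1 - t))\<^sup>2 / 200" "\<bar>- H t\<bar> \<le> (t * (1 - t))\<^sup>2 / 200"
    using H_le_square[OF assms] H_nonneg[of t] by auto
  note u = gap_curve_estimates[OF assms h(1), folded upper_def lower_def]
    and l = gap_curve_estimates[OF assms h(2), folded lower_def]
  show "t * (1 - t) \<le> cmod (upper t - 1)" "t * (1 - t) \<le> cmod (lower t - 1)"
    "cmod (upper t) \<le> 2" "cmod (lower t) \<le> 2" "cmod (upper t - lower t) \<le> 20 * H t"
    using u l H_nonneg[of t] by simp_all
  have w0: "0 \<le> t * (1 - t)" using assms by simp
  have e: "\<eta> \<le> 1/2" using \<eta> by simp
  {
    assume "tangent Q"
    then obtain \<sigma> where s: "\<bar>\<sigma>\<bar> = 1" "cmod (Q - of_real (1 - \<sigma> * \<eta>)) < \<eta>" unfolding tangent_def by blast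
    have "(cmod (upper t - 1))\<^sup>2 / 16 \<le> cmod (upper t - Q)"
      by (rule tangent_disk_dist[OF s(1) \<eta>_pos e s(2) u(1,2)])
    moreover have "(t * (1 - t))\<^sup>2 \<le> (cmod (upper t - 1))\<^sup>2" using u(3) w0 by (rule power_mono)
    ultimately show "(t * (1 - t))\<^sup>2 / 16 \<le> cmod (upper t - Q)" by linarith
    have "(cmod (lower t - 1))\<^sup>2 / 16 \<le> cmod (lower t - Q)"
      by (rule tangent_disk_dist[OF s(1) \<eta>_pos e s(2) l(1,2)])
    moreover have "(t * (1 - t))\<^sup>2 \<le> (cmod (lower t - 1))\<^sup>2" using l(3) w0 by (rule power_mono)
    ultimately show "(t * (1 - t))\<^sup>2 / 16 \<le> cmod (lower t - Q)" by linarith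
  }
qed

lemma upper'_lower'_bounds:
  assumes "t \<in> {0..1}"
  shows "cmod (upper' t) \<le> 26" "cmod (lower' t) \<le> 26"
    "cmod (upper' t - lower' t) \<le> 26 * (200 * (H t + \<bar>H' t\<bar>))"
proof -
  define a where "a = of_real (2 * pi * H' t) + \<i> * of_real (2 * pi)"
  define b where "b = of_real (- 2 * pi * H' t) + \<i> * of_real (2 * pi)"
  have w: "(t * (1 - t))\<^sup>2 \<le> 1"
    using assms mult_mono[of t 1 "1 - t" 1] by (intro power_le_one) auto
  have H': "\<bar>H' t\<bar> \<le> 1" using H_le_square[OF assms] H_nonneg[of t] w by linarith
  have p: "2 * pi \<le> 32/5" using pi_approx(2) by simp
  have pH: "2 * pi * \<bar>H' t\<bar> \<le> 32/5 * \<bar>H' t\<bar>" using p by (intro mult_right_mono) auto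
  have ab: "cmod a \<le> 13" "cmod b \<le> 13"
    using norm_triangle_ineq[of "of_real (2 * pi * H' t)" "\<i> * of_real (2 * pi)"]
      norm_triangle_ineq[of "of_real (- 2 * pi * H' t)" "\<i> * of_real (2 * pi)"] p pH H'
    unfolding a_def b_def norm_mult norm_of_real by (simp_all add: abs_mult)
  have u: "upper' t = b * upper t" and l: "lower' t = a * lower t"
    by (simp_all add: upper'_def lower'_def a_def b_def)
  show "cmod (upper' t) \<le> 26" "cmod (lower' t) \<le> 26"
    unfolding u l norm_mult using mult_mono[OF ab(2) gap_curves(3)[OF assms]]
      mult_mono[OF ab(1) gap_curves(4)[OF assms]] by simp_all
  have "upper' t - lower' t = (b - a) * upper t + a * (upper t - lower t)"
    unfolding u l by (simp add: algebra_simps)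
  also have "cmod \<dots> \<le> cmod (b - a) * cmod (upper t) + cmod a * cmod (upper t - lower t)"
    using norm_triangle_ineq by (simp add: norm_mult[symmetric])
  also have "\<dots> \<le> (2 * (32/5 * \<bar>H' t\<bar>)) * 2 + 13 * (20 * H t)"
  proof (intro add_mono mult_mono)
    have "b - a = of_real (- 4 * pi * H' t)" by (simp add: a_def b_def algebra_simps)
    then have "cmod (b - a) = 2 * (2 * pi * \<bar>H' t\<bar>)"
      by (simp only: norm_of_real) (simp add: abs_mult)
    then show "cmod (b - a) \<le> 2 * (32/5 * \<bar>H' t\<bar>)" using pH by simp
  qed (use gap_curves[OF assms] ab H_nonneg[of t] in auto)
  also have "\<dots> \<le> 26 * (200 * (H t + \<bar>H' t\<bar>))" using H_nonneg[of t] by simp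
  finally show "cmod (upper' t - lower' t) \<le> 26 * (200 * (H t + \<bar>H' t\<bar>))" .
qed

text \<open>The 26 bounds the derivatives of the two gap curves, \<open>exp 1\<close> comes from the
  Gamma bound, and 256 is the square of the 16 in the separation w^2/16 from the disks. The base
  belongs to the reserved half \<open>flat (c / 2)\<close>.\<close>

definition "gap_const = 26 * M * exp 1 * 256"
definition "gap_base = (c / 2) powr (- \<tau>)"

lemma M_nonneg: "0 \<le> M"
  by (rule order_trans[OF norm_ge_zero F_bd[OF curves_in_D(1) gap_curves(3), of 0]]) simp_all

lemma gap_const_nonneg: "0 \<le> gap_const" using M_nonneg by (simp add: gap_const_def)

text \<open>
  The kernels allowed below are those of \<open>1/(\<zeta> - Q)\<close> and its expansion at \<open>1\<close>: powers of
  \<open>1/(\<zeta> - 1)\<close>, possibly times \<open>1/(\<zeta> - Q)\<close>.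
\<close>

lemma gap_integrand_bound:
  assumes t: "t \<in> {0<..<1}" and v: "v = (\<lambda>_. 1) \<or> (\<exists>Q. tangent Q \<and> v = (\<lambda>\<zeta>. inverse (\<zeta> - Q)))"
  shows "norm ((upper' t * (inverse (upper t - 1) ^ m * v (upper t))) *\<^sub>C F (upper t) -
      (lower' t * (inverse (lower t - 1) ^ m * v (lower t))) *\<^sub>C F (lower t))
    \<le> gap_const * real (m + 3) * gap_base ^ n * Gamma (1 + real n * \<tau>) *
       ((t * (1 - t)) ^ 7 * (t * (1 - t)) ^ n / (t * (1 - t)) ^ (m + 5))"
proof -
  define w where "w = t * (1 - t)"
  have t01: "t \<in> {0..1}" using t by auto
  have w: "0 < w" "w \<le> 1" using t mult_mono[of t 1 "1 - t" 1] by (auto simp: w_def)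
  \<comment> \<open>A common measure for all increments between the two curves; 200 cancels the
    denominator in \<open>H_le\<close>.\<close>
  define \<delta> where "\<delta> = 200 * (H t + \<bar>H' t\<bar>)"
  \<comment> \<open>\<open>U\<close> bounds 1/(\<zeta> - 1), and \<open>V\<close> bounds 1/(\<zeta>
    - Q). By tangency \<open>V\<close> is of order w^(-2), so U^(m + 1) V^2 costs m + 5 powers of
    w.\<close>
  define U where "U = 1 / w"
  define V where "V = 16 / w\<^sup>2"
  have w2: "w\<^sup>2 \<le> 1" using w by (intro power_le_one) auto
  have UV: "1 \<le> U" "1 \<le> V" using w w2 by (auto simp: U_def V_def pos_le_divide_eq)
  have \<delta>: "0 \<le> \<delta>" "20 * H t \<le> \<delta>" "H t \<le> \<delta>" using H_nonneg[of t] by (auto simp: \<delta>_def)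
  note g = gap_curves[OF t01, folded w_def]
  have ul: "cmod (upper t - lower t) \<le> \<delta>" using g(5) \<delta> by linarith
  have u: "cmod (inverse (upper t - 1)) \<le> U" "cmod (inverse (lower t - 1)) \<le> U"
    "cmod (inverse (upper t - 1) - inverse (lower t - 1)) \<le> U\<^sup>2 * \<delta>"
  proof -
    show "cmod (inverse (upper t - 1)) \<le> U" "cmod (inverse (lower t - 1)) \<le> U"
      using g w by (auto simp: U_def norm_inverse inverse_eq_divide[symmetric] intro: le_imp_inverse_le)
    have "cmod (inverse (upper t - 1) - inverse (lower t - 1)) \<le> (1 / w)\<^sup>2 * cmod (upper t - 1 - (lower t - 1))"
      by (rule norm_inverse_diff_le[OF w(1) g(1,2)])
    also have "\<dots> \<le> U\<^sup>2 * \<delta>" unfolding U_def using ul by (intro mult_left_mono) auto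
    finally show "cmod (inverse (upper t - 1) - inverse (lower t - 1)) \<le> U\<^sup>2 * \<delta>" .
  qed
  have vv: "cmod (v (upper t)) \<le> V" "cmod (v (lower t)) \<le> V"
    "cmod (v (upper t) - v (lower t)) \<le> V\<^sup>2 * \<delta>"
  proof -
    have "cmod (v (upper t)) \<le> V \<and> cmod (v (lower t)) \<le> V \<and> cmod (v (upper t) - v (lower t)) \<le> V\<^sup>2 * \<delta>"
      using v
    proof
      assume "v = (\<lambda>_. 1)"
      then show ?thesis using UV \<delta> by simp
    next
      assume "\<exists>Q. tangent Q \<and> v = (\<lambda>\<zeta>. inverse (\<zeta> - Q))"
      then obtain Q where Q: "tangent Q" and v: "v = (\<lambda>\<zeta>. inverse (\<zeta> - Q))" by blast
      have s: "0 < w\<^sup>2 / 16" "V = 1 / (w\<^sup>2 / 16)" using w by (auto simp: V_def)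
      have "cmod (v (upper t) - v (lower t)) \<le> V\<^sup>2 * cmod (upper t - Q - (lower t - Q))"
        unfolding v s(2) by (rule norm_inverse_diff_le[OF s(1) g(6,7)[OF Q]])
      also have "\<dots> \<le> V\<^sup>2 * \<delta>" using ul by (intro mult_left_mono) auto
      finally show ?thesis
        using le_imp_inverse_le[OF g(6)[OF Q] s(1)] le_imp_inverse_le[OF g(7)[OF Q] s(1)]
        unfolding v s(2) by (simp add: norm_divide inverse_eq_divide)
    qed
    then show "cmod (v (upper t)) \<le> V" "cmod (v (lower t)) \<le> V"
      "cmod (v (upper t) - v (lower t)) \<le> V\<^sup>2 * \<delta>" by auto
  qed
  have x: "norm (F (upper t)) \<le> M" "norm (F (lower t)) \<le> M" "norm (F (upper t) - F (lower t)) \<le> M * \<delta>"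
  proof -
    show "norm (F (upper t)) \<le> M" "norm (F (lower t)) \<le> M"
      using F_bd curves_in_D[OF t01] g by auto
    show "norm (F (upper t) - F (lower t)) \<le> M * \<delta>"
      using F_gap[OF t01] mult_left_mono[OF \<delta>(3) M_nonneg] unfolding upper_def lower_def by linarith
  qed
  have "norm ((upper' t * inverse (upper t - 1) ^ m * v (upper t)) *\<^sub>C F (upper t) -
      (lower' t * inverse (lower t - 1) ^ m * v (lower t)) *\<^sub>C F (lower t))
      \<le> 26 * M * \<delta> * real (m + 3) * U ^ (m + 1) * V\<^sup>2"
    using upper'_lower'_bounds[OF t01] unfolding \<delta>_def[symmetric]
    by (intro kernel_difference_bound u vv x UV \<delta>)
  also have "\<dots> = (26 * M * real (m + 3) * U ^ (m + 1) * V\<^sup>2) * \<delta>" by simp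
  also have "\<dots> \<le> (26 * M * real (m + 3) * U ^ (m + 1) * V\<^sup>2) *
      (w ^ 7 * (exp 1 * gap_base ^ n * Gamma (1 + real n * \<tau>) * w ^ n))"
  proof (rule mult_left_mono)
    \<comment> \<open>The seventh power is kept, and the reserved \<open>flat (c / 2)\<close>
      becomes w^n with its Gamma factor. The exponent n is free; it will be taken equal to
      m.\<close>
    have "\<delta> \<le> w ^ 7 * flat (c / 2) \<tau> t" using H_le[OF t01] by (simp add: \<delta>_def w_def)
    also have "\<dots> \<le> w ^ 7 * (exp 1 * gap_base ^ n * Gamma (1 + real n * \<tau>) * w ^ n)"
      using flat_le_power_Gamma[of "c / 2" \<tau> t n] c \<tau> t01 w unfolding gap_base_def w_def
      by (intro mult_left_mono) auto
    finally show "\<delta> \<le> w ^ 7 * (exp 1 * gap_base ^ n * Gamma (1 + real n * \<tau>) * w ^ n)" .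
  qed (use M_nonneg UV in auto)
  also have "\<dots> = gap_const * real (m + 3) * gap_base ^ n * Gamma (1 + real n * \<tau>) *
      (w ^ 7 * w ^ n * (U ^ (m + 1) * (1 / w\<^sup>2)\<^sup>2))"
    by (simp add: gap_const_def V_def power_divide)
  also have "U ^ (m + 1) * (1 / w\<^sup>2)\<^sup>2 = 1 / w ^ (m + 5)"
    by (simp add: U_def power_divide power_add eval_nat_numeral)
  finally show ?thesis by (simp add: w_def mult.assoc)
qed

lemma circle_points:
  shows "\<eta> \<le> cmod (inner t - 1)" "\<eta> \<le> cmod (outer t - 1)"
    "tangent Q \<Longrightarrow> \<eta> \<le> cmod (inner t - Q)" "tangent Q \<Longrightarrow> \<eta> \<le> cmod (outer t - Q)"
proof -
  show "\<eta> \<le> cmod (inner t - 1)"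
    using norm_triangle_ineq2[of 1 "inner t"] norm_minus_commute[of "inner t" 1]
      circle_norms(1)[of t] \<eta>_pos norm_one[where 'a = complex] by linarith
  show "\<eta> \<le> cmod (outer t - 1)"
    using norm_triangle_ineq2[of "outer t" 1] circle_norms(2)[of t] \<eta>_pos norm_one[where 'a = complex]
    by linarith
  show "\<eta> \<le> cmod (inner t - Q)" if "tangent Q"
    using norm_triangle_ineq2[of Q "inner t"] norm_minus_commute[of "inner t" Q]
      circle_norms(1)[of t] tangent_norms(1)[OF that] by linarith
  show "\<eta> \<le> cmod (outer t - Q)" if "tangent Q"
    using norm_triangle_ineq2[of "outer t" Q] circle_norms(2)[of t] tangent_norms(2)[OF that] \<eta>_pos
    by linarith
qed

lemma circle_term_bound:
  assumes v: "v = (\<lambda>_. 1) \<or> (\<exists>Q. tangent Q \<and> v = (\<lambda>\<zeta>. inverse (\<zeta> - Q)))"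
    and t: "t \<in> {0..1}"
  shows "norm ((outer' t * (inverse (outer t - 1) ^ m * v (outer t))) *\<^sub>C F (outer t)) \<le> 14 * M * (1 / \<eta>) ^ (m + 1)"
    and "norm ((inner' t * (inverse (inner t - 1) ^ m * v (inner t))) *\<^sub>C F (inner t)) \<le> 14 * M * (1 / \<eta>) ^ (m + 1)"
proof -
  have inv: "cmod (inverse x) \<le> 1 / \<eta>" if "\<eta> \<le> cmod x" for x
    using le_imp_inverse_le[OF that \<eta>_pos] by (simp add: norm_divide inverse_eq_divide)
  have one: "1 \<le> 1 / \<eta>" using \<eta>_pos \<eta> by (simp add: pos_le_divide_eq)
  have vb: "cmod (v (outer t)) \<le> 1 / \<eta>" "cmod (v (inner t)) \<le> 1 / \<eta>"
    using v inv circle_points one by auto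
  have d: "cmod (outer' t) \<le> 14" "cmod (inner' t) \<le> 14"
    using circle_norms[of t] pi_approx(2) mult_mono[of "2 * pi" 7 "cmod (outer t)" 2]
      mult_mono[of "2 * pi" 7 "cmod (inner t)" 2]
    by (simp_all add: outer'_def inner'_def norm_mult)
  have Fb: "norm (F (outer t)) \<le> M" "norm (F (inner t)) \<le> M"
    using F_bd curves_in_D[OF t] circle_norms by auto
  have "norm ((outer' t * (inverse (outer t - 1) ^ m * v (outer t))) *\<^sub>C F (outer t))
      \<le> (14 * ((1 / \<eta>) ^ m * (1 / \<eta>))) * M"
    unfolding norm_scaleC norm_mult norm_power using d vb Fb inv circle_points \<eta>_pos
    by (intro mult_mono power_mono mult_nonneg_nonneg) auto
  then show "norm ((outer' t * (inverse (outer t - 1) ^ m * v (outer t))) *\<^sub>C F (outer t)) \<le> 14 * M * (1 / \<eta>) ^ (m + 1)"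
    by (simp add: ac_simps)
  have "norm ((inner' t * (inverse (inner t - 1) ^ m * v (inner t))) *\<^sub>C F (inner t))
      \<le> (14 * ((1 / \<eta>) ^ m * (1 / \<eta>))) * M"
    unfolding norm_scaleC norm_mult norm_power using d vb Fb inv circle_points \<eta>_pos
    by (intro mult_mono power_mono mult_nonneg_nonneg) auto
  then show "norm ((inner' t * (inverse (inner t - 1) ^ m * v (inner t))) *\<^sub>C F (inner t)) \<le> 14 * M * (1 / \<eta>) ^ (m + 1)"
    by (simp add: ac_simps)
qed

lemma curves_ne:
  assumes "t \<in> {0<..<1}"
  shows "upper t \<noteq> 1" "lower t \<noteq> 1" "tangent Q \<Longrightarrow> upper t \<noteq> Q" "tangent Q \<Longrightarrow> lower t \<noteq> Q"
proof -
  have t01: "t \<in> {0..1}" using assms by simp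
  have w: "0 < t * (1 - t)" using assms by simp
  have w2: "0 < (t * (1 - t))\<^sup>2 / 16" using zero_less_power[OF w, of 2] by linarith
  note g = gap_curves[OF t01]
  show "upper t \<noteq> 1" "lower t \<noteq> 1" using g(1,2) w by auto
  show "tangent Q \<Longrightarrow> upper t \<noteq> Q" "tangent Q \<Longrightarrow> lower t \<noteq> Q"
    using g(6,7) w2 by (metis diff_self norm_zero not_le)+
qed

lemma curves_ends: "lower 0 = upper 0" "lower 1 = upper 1" "lower' 0 = upper' 0" "lower' 1 = upper' 1"
  by (simp_all add: upper_def lower_def upper'_def lower'_def)

lemma continuous_on_integrand:
  assumes v: "v = (\<lambda>_. 1) \<or> (\<exists>Q. tangent Q \<and> v = (\<lambda>\<zeta>. inverse (\<zeta> - Q)))"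
  shows "continuous_on {0..1} (integrand (\<lambda>\<zeta>. inverse (\<zeta> - 1) ^ m * v \<zeta>))"
proof -
  let ?k = "\<lambda>\<zeta>. inverse (\<zeta> - 1) ^ m * v \<zeta>"
  have ck: "continuous_on S (\<lambda>t. ?k (z t))"
    if "continuous_on S z" "\<And>t. t \<in> S \<Longrightarrow> z t \<noteq> 1" "\<And>t Q. t \<in> S \<Longrightarrow> tangent Q \<Longrightarrow> z t \<noteq> Q"
    for S and z :: "real \<Rightarrow> complex"
    using v that by (auto intro!: continuous_intros)
  have circ: "inner t \<noteq> 1" "outer t \<noteq> 1" "tangent Q \<Longrightarrow> inner t \<noteq> Q" "tangent Q \<Longrightarrow> outer t \<noteq> Q" for t Q
    using circle_points(1,2)[of t] circle_points(3,4)[of Q t] \<eta>_pos by auto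
  have c1: "continuous_on {0..1} (\<lambda>t. (outer' t * ?k (outer t)) *\<^sub>C F (outer t))"
    by (intro continuous_on_scaleC continuous_on_mult curves_continuous F_curves_continuous ck) (use circ in auto)
  have c2: "continuous_on {0..1} (\<lambda>t. (inner' t * ?k (inner t)) *\<^sub>C F (inner t))"
    by (intro continuous_on_scaleC continuous_on_mult curves_continuous F_curves_continuous ck) (use circ in auto)
  \<comment> \<open>At t = 0 and t = 1 the two curves and their derivatives coincide, so the
    difference is 0 whatever value the kernel takes at its singularity. Near the ends the bound with
    n = m leaves a factor w^2.\<close>
  have c3: "continuous_on {0..1} (\<lambda>t. (upper' t * ?k (upper t)) *\<^sub>C F (upper t) - (lower' t * ?k (lower t)) *\<^sub>C F (lower t))"
  proof (rule continuous_on_unit_intervalI)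
    have sub: "{0<..<1} \<subseteq> {0..1::real}" by auto
    note c = curves_continuous[THEN continuous_on_subset, OF sub]
      F_curves_continuous[THEN continuous_on_subset, OF sub]
    show "continuous_on {0<..<1} (\<lambda>t. (upper' t * ?k (upper t)) *\<^sub>C F (upper t) - (lower' t * ?k (lower t)) *\<^sub>C F (lower t))"
      by (intro continuous_on_diff continuous_on_scaleC continuous_on_mult ck c)
        (use curves_ne in auto)
    fix t :: real assume t: "t \<in> {0<..<1}"
    define w where "w = t * (1 - t)"
    have w: "0 < w" using t by (simp add: w_def)
    have "w ^ 7 * w ^ m / w ^ (m + 5) = w\<^sup>2"
      using w by (rule weight_quotient)
    moreover have "w\<^sup>2 \<le> 1 * w"
      using w t mult_mono[of t 1 "1 - t" 1] unfolding power2_eq_square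
      by (intro mult_right_mono) (auto simp: w_def)
    moreover have "0 \<le> gap_const * real (m + 3) * gap_base ^ m * Gamma (1 + real m * \<tau>)"
      using gap_const_nonneg \<tau> by (intro mult_nonneg_nonneg Gamma_real_nonneg) (auto simp: gap_base_def add_pos_nonneg)
    ultimately have "gap_const * real (m + 3) * gap_base ^ m * Gamma (1 + real m * \<tau>) * (w ^ 7 * w ^ m / w ^ (m + 5))
       \<le> gap_const * real (m + 3) * gap_base ^ m * Gamma (1 + real m * \<tau>) * w"
      by (intro mult_left_mono) auto
    with gap_integrand_bound[OF t v, of m m]
    show "norm ((upper' t * ?k (upper t)) *\<^sub>C F (upper t) - (lower' t * ?k (lower t)) *\<^sub>C F (lower t))
        \<le> gap_const * real (m + 3) * gap_base ^ m * Gamma (1 + real m * \<tau>) * (t * (1 - t))"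
      unfolding w_def by linarith
  qed (simp_all add: curves_ends)
  show ?thesis
    unfolding integrand_def by (intro continuous_intros c1 c2 c3)
qed

text \<open>Cauchy's integrals for the coefficients at 1. They do not involve \<open>Q\<close>, so
  both disks receive the same formal series.\<close>

definition taylor :: "nat \<Rightarrow> 'b"
  where "taylor n = inverse (2 * of_real pi * \<i>) *\<^sub>C integral {0..1} (integrand (\<lambda>\<zeta>. inverse (\<zeta> - 1) ^ (n + 1)))"

text \<open>\<open>Q\<close> lies strictly on one side of the gap. The two curves on that side
  contribute 2 \<pi> i F(Q); those on the other side cancel, because the kernel is regular between
  them.\<close>

lemma Cauchy_tangent:
  assumes "tangent Q"
  shows "(2 * of_real pi * \<i>) *\<^sub>C F Q = integral {0..1} (integrand (\<lambda>\<zeta>. inverse (\<zeta> - Q)))"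
    and "Q \<in> D"
proof -
  obtain \<sigma> where \<sigma>: "\<bar>\<sigma>\<bar> = 1" "cmod (Q - of_real (1 - \<sigma> * \<eta>)) < \<eta>"
    using assms unfolding tangent_def by blast
  obtain t0 v where t0: "t0 \<in> {0..<1}" and v: "0 < v" "v < \<eta>" and Q: "Q = annulus_point t0 (\<sigma> * v)"
    and w2: "(t0 * (1 - t0))\<^sup>2 \<le> 32 * v"
    using tangent_disk_annulus_point[OF \<sigma>(1) \<eta>_pos \<eta> \<sigma>(2)] by metis
  have ss: "\<sigma> = 1 \<or> \<sigma> = -1" using \<sigma>(1) by (auto simp: abs_if split: if_splits)
  have t01: "t0 \<in> {0..1}" using t0 by simp
  \<comment> \<open>From H \<le> w^2/200 and w^2 \<le> 32 v.\<close>
  have Hv: "H t0 < v"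
    using H_le_square[OF t01] w2 v(1) abs_ge_zero[of "H' t0"] by linarith
  have H_eq: "H t = H t0" if "annulus_point t y = Q" "t \<in> {0..1}" for t y
    using annulus_point_eq_unit[OF _ that(2) t01, of y "\<sigma> * v"] that(1) Q H_ends by auto
  have y_eq: "y = \<sigma> * v" if "annulus_point t y = Q" for t y
    using annulus_point_eqD(1) that Q by metis
  show "Q \<in> D" unfolding Q using D[OF t01, of "\<sigma> * v"] Hv v \<sigma>(1) by (simp add: abs_mult)
  define k where "k \<zeta> = inverse (\<zeta> - Q)" for \<zeta>
  \<comment> \<open>The two sides of the gap are treated as separate domains, since only one of them
    contains \<open>Q\<close>.\<close>
  define Dp where "Dp = {annulus_point t y | t y. t \<in> {0..1} \<and> H t \<le> y \<and> y \<le> \<eta>}"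
  define Dm where "Dm = {annulus_point t y | t y. t \<in> {0..1} \<and> H t \<le> - y \<and> - y \<le> \<eta>}"
  have sub: "Dp \<subseteq> D" "Dm \<subseteq> D"
  proof -
    show "Dp \<subseteq> D"
    proof
      fix z assume "z \<in> Dp"
      then obtain t y where z: "z = annulus_point t y" "t \<in> {0..1}" "H t \<le> y" "y \<le> \<eta>"
        unfolding Dp_def by blast
      then show "z \<in> D" using D[of t y] H_nonneg[of t] by simp
    qed
    show "Dm \<subseteq> D"
    proof
      fix z assume "z \<in> Dm"
      then obtain t y where z: "z = annulus_point t y" "t \<in> {0..1}" "H t \<le> - y" "- y \<le> \<eta>"
        unfolding Dm_def by blast
      then show "z \<in> D" using D[of t y] H_nonneg[of t] by simp
    qed
  qed
  note Fp = has_derivative_subset[OF F sub(1)] continuous_on_subset[OF F1 sub(1)]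
    and Fm = has_derivative_subset[OF F sub(2)] continuous_on_subset[OF F1 sub(2)]
  have Dp: "annulus_point t y \<in> Dp" if "t \<in> {0..1}" "y \<in> closed_segment (H t) \<eta>" for t y
    using that H_less[of t] unfolding Dp_def closed_segment_eq_real_ivl by auto
  have Dm: "annulus_point t y \<in> Dm" if "t \<in> {0..1}" "y \<in> closed_segment (- H t) (- \<eta>)" for t y
  proof -
    have "H t \<le> - y" "- y \<le> \<eta>" using that H_less[of t] by (auto simp: closed_segment_eq_real_ivl)
    then show ?thesis unfolding Dm_def using that(1) by blast
  qed
  have ne: "H t \<noteq> \<eta>" "- H t \<noteq> - \<eta>" for t using H_less[of t] by auto
  have pv: "- (pi * v) < pi" "- pi < pi * v"
    using mult_pos_pos[OF pi_gt_zero v(1)] pi_gt_zero by linarith+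
  have h01: "H 0 = H 1" "- H 0 = - H 1" by simp_all
  have cmH': "continuous_on {0..1} (\<lambda>t. - H' t)" by (intro continuous_intros H'_continuous)
  have dk: "(k has_derivative (\<lambda>h. h *\<^sub>C (- (inverse (w - Q))\<^sup>2))) (at w within - {Q})" if "w \<in> - {Q} - {Q}" for w
    unfolding k_def using that by (intro has_derivative_inverse_diff) auto
  have ck: "continuous_on (- {Q}) k" "continuous_on (- {Q} - {Q}) (\<lambda>w. - (inverse (w - Q))\<^sup>2)"
    unfolding k_def by (intro continuous_intros; auto)+
  let ?I = "\<lambda>h h'. graph_integral h h' (\<lambda>\<zeta>. k \<zeta> *\<^sub>C F \<zeta>)"
  have main: "(2 * of_real pi * \<i>) *\<^sub>C F Q = (?I (\<lambda>_. - \<eta>) (\<lambda>_. 0) - ?I (\<lambda>_. \<eta>) (\<lambda>_. 0)) + (?I H H' - ?I (\<lambda>t. - H t) (\<lambda>t. - H' t))"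
    using ss
  proof
    assume s1: "\<sigma> = 1"
    have QDp: "Q \<in> Dp"
      unfolding Q by (rule Dp[OF t01]) (use Hv v s1 in \<open>simp add: closed_segment_eq_real_ivl\<close>)
    have QDm: "Q \<notin> Dm"
    proof
      assume "Q \<in> Dm"
      then obtain t y where "Q = annulus_point t y" "H t \<le> - y" unfolding Dm_def by blast
      then show False using y_eq[of t y] s1 v H_nonneg[of t] by simp
    qed
    have qh: "annulus_point t (H t) \<noteq> Q" "annulus_point t \<eta> \<noteq> Q" if "t \<in> {0..1}" for t
      using y_eq[of t "H t"] y_eq[of t \<eta>] H_eq[OF _ that] Hv v s1 by auto
    \<comment> \<open>Without F the curve may be pushed across the gap. The height -1 is never
      attained by H \<ge> 0, and the circle at this height encloses \<open>Q\<close>.\<close>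
    have "graph_integral H H' k = graph_integral (\<lambda>_. -1) (\<lambda>_. 0) k"
    proof (rule graph_integral_deform[OF has_vector_derivative_H H'_continuous h01(1) _ _ ck(1) ck(2) dk])
      show "H t \<noteq> -1" for t using H_nonneg[of t] by linarith
      fix t y :: real assume t: "t \<in> {0..1}" and "y \<in> closed_segment (H t) (-1)"
      then have "y \<le> H t" using H_nonneg[of t] by (auto simp: closed_segment_eq_real_ivl split: if_splits)
      then show "annulus_point t y \<in> - {Q}" using y_eq[of t y] H_eq[OF _ t, of y] Hv s1 by auto
    qed
    also have "\<dots> = 2 * pi * \<i>"
      unfolding k_def by (rule graph_integral_circle_inside) (use v s1 pv in \<open>simp add: Q\<close>)
    finally have i1: "graph_integral H H' k = 2 * pi * \<i>" .
    have i2: "graph_integral (\<lambda>_. \<eta>) (\<lambda>_. 0) k = 0"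
      unfolding k_def by (rule graph_integral_circle_outside) (use v s1 pv in \<open>simp add: Q\<close>)
    have "?I H H' - ?I (\<lambda>_. \<eta>) (\<lambda>_. 0) = (graph_integral H H' k - graph_integral (\<lambda>_. \<eta>) (\<lambda>_. 0) k) *\<^sub>C F Q"
      unfolding k_def
      by (rule graph_integral_deform_inside[where D = Dp, OF has_vector_derivative_H H'_continuous h01(1) ne(1) Dp Fp(2) _ QDp qh])
        (use Fp(1) sub in auto)
    moreover have "?I (\<lambda>t. - H t) (\<lambda>t. - H' t) = ?I (\<lambda>_. - \<eta>) (\<lambda>_. 0)"
      unfolding k_def
      by (rule graph_integral_deform_outside[where D = Dm, OF has_vector_derivative_minus_H cmH' h01(2) ne(2) Dm Fm(2) _ QDm])
        (use Fm(1) sub in auto)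
    ultimately show ?thesis by (simp add: i1 i2)
  next
    assume s1: "\<sigma> = -1"
    have QDm: "Q \<in> Dm"
      unfolding Q by (rule Dm[OF t01]) (use Hv v s1 in \<open>simp add: closed_segment_eq_real_ivl\<close>)
    have QDp: "Q \<notin> Dp"
    proof
      assume "Q \<in> Dp"
      then obtain t y where "Q = annulus_point t y" "H t \<le> y" unfolding Dp_def by blast
      then show False using y_eq[of t y] s1 v H_nonneg[of t] by simp
    qed
    have qh: "annulus_point t (- H t) \<noteq> Q" "annulus_point t (- \<eta>) \<noteq> Q" if "t \<in> {0..1}" for t
      using y_eq[of t "- H t"] y_eq[of t "- \<eta>"] H_eq[OF _ that] Hv v s1 by auto
    have "graph_integral (\<lambda>t. - H t) (\<lambda>t. - H' t) k = graph_integral (\<lambda>_. 1) (\<lambda>_. 0) k"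
    proof (rule graph_integral_deform[OF has_vector_derivative_minus_H cmH' h01(2) _ _ ck(1) ck(2) dk])
      show "- H t \<noteq> 1" for t using H_nonneg[of t] by linarith
      fix t y :: real assume t: "t \<in> {0..1}" and "y \<in> closed_segment (- H t) 1"
      then have "- H t \<le> y" using H_nonneg[of t] by (auto simp: closed_segment_eq_real_ivl split: if_splits)
      then show "annulus_point t y \<in> - {Q}" using y_eq[of t y] H_eq[OF _ t, of y] Hv s1 by auto
    qed
    also have "\<dots> = 0"
      unfolding k_def by (rule graph_integral_circle_outside) (use v s1 pv in \<open>simp add: Q\<close>)
    finally have i1: "graph_integral (\<lambda>t. - H t) (\<lambda>t. - H' t) k = 0" .
    have i2: "graph_integral (\<lambda>_. - \<eta>) (\<lambda>_. 0) k = 2 * pi * \<i>"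
      unfolding k_def by (rule graph_integral_circle_inside) (use v s1 pv in \<open>simp add: Q\<close>)
    have "?I (\<lambda>t. - H t) (\<lambda>t. - H' t) - ?I (\<lambda>_. - \<eta>) (\<lambda>_. 0)
        = (graph_integral (\<lambda>t. - H t) (\<lambda>t. - H' t) k - graph_integral (\<lambda>_. - \<eta>) (\<lambda>_. 0) k) *\<^sub>C F Q"
      unfolding k_def
      by (rule graph_integral_deform_inside[where D = Dm, OF has_vector_derivative_minus_H cmH' h01(2) ne(2) Dm Fm(2) _ QDm qh])
        (use Fm(1) sub in auto)
    moreover have "?I H H' = ?I (\<lambda>_. \<eta>) (\<lambda>_. 0)"
      unfolding k_def
      by (rule graph_integral_deform_outside[where D = Dp, OF has_vector_derivative_H H'_continuous h01(1) ne(1) Dp Fp(2) _ QDp])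
        (use Fp(1) sub in auto)
    ultimately show ?thesis by (simp add: i1 i2 scaleC.diff_left scaleC.minus_left algebra_simps)
  qed
  show "(2 * of_real pi * \<i>) *\<^sub>C F Q = integral {0..1} (integrand (\<lambda>\<zeta>. inverse (\<zeta> - Q)))"
  proof -
    have cont: "continuous_on {0..1} (\<lambda>t. (z' t * k (z t)) *\<^sub>C F (z t))"
      if "continuous_on {0..1} z" "continuous_on {0..1} z'" "continuous_on {0..1} (\<lambda>t. F (z t))"
        "\<And>t. t \<in> {0..1} \<Longrightarrow> z t \<noteq> Q" for z z' :: "real \<Rightarrow> complex"
      unfolding k_def using that by (intro continuous_intros) auto
    have neQ: "upper t \<noteq> Q" "lower t \<noteq> Q" "inner t \<noteq> Q" "outer t \<noteq> Q" if t: "t \<in> {0..1}" for t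
    proof -
      have H': "H t \<noteq> v" if "annulus_point t y = Q" for y using H_eq[OF that t] Hv by simp
      show "upper t \<noteq> Q"
      proof
        assume u: "upper t = Q"
        then have "H t = \<sigma> * v" using y_eq unfolding upper_def by blast
        then show False using ss v H_nonneg[of t] H' u unfolding upper_def by auto
      qed
      show "lower t \<noteq> Q"
      proof
        assume u: "lower t = Q"
        then have "- H t = \<sigma> * v" using y_eq unfolding lower_def by blast
        then show False using ss v H_nonneg[of t] H' u unfolding lower_def by auto
      qed
      show "inner t \<noteq> Q" "outer t \<noteq> Q" using circle_points(3,4)[of Q t] assms \<eta>_pos by auto
    qed
    have int: "(\<lambda>t. (upper' t * k (upper t)) *\<^sub>C F (upper t)) integrable_on {0..1}"
      "(\<lambda>t. (lower' t * k (lower t)) *\<^sub>C F (lower t)) integrable_on {0..1}"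
      "(\<lambda>t. (inner' t * k (inner t)) *\<^sub>C F (inner t)) integrable_on {0..1}"
      "(\<lambda>t. (outer' t * k (outer t)) *\<^sub>C F (outer t)) integrable_on {0..1}"
      by (intro integrable_continuous_real cont curves_continuous F_curves_continuous neQ; assumption)+
    have I: "?I H H' = integral {0..1} (\<lambda>t. (upper' t * k (upper t)) *\<^sub>C F (upper t))"
      "?I (\<lambda>t. - H t) (\<lambda>t. - H' t) = integral {0..1} (\<lambda>t. (lower' t * k (lower t)) *\<^sub>C F (lower t))"
      "?I (\<lambda>_. \<eta>) (\<lambda>_. 0) = integral {0..1} (\<lambda>t. (inner' t * k (inner t)) *\<^sub>C F (inner t))"
      "?I (\<lambda>_. - \<eta>) (\<lambda>_. 0) = integral {0..1} (\<lambda>t. (outer' t * k (outer t)) *\<^sub>C F (outer t))"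
      by (simp_all add: graph_integral_def scaleC_scaleC upper'_def lower'_def inner'_def outer'_def
          upper_def lower_def inner_def outer_def)
    show ?thesis
      unfolding main I integrand_def k_def[symmetric]
      by (simp only: integral_diff integral_add integrable_diff int)
  qed
qed

text \<open>The kernel is expanded under the integral, for each \<open>t\<close> separately.
  Coefficients and remainder inherit the pairing of the gap terms, so that all their integrals
  exist.\<close>

lemma remainder:
  assumes Q: "tangent Q"
  shows "F Q - (\<Sum>n<N. (Q - 1) ^ n *\<^sub>C taylor n) = (inverse (2 * of_real pi * \<i>) * (Q - 1) ^ N) *\<^sub>C
    integral {0..1} (integrand (\<lambda>\<zeta>. inverse (\<zeta> - 1) ^ N * inverse (\<zeta> - Q)))"
proof -
  let ?R = "\<lambda>\<zeta>. inverse (\<zeta> - 1) ^ N * inverse (\<zeta> - Q)"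
  let ?T = "\<lambda>n \<zeta>. inverse (\<zeta> - 1) ^ (n + 1)"
  have contR: "continuous_on {0..1} (integrand ?R)"
    by (rule continuous_on_integrand) (use Q in blast)
  have contT: "continuous_on {0..1} (integrand (?T n))" for n
    using continuous_on_integrand[of "\<lambda>_. 1" "n + 1"] by simp
  have pt: "integrand (\<lambda>\<zeta>. inverse (\<zeta> - Q)) t
      = (\<Sum>n<N. (Q - 1) ^ n *\<^sub>C integrand (?T n) t) + (Q - 1) ^ N *\<^sub>C integrand ?R t"
    if t: "t \<in> {0..1}" for t
  proof -
    have ex: "(z' * inverse (\<zeta> - Q)) *\<^sub>C x
        = (\<Sum>n<N. (Q - 1) ^ n *\<^sub>C ((z' * ?T n \<zeta>) *\<^sub>C x)) + (Q - 1) ^ N *\<^sub>C ((z' * ?R \<zeta>) *\<^sub>C x)"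
      if "\<zeta> \<noteq> 1" "\<zeta> \<noteq> Q" for \<zeta> z' and x :: 'b
    proof -
      have "(z' * inverse (\<zeta> - Q)) *\<^sub>C x
          = (z' * ((\<Sum>n<N. (Q - 1) ^ n * ?T n \<zeta>) + (Q - 1) ^ N * ?R \<zeta>)) *\<^sub>C x"
        by (rule arg_cong[where f = "\<lambda>u. (z' * u) *\<^sub>C x"]) (rule inverse_diff_expansion[OF that])
      also have "\<dots> = (\<Sum>n<N. (Q - 1) ^ n *\<^sub>C ((z' * ?T n \<zeta>) *\<^sub>C x)) + (Q - 1) ^ N *\<^sub>C ((z' * ?R \<zeta>) *\<^sub>C x)"
        by (simp only: distrib_left sum_distrib_left mult.left_commute[of z'] scaleC.add_left
            scaleC.sum_left scaleC_scaleC)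
      finally show ?thesis .
    qed
    have circ: "inner t \<noteq> 1" "outer t \<noteq> 1" "inner t \<noteq> Q" "outer t \<noteq> Q"
      using circle_points(1,2)[of t] circle_points(3,4)[of Q t] Q \<eta>_pos by auto
    \<comment> \<open>At the ends \<zeta> = 1 and the expansion does not apply; there the upper and
      lower terms coincide, and both sides are 0.\<close>
    have gap: "(upper' t * inverse (upper t - Q)) *\<^sub>C F (upper t) - (lower' t * inverse (lower t - Q)) *\<^sub>C F (lower t)
      = (\<Sum>n<N. (Q - 1) ^ n *\<^sub>C ((upper' t * ?T n (upper t)) *\<^sub>C F (upper t) - (lower' t * ?T n (lower t)) *\<^sub>C F (lower t)))
        + (Q - 1) ^ N *\<^sub>C ((upper' t * ?R (upper t)) *\<^sub>C F (upper t) - (lower' t * ?R (lower t)) *\<^sub>C F (lower t))"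
    proof (cases "t \<in> {0<..<1}")
      case True
      show ?thesis
        unfolding ex[OF curves_ne(1)[OF True] curves_ne(3)[OF True Q]]
          ex[OF curves_ne(2)[OF True] curves_ne(4)[OF True Q]]
        by (simp add: scaleC.diff_right sum_subtractf algebra_simps)
    next
      case False
      then have "t = 0 \<or> t = 1" using t by auto
      then show ?thesis using curves_ends by (auto simp: scaleC.zero_right)
    qed
    have regroup: "(a + a') - (b + b') + (g + g') = (a - b + g) + (a' - b' + g')"
      for a a' b b' g g' :: 'b by simp
    show ?thesis
      unfolding integrand_def gap ex[OF circ(1,3)] ex[OF circ(2,4)] regroup
      by (simp only: scaleC.diff_right scaleC.add_right sum_subtractf sum.distrib)
  qed
  have int: "integrand ?R integrable_on {0..1}" "integrand (?T n) integrable_on {0..1}" for n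
    using contR contT by (auto intro: integrable_continuous_real)
  have sc: "((\<lambda>t. a *\<^sub>C f t) has_integral a *\<^sub>C integral {0..1} f) {0..1}"
    if "f integrable_on {0..1}" for a and f :: "real \<Rightarrow> 'b"
    using has_integral_linear[OF integrable_integral[OF that] scaleC.bounded_linear_right[of a]]
    by (simp add: o_def)
  have "((\<lambda>t. (\<Sum>n<N. (Q - 1) ^ n *\<^sub>C integrand (?T n) t) + (Q - 1) ^ N *\<^sub>C integrand ?R t) has_integral
      (\<Sum>n<N. (Q - 1) ^ n *\<^sub>C integral {0..1} (integrand (?T n))) + (Q - 1) ^ N *\<^sub>C integral {0..1} (integrand ?R)) {0..1}"
    by (intro has_integral_add has_integral_sum sc int) simp
  from has_integral_eq[OF pt[symmetric] this]
  have I: "integral {0..1} (integrand (\<lambda>\<zeta>. inverse (\<zeta> - Q)))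
      = (\<Sum>n<N. (Q - 1) ^ n *\<^sub>C integral {0..1} (integrand (?T n))) + (Q - 1) ^ N *\<^sub>C integral {0..1} (integrand ?R)"
    by (rule integral_unique)
  define a :: complex where "a = 2 * of_real pi * \<i>"
  have "a \<noteq> 0" by (simp add: a_def)
  then have "F Q = inverse a *\<^sub>C (a *\<^sub>C F Q)" by (simp add: scaleC_scaleC)
  also have "a *\<^sub>C F Q = (\<Sum>n<N. (Q - 1) ^ n *\<^sub>C integral {0..1} (integrand (?T n))) + (Q - 1) ^ N *\<^sub>C integral {0..1} (integrand ?R)"
    unfolding a_def Cauchy_tangent(1)[OF Q] by (rule I)
  also have "inverse a *\<^sub>C \<dots> = (\<Sum>n<N. (Q - 1) ^ n *\<^sub>C taylor n) + (inverse a * (Q - 1) ^ N) *\<^sub>C integral {0..1} (integrand ?R)"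
    unfolding taylor_def a_def[symmetric] scaleC.add_right scaleC.sum_right scaleC_scaleC
    by (simp only: mult.commute[of "inverse a"])
  finally show ?thesis unfolding a_def[symmetric] by simp
qed

text \<open>The circles contribute geometric growth, twice 14, and the gap contributes the factorial
  growth, with m = n = N in \<open>gap_integrand_bound\<close>.\<close>

lemma remainder_integral_bound:
  assumes Q: "tangent Q"
  shows "norm (integral {0..1} (integrand (\<lambda>\<zeta>. inverse (\<zeta> - 1) ^ N * inverse (\<zeta> - Q))))
    \<le> 28 * M * (1 / \<eta>) ^ (N + 1) + gap_const * real (N + 3) * gap_base ^ N * Gamma (1 + real N * \<tau>)"
proof -
  let ?k = "\<lambda>\<zeta>. inverse (\<zeta> - 1) ^ N * inverse (\<zeta> - Q)"
  let ?B = "gap_const * real (N + 3) * gap_base ^ N * Gamma (1 + real N * \<tau>)"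
  have v: "(\<lambda>\<zeta>. inverse (\<zeta> - Q)) = (\<lambda>_. 1) \<or> (\<exists>Q'. tangent Q' \<and> (\<lambda>\<zeta>. inverse (\<zeta> - Q)) = (\<lambda>\<zeta>. inverse (\<zeta> - Q')))"
    using Q by blast
  have B: "0 \<le> ?B"
    using gap_const_nonneg \<tau> by (intro mult_nonneg_nonneg Gamma_real_nonneg) (auto simp: gap_base_def add_pos_nonneg)
  have "norm (integrand ?k t) \<le> 28 * M * (1 / \<eta>) ^ (N + 1) + ?B" if t: "t \<in> {0..1}" for t
  proof -
    have gap: "norm ((upper' t * ?k (upper t)) *\<^sub>C F (upper t) - (lower' t * ?k (lower t)) *\<^sub>C F (lower t)) \<le> ?B"
    proof (cases "t \<in> {0<..<1}")
      case True
      define w where "w = t * (1 - t)"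
      have w: "0 < w" "w \<le> 1" using True mult_mono[of t 1 "1 - t" 1] by (auto simp: w_def)
      have "w ^ 7 * w ^ N / w ^ (N + 5) = w\<^sup>2"
        using w(1) by (rule weight_quotient)
      moreover have "w\<^sup>2 \<le> 1" using w by (intro power_le_one) auto
      ultimately have "?B * (w ^ 7 * w ^ N / w ^ (N + 5)) \<le> ?B * 1"
        using B by (intro mult_left_mono) auto
      then show ?thesis
        using gap_integrand_bound[OF True v, of N N] unfolding w_def by linarith
    next
      case False
      then have "t = 0 \<or> t = 1" using t by auto
      then show ?thesis using curves_ends B by auto
    qed
    have "norm (integrand ?k t) \<le> (14 * M * (1 / \<eta>) ^ (N + 1) + 14 * M * (1 / \<eta>) ^ (N + 1)) + ?B"
      unfolding integrand_def
      by (intro norm_triangle_le norm_triangle_le_diff add_mono circle_term_bound[OF v t] gap)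
    then show ?thesis by simp
  qed
  then have "norm (integral {0..1} (integrand ?k)) \<le> (28 * M * (1 / \<eta>) ^ (N + 1) + ?B) * (1 - 0)"
    using continuous_on_integrand[OF v, of N] by (intro integral_bound) auto
  then show ?thesis by simp
qed

text \<open>Two growth rates are merged into one: (1/\<eta>)^N from the circles and (N + 3) times a
  geometric and a Gamma factor from the gap. The linear factor is absorbed by 3 * 2^N.\<close>

theorem gevrey_expansion:
  "\<exists>c0 c1. c0 > 0 \<and> c1 > 0 \<and> (\<forall>N Q. tangent Q \<longrightarrow>
    norm (F Q - (\<Sum>n<N. (Q - 1) ^ n *\<^sub>C taylor n)) \<le> c0 * c1 ^ N * Gamma (1 + real N * \<tau>) * cmod (Q - 1) ^ N)"
proof -
  define c0 where "c0 = 28 * M / \<eta> * exp 2 + 3 * gap_const + 1"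
  define c1 where "c1 = 1 / \<eta> + 2 * gap_base"
  have gb: "0 < gap_base" using c by (simp add: gap_base_def)
  have pos: "0 < c0" "0 < c1"
  proof -
    have "0 \<le> 28 * M / \<eta> * exp 2" using M_nonneg \<eta>_pos by simp
    then show "0 < c0" using gap_const_nonneg unfolding c0_def by linarith
    show "0 < c1" using \<eta>_pos gb by (simp add: c1_def add_pos_pos)
  qed
  have "norm (F Q - (\<Sum>n<N. (Q - 1) ^ n *\<^sub>C taylor n)) \<le> c0 * c1 ^ N * Gamma (1 + real N * \<tau>) * cmod (Q - 1) ^ N"
    if Q: "tangent Q" for N Q
  proof -
    define G where "G = Gamma (1 + real N * \<tau>)"
    \<comment> \<open>\<Gamma> may be smaller than 1; the Gamma bound at v = 1 shows that a factor
      exp(2) suffices to bring the geometric term under it.\<close>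
    have "1 \<le> exp 1 * (exp 1 * G)"
      using powr_exp_le_Gamma[of "real N * \<tau>" 1] \<tau>
      by (simp add: G_def exp_minus field_simps)
    then have G: "1 \<le> exp 2 * G"
      by (simp add: mult.assoc[symmetric] mult_exp_exp)
    have G0: "0 \<le> G" using \<tau> unfolding G_def by (intro Gamma_real_nonneg) (simp add: add_pos_nonneg)
    have t1: "28 * M * (1 / \<eta>) ^ (N + 1) \<le> 28 * M / \<eta> * exp 2 * (c1 ^ N * G)"
    proof -
      have "(1 / \<eta>) ^ N * 1 \<le> c1 ^ N * (exp 2 * G)"
        using G \<eta>_pos gb by (intro mult_mono power_mono) (auto simp: c1_def)
      then have "28 * M / \<eta> * ((1 / \<eta>) ^ N * 1) \<le> 28 * M / \<eta> * (c1 ^ N * (exp 2 * G))"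
        using M_nonneg \<eta>_pos by (intro mult_left_mono) auto
      then show ?thesis by (simp add: ac_simps)
    qed
    have t2: "gap_const * real (N + 3) * gap_base ^ N * G \<le> 3 * gap_const * (c1 ^ N * G)"
    proof -
      have "real (N + 3) \<le> 3 * 2 ^ N"
        by (induction N) auto
      then have "real (N + 3) * gap_base ^ N \<le> 3 * 2 ^ N * gap_base ^ N"
        using gb by (intro mult_right_mono) auto
      also have "\<dots> = 3 * (2 * gap_base) ^ N" by (simp add: power_mult_distrib)
      also have "\<dots> \<le> 3 * c1 ^ N"
        using gb \<eta>_pos by (intro mult_left_mono power_mono) (auto simp: c1_def)
      finally have "gap_const * G * (real (N + 3) * gap_base ^ N) \<le> gap_const * G * (3 * c1 ^ N)"
        using gap_const_nonneg G0 by (intro mult_left_mono) auto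
      then show ?thesis by (simp add: ac_simps)
    qed
    have "norm (integral {0..1} (integrand (\<lambda>\<zeta>. inverse (\<zeta> - 1) ^ N * inverse (\<zeta> - Q)))) \<le> c0 * (c1 ^ N * G)"
    proof -
      have "0 \<le> c1 ^ N * G" using pos G0 by simp
      then show ?thesis
        using remainder_integral_bound[OF Q, of N] t1 t2 unfolding G_def[symmetric] c0_def
        by (simp add: distrib_right)
    qed
    moreover have "cmod (inverse (2 * of_real pi * \<i>)) \<le> 1"
      using le_imp_inverse_le[of 1 "2 * pi"] pi_ge_two by (simp add: norm_inverse norm_mult)
    ultimately have "norm (F Q - (\<Sum>n<N. (Q - 1) ^ n *\<^sub>C taylor n)) \<le> (1 * cmod (Q - 1) ^ N) * (c0 * (c1 ^ N * G))"
      unfolding remainder[OF Q] norm_scaleC norm_mult norm_power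
      by (intro mult_mono mult_nonneg_nonneg) auto
    then show ?thesis by (simp add: G_def ac_simps)
  qed
  with pos show ?thesis by blast
qed

end

section \<open>Monogenic functions\<close>

text \<open>Taking z1 = z in the Whitney condition gives the derivative relative to
  \<open>K\<close>. Taking \<epsilon> = 1 with both points free gives a Lipschitz bound for pairs
  near z, even when the segment joining them leaves \<open>K\<close>.\<close>

lemma C1_hol_obtains:
  assumes "f \<in> C1_hol K"
  obtains f1 where "continuous_on K f1"
    "\<And>z. z \<in> K \<Longrightarrow> (f has_derivative (\<lambda>h. h *\<^sub>C f1 z)) (at z within K)"
    "\<And>z. z \<in> K \<Longrightarrow> \<exists>\<delta>>0. \<forall>z1\<in>K. \<forall>z2\<in>K. cmod (z1 - z) < \<delta> \<longrightarrow> cmod (z2 - z) < \<delta> \<longrightarrow>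
      norm (f z2 - f z1) \<le> (norm (f1 z1) + 1) * cmod (z1 - z2)"
proof -
  obtain f1 where f1: "continuous_on K f1" and
    W: "\<And>z \<epsilon>. z \<in> K \<Longrightarrow> \<epsilon> > 0 \<Longrightarrow> \<exists>\<delta>>0. \<forall>z1\<in>K. \<forall>z2\<in>K.
        cmod (z1 - z) < \<delta> \<longrightarrow> cmod (z2 - z) < \<delta> \<longrightarrow>
        norm (f z2 - f z1 - (z2 - z1) *\<^sub>C f1 z1) \<le> \<epsilon> * cmod (z1 - z2)"
    using assms unfolding C1_hol_def by blast
  have "(f has_derivative (\<lambda>h. h *\<^sub>C f1 z)) (at z within K)" if z: "z \<in> K" for z
    unfolding has_derivative_within_alt
  proof (intro conjI allI impI)
    show "bounded_linear (\<lambda>h. h *\<^sub>C f1 z)" by (rule scaleC.bounded_linear_left)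
    fix e :: real assume "0 < e"
    from W[OF z this] obtain \<delta> where \<delta>: "\<delta> > 0" "\<And>z1 z2. z1 \<in> K \<Longrightarrow> z2 \<in> K \<Longrightarrow>
        cmod (z1 - z) < \<delta> \<Longrightarrow> cmod (z2 - z) < \<delta> \<Longrightarrow>
        norm (f z2 - f z1 - (z2 - z1) *\<^sub>C f1 z1) \<le> e * cmod (z1 - z2)" by blast
    have "norm (f y - f z - (y - z) *\<^sub>C f1 z) \<le> e * norm (y - z)" if "y \<in> K" "norm (y - z) < \<delta>" for y
      using \<delta>(2)[OF z that(1)] that(2) \<delta>(1) by (simp add: norm_minus_commute)
    then show "\<exists>d>0. \<forall>y\<in>K. norm (y - z) < d \<longrightarrow> norm (f y - f z - (y - z) *\<^sub>C f1 z) \<le> e * norm (y - z)"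
      using \<delta>(1) by blast
  qed
  moreover have "\<exists>\<delta>>0. \<forall>z1\<in>K. \<forall>z2\<in>K. cmod (z1 - z) < \<delta> \<longrightarrow> cmod (z2 - z) < \<delta> \<longrightarrow>
      norm (f z2 - f z1) \<le> (norm (f1 z1) + 1) * cmod (z1 - z2)" if z: "z \<in> K" for z
  proof -
    from W[OF z zero_less_one] obtain \<delta> where \<delta>: "\<delta> > 0" "\<And>z1 z2. z1 \<in> K \<Longrightarrow> z2 \<in> K \<Longrightarrow>
        cmod (z1 - z) < \<delta> \<Longrightarrow> cmod (z2 - z) < \<delta> \<Longrightarrow>
        norm (f z2 - f z1 - (z2 - z1) *\<^sub>C f1 z1) \<le> 1 * cmod (z1 - z2)" by blast
    have "norm (f z2 - f z1) \<le> (norm (f1 z1) + 1) * cmod (z1 - z2)"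
      if "z1 \<in> K" "z2 \<in> K" "cmod (z1 - z) < \<delta>" "cmod (z2 - z) < \<delta>" for z1 z2
      using \<delta>(2)[OF that] norm_triangle_ineq[of "f z2 - f z1 - (z2 - z1) *\<^sub>C f1 z1" "(z2 - z1) *\<^sub>C f1 z1"]
      by (simp add: norm_scaleC norm_minus_commute algebra_simps)
    then show ?thesis using \<delta>(1) by blast
  qed
  ultimately show ?thesis using that f1 by blast
qed

text \<open>Near 1 the Lipschitz bound compares points facing each other across the gap, at distance
  at most 20 H. Away from 1, compactness bounds H from below, and boundedness of F suffices.\<close>

lemma flat_gap_Lipschitz:
  fixes F :: "complex \<Rightarrow> 'b::complex_banach"
  assumes cont: "continuous_on {0..1} H" and pos: "\<And>t. t \<in> {0<..<1} \<Longrightarrow> 0 < H t"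
    and ends: "H 0 = 0" "H 1 = 0"
    and small: "\<And>t. t \<in> {0..1} \<Longrightarrow> H t \<le> (t * (1 - t))\<^sup>2 / 200"
    and in_D: "\<And>t. t \<in> {0..1} \<Longrightarrow> annulus_point t (H t) \<in> D \<and> annulus_point t (- H t) \<in> D"
    and bd: "\<And>w. w \<in> D \<Longrightarrow> norm (F w) \<le> B"
    and Lip: "0 < \<delta>" "\<And>w w'. w \<in> D \<Longrightarrow> w' \<in> D \<Longrightarrow> cmod (w - 1) < \<delta> \<Longrightarrow> cmod (w' - 1) < \<delta> \<Longrightarrow>
      norm (F w - F w') \<le> L * cmod (w - w')"
  obtains M where "\<And>t. t \<in> {0..1} \<Longrightarrow>
    norm (F (annulus_point t (H t)) - F (annulus_point t (- H t))) \<le> M * H t"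
proof -
  define u where "u t = annulus_point t (H t)" for t
  define l where "l t = annulus_point t (- H t)" for t
  have nn: "0 \<le> H t" if "t \<in> {0..1}" for t
    using pos[of t] ends that by (cases "t = 0 \<or> t = 1") auto
  have ul: "cmod (u t - l t) \<le> 20 * H t" if "t \<in> {0..1}" for t
    using gap_curve_estimates(4)[OF that, of "H t"] small[OF that] nn[OF that] by (simp add: u_def l_def)
  have cont': "continuous_on {0..1} u" "continuous_on {0..1} l"
    unfolding u_def l_def by (intro continuous_intros cont)+
  have e: "u 0 = 1" "u 1 = 1" "l 0 = 1" "l 1 = 1"
    using annulus_point_0_1[of 0] by (simp_all add: u_def l_def ends annulus_point_def)
  have near: "\<exists>s>0. \<forall>t\<in>{0..1}. \<bar>t - a\<bar> < s \<longrightarrow> cmod (z t - 1) < \<delta>"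
    if "continuous_on {0..1} z" "z a = 1" "a \<in> {0..1}" for a :: real and z
    using that Lip(1) unfolding continuous_on_iff dist_norm real_norm_def by metis
  obtain s1 s2 s3 s4 where s: "0 < s1" "0 < s2" "0 < s3" "0 < s4"
    "\<And>t. t \<in> {0..1} \<Longrightarrow> \<bar>t - 0\<bar> < s1 \<Longrightarrow> cmod (u t - 1) < \<delta>"
    "\<And>t. t \<in> {0..1} \<Longrightarrow> \<bar>t - 1\<bar> < s2 \<Longrightarrow> cmod (u t - 1) < \<delta>"
    "\<And>t. t \<in> {0..1} \<Longrightarrow> \<bar>t - 0\<bar> < s3 \<Longrightarrow> cmod (l t - 1) < \<delta>"
    "\<And>t. t \<in> {0..1} \<Longrightarrow> \<bar>t - 1\<bar> < s4 \<Longrightarrow> cmod (l t - 1) < \<delta>"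
    using near[OF cont'(1) e(1)] near[OF cont'(1) e(2)] near[OF cont'(2) e(3)] near[OF cont'(2) e(4)]
    by auto
  \<comment> \<open>The cap 1/2 keeps \<open>{s..1-s}\<close> nonempty, so that H attains a minimum
    on it.\<close>
  define s where "s = min (1/2) (min (min s1 s2) (min s3 s4))"
  have s': "0 < s" "s \<le> 1/2" "s \<le> s1" "s \<le> s2" "s \<le> s3" "s \<le> s4"
    using s(1-4) by (auto simp: s_def)
  obtain t0 where t0: "t0 \<in> {s..1-s}" "\<And>t. t \<in> {s..1-s} \<Longrightarrow> H t0 \<le> H t"
    using continuous_attains_inf[of "{s..1-s}" H] continuous_on_subset[OF cont, of "{s..1-s}"] s' by auto
  have Ht0: "0 < H t0" using pos[of t0] t0(1) s' by auto
  define M where "M = max (\<bar>L\<bar> * 20) (2 * B / H t0)"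
  have "norm (F (u t) - F (l t)) \<le> M * H t" if t: "t \<in> {0..1}" for t
  proof (cases "t \<in> {s..1-s}")
    case True
    have "norm (F (u t) - F (l t)) \<le> 2 * B"
      using norm_triangle_ineq4[of "F (u t)" "F (l t)"] bd[of "u t"] bd[of "l t"] in_D[OF t]
      unfolding u_def l_def by linarith
    also have "\<dots> = 2 * B / H t0 * H t0" using Ht0 by simp
    also have "\<dots> \<le> 2 * B / H t0 * H t"
      using t0(2)[OF True] Ht0 order_trans[OF norm_ge_zero bd] in_D[OF t]
      by (intro mult_left_mono divide_nonneg_pos) auto
    also have "\<dots> \<le> M * H t" using nn[OF t] by (intro mult_right_mono) (auto simp: M_def)
    finally show ?thesis .
  next
    case False
    then have "\<bar>t - 0\<bar> < s \<or> \<bar>t - 1\<bar> < s" using t by auto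
    then have "cmod (u t - 1) < \<delta>" "cmod (l t - 1) < \<delta>"
      using s(5-8)[OF t] s' by linarith+
    then have "norm (F (u t) - F (l t)) \<le> L * cmod (u t - l t)"
      using Lip(2) in_D[OF t] unfolding u_def l_def by blast
    also have "\<dots> \<le> \<bar>L\<bar> * (20 * H t)" using ul[OF t] by (intro mult_mono) auto
    also have "\<dots> = \<bar>L\<bar> * 20 * H t" by simp
    also have "\<dots> \<le> M * H t" using nn[OF t] by (intro mult_right_mono) (auto simp: M_def)
    finally show ?thesis .
  qed
  then show ?thesis using that unfolding u_def l_def by blast
qed

text \<open>For a common point z of the two circles and Z = z / l,
  \<open>tangent_disk_norm_eq\<close> reduces to (1 - \<sigma> r) |Z - 1|^2 = 0.\<close>

lemma tangent_disk_ball: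
  assumes l: "cmod l = 1" and "\<bar>\<sigma>\<bar> = 1" "0 < r" "r < 1"
  shows "tangent_disk l (ball (l * of_real (1 - \<sigma> * r)) r)"
proof -
  have sr: "\<bar>\<sigma> * r\<bar> = r" using assms by (simp add: abs_mult)
  have l0: "l \<noteq> 0" using l by auto
  have d: "dist (l * of_real (1 - \<sigma> * r)) (l * Z) = cmod (Z - of_real (1 - \<sigma> * r))" for Z
    unfolding dist_norm right_diff_distrib[symmetric] norm_mult l by (simp add: norm_minus_commute)
  have "z = l" if z: "dist (l * of_real (1 - \<sigma> * r)) z = r" "cmod z = 1" for z
  proof -
    define Z where "Z = z / l"
    have Z: "z = l * Z" "cmod Z = 1" using l0 z(2) l by (simp_all add: Z_def norm_divide)
    have "(cmod (Z - of_real (1 - \<sigma> * r)))\<^sup>2 = r\<^sup>2" using z(1) d unfolding Z(1) by simp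
    then have "(1 - \<sigma> * r) * (cmod (Z - 1))\<^sup>2 = 0"
      unfolding tangent_disk_norm_eq[OF assms(2)] by (simp add: Z(2))
    moreover have "1 - \<sigma> * r \<noteq> 0" using sr assms(4) by auto
    ultimately show "z = l" using Z(1) by simp
  qed
  moreover have "dist (l * of_real (1 - \<sigma> * r)) l = r"
    using d[of 1] sr by (simp add: norm_mult flip: of_real_mult)
  ultimately have "sphere (l * of_real (1 - \<sigma> * r)) r \<inter> sphere 0 1 = {l}"
    using l by (auto simp: dist_norm)
  then show ?thesis using assms(3) unfolding tangent_disk_def by blast
qed

lemma exp_2pi_i_annulus_point:
  "exp_2pi_i (of_real y0) * annulus_point t y = exp_2pi_i (Complex (y0 + t) y)"
proof -
  have "2 * of_real pi * \<i> * of_real y0 + (of_real (- 2 * pi * y) + \<i> * of_real (2 * pi * t))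
      = 2 * of_real pi * \<i> * Complex (y0 + t) y"
    by (simp add: complex_eq_iff algebra_simps)
  then show ?thesis by (simp only: exp_2pi_i_def annulus_point_def exp_add[symmetric])
qed

theorem theorem3p3:
  fixes \<tau> \<kappa> d \<alpha> :: real and \<gamma> :: "nat \<Rightarrow> real" and l :: complex
  assumes "\<tau> \<ge> 2"
    and "0 < \<kappa>" and "\<kappa> < 1" and "0 < d" and "0 < \<alpha>"
    and "decseq \<gamma>" and "\<And>j. 0 < \<gamma> j" and "\<gamma> \<longlonglongrightarrow> 0"
    and "\<And>j. \<gamma> j < min (\<alpha> * exp 1 / 2) (min ((exp \<alpha> - 1) / 2) 1)"
    and "l \<in> DC_circle \<tau>"
  shows "(monogenic (K_seq \<kappa> d \<alpha> \<gamma>) :: (complex \<Rightarrow> 'b::complex_banach) set)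
    \<subseteq> gevrey \<tau> l (\<Union>j. K_seq \<kappa> d \<alpha> \<gamma> j)"
proof
  fix f :: "complex \<Rightarrow> 'b" assume f: "f \<in> monogenic (K_seq \<kappa> d \<alpha> \<gamma>)"
  have \<tau>: "0 < \<tau>" using assms(1) by simp
  obtain y0 g where y0: "y0 \<in> DC g \<tau>" "0 < g" "l = exp_2pi_i (of_real y0)"
    using assms(10) unfolding DC_circle_def DC_union_def by auto
  have l: "cmod l = 1" by (simp add: y0(3) exp_2pi_i_def norm_exp_eq_Re)
  obtain c where c: "0 < c" and dense: "\<And>\<theta>. 0 < \<theta> \<Longrightarrow> \<exists>\<epsilon>>0. \<forall>\<gamma>. 0 < \<gamma> \<and> \<gamma> < \<epsilon> \<longrightarrow>
      y0 \<in> C_real (psi_exp \<alpha> \<gamma>) \<and> y0 + 1 \<in> C_real (psi_exp \<alpha> \<gamma>) \<and>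
      (\<forall>t\<in>{0<..<1}. \<exists>a\<in>C_real (psi_exp \<alpha> \<gamma>).
         \<bar>y0 + t - a\<bar> \<le> \<theta> * exp (- c * (t * (1 - t)) powr (- 1 / \<tau>)))"
    using C_real_dense_near_DC[OF y0(1,2) \<tau> assms(5)] by metis
  obtain K where K: "0 < K" "\<And>t. t \<in> {0..1} \<Longrightarrow>
      flat c \<tau> t + \<bar>flat_deriv c \<tau> t\<bar> \<le> K * (t * (1 - t)) ^ 7 * flat (c / 2) \<tau> t"
    using flat_bound[OF c \<tau>, of 7] by metis
  \<comment> \<open>The height d is the limit in \<open>C_complex\<close>, and 1/30 is the range of
    the geometric estimates.\<close>
  define \<eta> where "\<eta> = min d (1/30)"
  \<comment> \<open>The bound \<eta>/2 keeps the gap between the two circles; 1/(200 K) turns the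
    constant of \<open>flat_bound\<close> into the 1/200 of the locale.\<close>
  define \<theta> where "\<theta> = min (\<eta> / 2) (1 / (200 * K))"
  have \<eta>: "0 < \<eta>" "\<eta> \<le> d" "\<eta> \<le> 1/30" using assms(4) by (auto simp: \<eta>_def)
  have \<theta>: "0 < \<theta>" "\<theta> < \<eta>" "\<theta> * K \<le> 1/200"
  proof -
    show "0 < \<theta>" "\<theta> < \<eta>" using \<eta>(1) K(1) by (auto simp: \<theta>_def)
    have "\<theta> \<le> 1 / (200 * K)" by (simp add: \<theta>_def)
    then show "\<theta> * K \<le> 1/200" using K(1) by (simp add: field_simps)
  qed
  define H where "H t = \<theta> * flat c \<tau> t" for t
  define H' where "H' t = \<theta> * flat_deriv c \<tau> t" for t
  have H0: "0 \<le> H t" for t using \<theta>(1) flat_nonneg by (simp add: H_def)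
  obtain \<epsilon> where \<epsilon>: "0 < \<epsilon>" "\<And>\<gamma>. 0 < \<gamma> \<Longrightarrow> \<gamma> < \<epsilon> \<Longrightarrow>
      y0 \<in> C_real (psi_exp \<alpha> \<gamma>) \<and> y0 + 1 \<in> C_real (psi_exp \<alpha> \<gamma>) \<and>
      (\<forall>t\<in>{0<..<1}. \<exists>a\<in>C_real (psi_exp \<alpha> \<gamma>).
         \<bar>y0 + t - a\<bar> \<le> \<theta> * exp (- c * (t * (1 - t)) powr (- 1 / \<tau>)))"
    using dense[OF \<theta>(1)] by blast
  obtain j where j: "\<gamma> j < \<epsilon>"
    using order_tendstoD(2)[OF assms(8) \<epsilon>(1)] by (auto simp: eventually_sequentially)
  note C = \<epsilon>(2)[OF assms(7) j]
  define K0 where "K0 = K_seq \<kappa> d \<alpha> \<gamma> j"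
  \<comment> \<open>Some point of the Cantor set lies at horizontal distance at most H(t) \<le> |y|,
    and \<kappa> < 1, so the cone condition holds. At t = 0 and t = 1, where H = 0, this point is
    \<open>y0\<close> or \<open>y0 + 1\<close> itself.\<close>
  have in_K0: "l * annulus_point t y \<in> K0" if t: "t \<in> {0..1}" and y: "H t \<le> \<bar>y\<bar>" "\<bar>y\<bar> \<le> \<eta>" for t y
  proof -
    have "\<exists>a\<in>C_real (psi_exp \<alpha> (\<gamma> j)). \<bar>y0 + t - a\<bar> \<le> H t"
    proof (cases "t \<in> {0<..<1}")
      case True
      then show ?thesis using C by (auto simp: H_def flat_def)
    next
      case False
      then have "t = 0 \<or> t = 1" using t by auto
      then show ?thesis using C by (auto simp: H_def)
    qed
    then obtain a where a: "a \<in> C_real (psi_exp \<alpha> (\<gamma> j))" "\<bar>y0 + t - a\<bar> \<le> H t" by blast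
    have "\<kappa> * \<bar>y0 + t - a\<bar> \<le> 1 * \<bar>y0 + t - a\<bar>" using assms(3) by (intro mult_right_mono) auto
    then have "Complex (y0 + t) y \<in> C_complex (psi_exp \<alpha> (\<gamma> j)) \<kappa> d"
      using a y \<eta>(2) unfolding C_complex_def by (auto intro!: bexI[of _ a])
    then show ?thesis
      unfolding K0_def K_seq_def y0(3) exp_2pi_i_annulus_point by blast
  qed
  obtain f1 where f1: "continuous_on K0 f1"
    "\<And>z. z \<in> K0 \<Longrightarrow> (f has_derivative (\<lambda>h. h *\<^sub>C f1 z)) (at z within K0)"
    "\<And>z. z \<in> K0 \<Longrightarrow> \<exists>\<delta>>0. \<forall>z1\<in>K0. \<forall>z2\<in>K0. cmod (z1 - z) < \<delta> \<longrightarrow> cmod (z2 - z) < \<delta> \<longrightarrow>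
      norm (f z2 - f z1) \<le> (norm (f1 z1) + 1) * cmod (z1 - z2)"
    using C1_hol_obtains[of f K0] f unfolding monogenic_def K0_def by blast
  \<comment> \<open>A compact model of both sides of the gap, carried into \<open>K0\<close> by the
    rotation; F and F1 are bounded on it.\<close>
  define D where "D = (\<lambda>(t, y). annulus_point t y) ` {p \<in> {0..1} \<times> {-\<eta>..\<eta>}. H (fst p) \<le> \<bar>snd p\<bar>}"
  have D: "annulus_point t y \<in> D" if "t \<in> {0..1}" "H t \<le> \<bar>y\<bar>" "\<bar>y\<bar> \<le> \<eta>" for t y
    unfolding D_def using that by (intro image_eqI[of _ _ "(t, y)"]) auto
  have DK: "l * w \<in> K0" if "w \<in> D" for w
    using that in_K0 unfolding D_def by auto
  have cH: "continuous_on {0..1} H"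
  proof -
    have "continuous_on {0..1} (flat c \<tau>)"
      using has_vector_derivative_continuous[OF has_vector_derivative_flat[OF c \<tau>]]
      by (simp add: continuous_on_eq_continuous_within)
    then show ?thesis unfolding H_def by (intro continuous_intros)
  qed
  have "compact D"
  proof -
    have "closed {p \<in> {0..1} \<times> {-\<eta>..\<eta>}. H (fst p) \<le> \<bar>snd p\<bar>}"
      by (intro continuous_on_closed_Collect_le closed_Times closed_atLeastAtMost continuous_intros
          continuous_on_compose2[OF cH]) auto
    moreover have "compact ({0..1::real} \<times> {-\<eta>..\<eta>})" by (intro compact_Times compact_Icc)
    ultimately have "compact (({0..1} \<times> {-\<eta>..\<eta>}) \<inter> {p \<in> {0..1} \<times> {-\<eta>..\<eta>}. H (fst p) \<le> \<bar>snd p\<bar>})"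
      by (rule compact_Int_closed[rotated])
    then have "compact {p \<in> {0..1} \<times> {-\<eta>..\<eta>}. H (fst p) \<le> \<bar>snd p\<bar>}"
      by (rule back_subst[of compact]) auto
    then show ?thesis
      unfolding D_def case_prod_beta' by (intro compact_continuous_image continuous_intros)
  qed
  define F where "F w = f (l * w)" for w
  define F1 where "F1 w = l *\<^sub>C f1 (l * w)" for w
  have cF1: "continuous_on D F1"
    unfolding F1_def using DK
    by (intro continuous_intros continuous_on_compose2[OF f1(1)]) auto
  have dF: "(F has_derivative (\<lambda>h. h *\<^sub>C F1 w)) (at w within D)" if w: "w \<in> D" for w
  proof -
    have "((\<lambda>w. l * w) has_derivative (\<lambda>h. l * h)) (at w within D)"
      by (intro derivative_intros)
    moreover have "(f has_derivative (\<lambda>h. h *\<^sub>C f1 (l * w))) (at (l * w) within (\<lambda>w. l * w) ` D)"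
      by (rule has_derivative_subset[OF f1(2)[OF DK[OF w]]]) (use DK in auto)
    ultimately have "((\<lambda>w. f (l * w)) has_derivative (\<lambda>h. (l * h) *\<^sub>C f1 (l * w))) (at w within D)"
      by (rule has_derivative_in_compose)
    then show ?thesis unfolding F_def F1_def by (simp add: scaleC_scaleC mult.commute)
  qed
  have cF: "continuous_on D F"
    using has_derivative_continuous[OF dF] by (simp add: continuous_on_eq_continuous_within)
  obtain B where B: "\<And>w. w \<in> D \<Longrightarrow> norm (F w) \<le> B"
    using compact_imp_bounded[OF compact_continuous_image[OF cF \<open>compact D\<close>]] by (auto simp: bounded_iff)
  obtain B1 where B1: "\<And>w. w \<in> D \<Longrightarrow> norm (F1 w) \<le> B1"
    using compact_imp_bounded[OF compact_continuous_image[OF cF1 \<open>compact D\<close>]] by (auto simp: bounded_iff)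
  have H_le: "H t + \<bar>H' t\<bar> \<le> (t * (1 - t)) ^ 7 * flat (c / 2) \<tau> t / 200" if t: "t \<in> {0..1}" for t
  proof -
    have "H t + \<bar>H' t\<bar> = \<theta> * (flat c \<tau> t + \<bar>flat_deriv c \<tau> t\<bar>)"
      using \<theta>(1) by (simp add: H_def H'_def abs_mult distrib_left)
    also have "\<dots> \<le> \<theta> * (K * (t * (1 - t)) ^ 7 * flat (c / 2) \<tau> t)"
      using K(2)[OF t] \<theta>(1) by (intro mult_left_mono) auto
    also have "\<dots> = (\<theta> * K) * ((t * (1 - t)) ^ 7 * flat (c / 2) \<tau> t)" by simp
    also have "\<dots> \<le> 1/200 * ((t * (1 - t)) ^ 7 * flat (c / 2) \<tau> t)"
      using \<theta>(3) t flat_nonneg by (intro mult_right_mono) auto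
    finally show ?thesis by simp
  qed
  have H_sq: "H t \<le> (t * (1 - t))\<^sup>2 / 200" if t: "t \<in> {0..1}" for t
  proof -
    have w: "0 \<le> t * (1 - t)" "t * (1 - t) \<le> 1"
      using t mult_mono[of t 1 "1 - t" 1] by auto
    have "flat (c / 2) \<tau> t \<le> 1" using c by (simp add: flat_def)
    then have "(t * (1 - t)) ^ 7 * flat (c / 2) \<tau> t \<le> (t * (1 - t)) ^ 2 * 1"
      using w flat_nonneg by (intro mult_mono power_decreasing) auto
    then show ?thesis using H_le[OF t] abs_ge_zero[of "H' t"] by linarith
  qed
  have H_less: "H t < \<eta>" for t
  proof -
    have "flat c \<tau> t \<le> 1" using c by (simp add: flat_def)
    then have "H t \<le> \<theta> * 1" unfolding H_def using \<theta>(1) by (intro mult_left_mono) auto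
    then show ?thesis using \<theta>(2) by simp
  qed
  have "annulus_point 0 0 \<in> D" using D[of 0 0] \<eta>(1) by (simp add: H_def)
  then have "1 \<in> D" by (simp add: annulus_point_def)
  then have "l \<in> K0" using DK[of 1] by simp
  from f1(3)[OF this] obtain \<delta> where \<delta>: "\<delta> > 0" "\<And>z1 z2. z1 \<in> K0 \<Longrightarrow> z2 \<in> K0 \<Longrightarrow>
      cmod (z1 - l) < \<delta> \<Longrightarrow> cmod (z2 - l) < \<delta> \<Longrightarrow>
      norm (f z2 - f z1) \<le> (norm (f1 z1) + 1) * cmod (z1 - z2)" by blast
  have scale: "cmod (l * w - l * w') = cmod (w - w')" for w w'
    unfolding right_diff_distrib[symmetric] norm_mult l by simp
  have "\<exists>M. \<forall>t\<in>{0..1}.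
    norm (F (annulus_point t (H t)) - F (annulus_point t (- H t))) \<le> M * H t"
  \<comment> \<open>The Whitney condition is used at \<lambda> only; \<open>B1 + 1\<close> is its
    local Lipschitz constant once f1 is bounded.\<close>
  proof (rule flat_gap_Lipschitz[OF cH _ _ _ H_sq _ B \<delta>(1), where L = "B1 + 1"])
    show "0 < H t" if "t \<in> {0<..<1}" for t using flat_pos[OF that] \<theta>(1) by (simp add: H_def)
    show "annulus_point t (H t) \<in> D \<and> annulus_point t (- H t) \<in> D" if "t \<in> {0..1}" for t
      using D[OF that] H0[of t] H_less[of t] by simp
    fix w w' assume w: "w \<in> D" "w' \<in> D" "cmod (w - 1) < \<delta>" "cmod (w' - 1) < \<delta>"
    have "norm (F w - F w') \<le> (norm (f1 (l * w')) + 1) * cmod (w' - w)"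
      using \<delta>(2)[OF DK[OF w(2)] DK[OF w(1)]] w scale[of _ 1] scale[of w' w] by (simp add: F_def)
    also have "norm (f1 (l * w')) = norm (F1 w')" by (simp add: F1_def norm_scaleC l)
    also have "(norm (F1 w') + 1) * cmod (w' - w) \<le> (B1 + 1) * cmod (w - w')"
      using B1[OF w(2)] by (simp add: norm_minus_commute mult_right_mono)
    finally show "norm (F w - F w') \<le> (B1 + 1) * cmod (w - w')" .
  next
    show "\<exists>M. \<forall>t\<in>{0..1}. norm (F (annulus_point t (H t)) - F (annulus_point t (- H t))) \<le> M * H t"
      if "\<And>t. t \<in> {0..1} \<Longrightarrow> norm (F (annulus_point t (H t)) - F (annulus_point t (- H t))) \<le> M * H t" for M
      using that by blast
  qed (simp_all add: H_def)
  then obtain M where M: "\<And>t. t \<in> {0..1} \<Longrightarrow>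
    norm (F (annulus_point t (H t)) - F (annulus_point t (- H t))) \<le> M * H t" by blast
  interpret gap: flat_gap c \<tau> \<theta> \<eta> "max M B" D F F1 "\<lambda>t. \<theta> * flat c \<tau> t" "\<lambda>t. \<theta> * flat_deriv c \<tau> t"
  proof (unfold_locales, unfold H_def[symmetric] H'_def[symmetric])
    show "norm (F (annulus_point t (H t)) - F (annulus_point t (- H t))) \<le> max M B * H t" if "t \<in> {0..1}" for t
      using M[OF that] mult_right_mono[OF max.cobounded1[of M B] H0[of t]] by linarith
    show "norm (F w) \<le> max M B" if "w \<in> D" for w using B[OF that] by simp
  qed (use c \<tau> \<theta> \<eta> H_le D cF1 dF in auto)
  obtain c0 c1 where c01: "c0 > 0" "c1 > 0" and G: "\<And>N Q. gap.tangent Q \<Longrightarrow>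
    norm (F Q - (\<Sum>n<N. (Q - 1) ^ n *\<^sub>C gap.taylor n)) \<le> c0 * c1 ^ N * Gamma (1 + real N * \<tau>) * cmod (Q - 1) ^ N"
    using gap.gevrey_expansion by blast
  define \<Delta> where "\<Delta> \<sigma> = ball (l * of_real (1 - \<sigma> * \<eta>)) \<eta>" for \<sigma> :: real
  have l0: "l \<noteq> 0" using l by auto
  have \<Delta>: "\<exists>Q. q = l * Q \<and> gap.tangent Q" if "q \<in> \<Delta> \<sigma>" "\<bar>\<sigma>\<bar> = 1" for q \<sigma>
  proof (intro exI conjI)
    show "q = l * (q / l)" using l0 by simp
    have "cmod (q / l - of_real (1 - \<sigma> * \<eta>)) = cmod (q - l * of_real (1 - \<sigma> * \<eta>))"
      using scale[of "q / l" "of_real (1 - \<sigma> * \<eta>)"] l0 by simp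
    then show "gap.tangent (q / l)"
      using that unfolding \<Delta>_def gap.tangent_def by (auto simp: dist_norm norm_minus_commute intro!: exI[of _ \<sigma>])
  qed
  have \<Delta>K: "\<Delta> \<sigma> \<subseteq> K0" if "\<bar>\<sigma>\<bar> = 1" for \<sigma>
    using \<Delta>[OF _ that] gap.Cauchy_tangent(2) DK by blast
  \<comment> \<open>The disk is contained in \<open>K0\<close>, so the derivative relative to
    \<open>K0\<close> restricts to it.\<close>
  have hol: "holomorphic_banach_on f (\<Delta> \<sigma>)" if "\<bar>\<sigma>\<bar> = 1" for \<sigma>
    unfolding holomorphic_banach_on_def
    using f1(2) \<Delta>K[OF that] has_derivative_subset by blast
  \<comment> \<open>Rotating back, (q - l)^n = l^n (Q - 1)^n, so the coefficients acquire the factor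
    l^(-n).\<close>
  define a where "a n = inverse l ^ n *\<^sub>C gap.taylor n" for n
  have bound: "norm (f q - (\<Sum>n<N. (q - l) ^ n *\<^sub>C a n)) \<le> c0 * c1 ^ N * Gamma (1 + real N * \<tau>) * cmod (q - l) ^ N"
    if q: "q \<in> \<Delta> \<sigma>" "\<bar>\<sigma>\<bar> = 1" for N q \<sigma>
  proof -
    obtain Q where Q: "q = l * Q" "gap.tangent Q" using \<Delta>[OF q] by blast
    have "(q - l) ^ n *\<^sub>C a n = (Q - 1) ^ n *\<^sub>C gap.taylor n" for n
    proof -
      have "(q - l) * inverse l = Q - 1" using l0 by (simp add: Q(1) field_simps)
      then show ?thesis by (simp add: a_def scaleC_scaleC power_mult_distrib[symmetric])
    qed
    moreover have "cmod (q - l) = cmod (Q - 1)" using scale[of Q 1] by (simp add: Q(1))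
    ultimately show ?thesis using G[OF Q(2), of N] by (simp add: F_def Q(1))
  qed
  have eta1: "\<eta> < 1" using \<eta> by simp
  have ctr: "cmod (l * of_real (1 - \<sigma> * \<eta>)) = 1 - \<sigma> * \<eta>" if "\<bar>\<sigma>\<bar> = 1" for \<sigma>
  proof -
    have "\<bar>\<sigma> * \<eta>\<bar> = \<eta>" using that \<eta>(1) by (simp add: abs_mult)
    then show ?thesis using eta1 unfolding norm_mult l norm_of_real by simp
  qed
  have m: "\<Delta> 1 \<subseteq> {q. cmod q < 1}"
  proof
    fix q assume "q \<in> \<Delta> 1"
    then have "cmod (q - l * of_real (1 - 1 * \<eta>)) < \<eta>" by (simp add: \<Delta>_def dist_norm norm_minus_commute)
    then show "q \<in> {q. cmod q < 1}"
      using norm_triangle_ineq2[of q "l * of_real (1 - 1 * \<eta>)"] ctr[of 1] by simp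
  qed
  have p: "\<Delta> (-1) \<subseteq> {q. cmod q > 1}"
  proof
    fix q assume "q \<in> \<Delta> (-1)"
    then have "cmod (l * of_real (1 - (-1) * \<eta>) - q) < \<eta>" by (simp add: \<Delta>_def dist_norm)
    then show "q \<in> {q. cmod q > 1}"
      using norm_triangle_ineq2[of "l * of_real (1 - (-1) * \<eta>)" q] ctr[of "-1"] by simp
  qed
  have "\<Delta> \<sigma> \<subseteq> (\<Union>j. K_seq \<kappa> d \<alpha> \<gamma> j)" if "\<bar>\<sigma>\<bar> = 1" for \<sigma>
    using \<Delta>K[OF that] unfolding K0_def by blast
  moreover have "tangent_disk l (\<Delta> \<sigma>)" if "\<bar>\<sigma>\<bar> = 1" for \<sigma>
    unfolding \<Delta>_def by (rule tangent_disk_ball[OF l that \<eta>(1) eta1])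
  moreover have "\<forall>N. \<forall>q\<in>\<Delta> 1 \<union> \<Delta> (-1). norm (f q - (\<Sum>n<N. (q - l) ^ n *\<^sub>C a n))
      \<le> c0 * c1 ^ N * Gamma (1 + real N * \<tau>) * cmod (q - l) ^ N"
    using bound by auto
  ultimately show "f \<in> gevrey \<tau> l (\<Union>j. K_seq \<kappa> d \<alpha> \<gamma> j)"
    unfolding gevrey_def mem_Collect_eq using m p hol c01
    by (intro exI[of _ "\<Delta> 1"] exI[of _ "\<Delta> (-1)"] conjI exI[of _ a] exI[of _ c0] exI[of _ c1]) auto
qed

end
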